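(* There exists a global constant $\mathbf K>0$ such that the following holds. Let $M=\Gamma\backslash\mathbb H^2$ be a convex co-compact hyperbolic surface with limit set $\Lambda_\Gamma\subset\mathbb S^1$ of dimension $\delta\in(0,1)$, and let $\mathbf C\ge1$ be a constant such that $\Lambda_\Gamma$ is $\delta$-regular with constant $\mathbf C$. Then $\Lambda_\Gamma$ satisfies the additive energy bound with exponent $$\beta_E:=\delta\exp\big[-\mathbf K(1-\delta)^{-28}(1+\log^{14}\mathbf C)\big].$$
   Context: Convex co-compact surface: $\Gamma\subset\mathrm{PSO}(1,2)$ is a discrete group of isometries of $\mathbb H^2$ such that $M=\Gamma\backslash\mathbb H^2$ is a smooth surface with compact convex core. Limit set: in the disk model, $\Lambda_\Gamma=\overline{\{\gamma.x\mid\gamma\in\Gamma\}}\cap\mathbb S^1$ for any $x\in\mathbb H^2$. Its dimension $\delta$ is the smallest number such that $\sum_{\gamma\in\Gamma}\exp(-s\,d_{\mathbb H^2}(x,\gamma.x'))<\infty$ for all $x,x'\in\mathbb H^2$ and $\operatorname{Re}s>\delta$ (it equals the Hausdorff dimension of $\Lambda_\Gamma$). Regularity: a closed subset $\mathcal X$ of a complete metric space $\mathcal M$ (with more than one element) is $\delta$-regular with constant $C_{\mathcal X}$ if $C_{\mathcal X}^{-1}r^\delta\le\mu_\delta(\mathcal X\cap B(x,r))\le C_{\mathcal X}r^\delta$ for all $x\in\mathcal X$ and $0<r<\operatorname{diam}(\mathcal M)$, where $\mu_\delta$ is the $\delta$-dimensional Hausdorff measure. Here $\mathcal M=\mathbb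 S^1\subset\mathbb R^2$ with the Euclidean distance. Additive energy: for a subset $\mathcal X$ of a one-dimensional inner product space and $\alpha>0$, $$E_A(\mathcal X,\alpha)=\alpha^{-4}\mu_L\big(\{(\eta_1,\eta_2,\eta_3,\eta_4)\in\mathcal X(\alpha)^4\mid|\eta_1-\eta_2+\eta_3-\eta_4|\le\alpha\}\big),$$ where $\mathcal X(\alpha)$ is the $\alpha$-neighborhood of $\mathcal X$ and $\mu_L$ is Lebesgue measure. For $y\ne y'\in\mathbb S^1\subset\mathbb R^2$ put $\mathcal G(y,y')=\frac{y'-(y\cdot y')y}{1-y\cdot y'}$, which is orthogonal to $y$ and regarded as an element of $T_y\mathbb S^1$; $\mathcal G(y_0,\Lambda_\Gamma)=\{\mathcal G(y_0,y')\mid y'\in\Lambda_\Gamma\setminus\{y_0\}\}$. $\Lambda_\Gamma$ satisfies the additive energy bound with exponent $\beta_E>0$ if for each $C_1>0$ there exists $C>0$ such that for all $\alpha\in(0,1)$, $$\sup_{y_0\in\Lambda_\Gamma}E_A\big(\mathcal G(y_0,\Lambda_\Gamma)\cap B(0,C_1),\alpha\big)\le C\alpha^{-3\delta+\beta_E}.$$ $\log^{14}\mathbf C=(\log\mathbf C)^{14}$. *)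

theory Defs
  imports "HOL-Analysis.Analysis"
begin

text \<open>Hyperboloid model; coordinate 1 of \<open>real^3\<close> is the time coordinate.\<close>

definition mink :: "real^3 \<Rightarrow> real^3 \<Rightarrow> real" where
  "mink x y = x$1 * y$1 - x$2 * y$2 - x$3 * y$3"

definition H2 :: "(real^3) set" where
  "H2 = {x. mink x x = 1 \<and> x$1 > 0}"

definition hdist :: "real^3 \<Rightarrow> real^3 \<Rightarrow> real" where
  "hdist x y = arcosh (mink x y)"

text \<open>The group of linear maps preserving the Minkowski form, the orientation and the time
  direction, that is, the orientation-preserving isometries of the hyperbolic plane.\<close>

definition PSO12 :: "(real^3^3) set" where
  "PSO12 = {A. (\<forall>x y. mink (A *v x) (A *v y) = mink x y) \<and> det A = 1 \<and> (\<forall>x\<in>H2. A *v x \<in> H2)}"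

definition discrete_isometry_group :: "(real^3^3) set \<Rightarrow> bool" where
  "discrete_isometry_group \<Gamma> \<longleftrightarrow>
     \<Gamma> \<subseteq> PSO12 \<and> mat 1 \<in> \<Gamma> \<and> (\<forall>A\<in>\<Gamma>. \<forall>B\<in>\<Gamma>. A ** B \<in> \<Gamma>) \<and> (\<forall>A\<in>\<Gamma>. matrix_inv A \<in> \<Gamma>) \<and>
     discrete \<Gamma>"

text \<open>Stereographic projection from \<open>(-1,0,0)\<close>: the isometry from the hyperboloid onto the
  Poincare disk.\<close>

definition to_disk :: "real^3 \<Rightarrow> real^2" where
  "to_disk x = vector [x$2 / (1 + x$1), x$3 / (1 + x$1)]"

definition limit_set_from :: "real^3 \<Rightarrow> (real^3^3) set \<Rightarrow> (real^2) set" where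
  "limit_set_from x \<Gamma> = closure ((\<lambda>\<gamma>. to_disk (\<gamma> *v x)) ` \<Gamma>) \<inter> sphere 0 1"

text \<open>The base point is immaterial, see \<open>limit_set_eq\<close> below.\<close>

definition limit_set :: "(real^3^3) set \<Rightarrow> (real^2) set" where
  "limit_set \<Gamma> = limit_set_from (vector [1, 0, 0]) \<Gamma>"

lemma to_disk_norm:
  assumes "u \<in> H2"
  shows "1 - (norm (to_disk u))\<^sup>2 = 2 / (1 + u$1)"
proof -
  have u: "(u$2)\<^sup>2 + (u$3)\<^sup>2 = (u$1)\<^sup>2 - 1" "u$1 > 0"
    using assms by (auto simp: H2_def mink_def power2_eq_square)
  have "(norm (to_disk u))\<^sup>2 = ((u$2)\<^sup>2 + (u$3)\<^sup>2) / (1 + u$1)\<^sup>2"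
    unfolding power2_norm_eq_inner
    by (simp add: to_disk_def inner_vec_def sum_2 vector_2 power2_eq_square add_divide_distrib)
  also have "\<dots> = ((u$1 - 1) * (1 + u$1)) / ((1 + u$1) * (1 + u$1))"
    unfolding u(1) by (simp add: power2_eq_square algebra_simps)
  also have "\<dots> = (u$1 - 1) / (1 + u$1)"
    using u(2) by simp
  finally show ?thesis
    using u(2) by (simp add: field_simps)
qed

lemma to_disk_dist:
  assumes "u \<in> H2" "v \<in> H2"
  shows "(norm (to_disk u - to_disk v))\<^sup>2 = 2 * (mink u v - 1) / ((1 + u$1) * (1 + v$1))"
proof -
  have u: "u$1 > 0" and v: "v$1 > 0"
    using assms by (auto simp: H2_def)
  have "to_disk u \<bullet> to_disk v = (u$1 * v$1 - mink u v) / ((1 + u$1) * (1 + v$1))"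
    by (simp add: to_disk_def inner_vec_def sum_2 vector_2 mink_def add_divide_distrib)
  moreover have "(norm (to_disk u - to_disk v))\<^sup>2
      = (norm (to_disk u))\<^sup>2 + (norm (to_disk v))\<^sup>2 - 2 * (to_disk u \<bullet> to_disk v)"
    by (simp add: power2_norm_eq_inner inner_diff inner_commute)
  ultimately have "(norm (to_disk u - to_disk v))\<^sup>2
      = (1 - 2 / (1 + u$1)) + (1 - 2 / (1 + v$1))
        - 2 * ((u$1 * v$1 - mink u v) / ((1 + u$1) * (1 + v$1)))"
    using to_disk_norm[OF assms(1)] to_disk_norm[OF assms(2)] by linarith
  then show ?thesis
    using u v by (simp add: divide_simps) (simp add: algebra_simps)
qed

lemma to_disk_dist_le:
  assumes "u \<in> H2" "v \<in> H2"
  shows "(norm (to_disk u - to_disk v))\<^sup>2 \<le> \<bar>mink u v - 1\<bar> * (1 - (norm (to_disk u))\<^sup>2)"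
proof -
  have u: "u$1 > 0" and v: "v$1 > 0"
    using assms by (auto simp: H2_def)
  have "2 * (mink u v - 1) / ((1 + u$1) * (1 + v$1))
      \<le> 2 * \<bar>mink u v - 1\<bar> / ((1 + u$1) * 1)"
    using u v by (intro frac_le mult_left_mono mult_pos_pos) simp_all
  then show ?thesis
    using to_disk_dist[OF assms] to_disk_norm[OF assms(1)] by (simp add: mult.commute)
qed

lemma limit_set_from_subset:
  assumes "\<Gamma> \<subseteq> PSO12" "x \<in> H2" "x' \<in> H2"
  shows "limit_set_from x \<Gamma> \<subseteq> limit_set_from x' \<Gamma>"
proof
  fix \<xi> assume xi: "\<xi> \<in> limit_set_from x \<Gamma>"
  then obtain p where "\<And>n. p n \<in> (\<lambda>\<gamma>. to_disk (\<gamma> *v x)) ` \<Gamma>" and lim: "p \<longlonglongrightarrow> \<xi>"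
    and n1: "norm \<xi> = 1"
    by (auto simp: limit_set_from_def closure_sequential)
  then obtain g where g: "\<And>n. g n \<in> \<Gamma>" and p: "\<And>n. p n = to_disk (g n *v x)"
    by (simp add: image_iff) metis
  define q where "q n = to_disk (g n *v x')" for n
  have le: "(norm (p n - q n))\<^sup>2 \<le> \<bar>mink x x' - 1\<bar> * (1 - (norm (p n))\<^sup>2)" for n
  proof -
    have "g n \<in> PSO12" using g assms(1) by blast
    then have "g n *v x \<in> H2" "g n *v x' \<in> H2" "mink (g n *v x) (g n *v x') = mink x x'"
      using assms by (auto simp: PSO12_def)
    then show ?thesis
      unfolding p q_def by (metis to_disk_dist_le)
  qed
  have "(\<lambda>n. \<bar>mink x x' - 1\<bar> * (1 - (norm (p n))\<^sup>2)) \<longlonglongrightarrow> \<bar>mink x x' - 1\<bar> * (1 - (norm \<xi>)\<^sup>2)"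
    by (intro tendsto_intros lim)
  then have "(\<lambda>n. \<bar>mink x x' - 1\<bar> * (1 - (norm (p n))\<^sup>2)) \<longlonglongrightarrow> 0"
    by (simp add: n1)
  then have "(\<lambda>n. (norm (p n - q n))\<^sup>2) \<longlonglongrightarrow> 0"
    by (rule tendsto_sandwich[OF _ _ tendsto_const, rotated 2]) (simp_all add: le)
  then have "(\<lambda>n. p n - q n) \<longlonglongrightarrow> 0"
    by (simp add: tendsto_norm_zero_iff)
  then have "(\<lambda>n. p n - (p n - q n)) \<longlonglongrightarrow> \<xi> - 0"
    by (intro tendsto_diff lim)
  then have "q \<longlonglongrightarrow> \<xi>" by simp
  moreover have "\<And>n. q n \<in> (\<lambda>\<gamma>. to_disk (\<gamma> *v x')) ` \<Gamma>"
    using g by (auto simp: q_def)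
  ultimately show "\<xi> \<in> limit_set_from x' \<Gamma>"
    using n1 by (auto simp: limit_set_from_def closure_sequential)
qed

lemma limit_set_eq:
  assumes "\<Gamma> \<subseteq> PSO12" "x \<in> H2"
  shows "limit_set_from x \<Gamma> = limit_set \<Gamma>"
proof -
  have "vector [1, 0, 0] \<in> H2"
    by (simp add: H2_def mink_def vector_3)
  then show ?thesis
    unfolding limit_set_def using limit_set_from_subset[OF assms(1)] assms(2) by blast
qed

definition poincare_series_converge :: "(real^3^3) set \<Rightarrow> complex \<Rightarrow> bool" where
  "poincare_series_converge \<Gamma> s \<longleftrightarrow>
     (\<forall>x\<in>H2. \<forall>x'\<in>H2. (\<lambda>\<gamma>. exp (- s * of_real (hdist x (\<gamma> *v x')))) summable_on \<Gamma>)"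

text \<open>A relation and not an \<open>Inf\<close>: for finite \<open>\<Gamma>\<close> there is no smallest such real number.\<close>

definition limit_set_dimension :: "(real^3^3) set \<Rightarrow> real \<Rightarrow> bool" where
  "limit_set_dimension \<Gamma> \<delta> \<longleftrightarrow>
     (\<forall>s. Re s > \<delta> \<longrightarrow> poincare_series_converge \<Gamma> s) \<and>
     (\<forall>\<delta>'. (\<forall>s. Re s > \<delta>' \<longrightarrow> poincare_series_converge \<Gamma> s) \<longrightarrow> \<delta> \<le> \<delta>')"

definition geodesically_convex :: "(real^3) set \<Rightarrow> bool" where
  "geodesically_convex S \<longleftrightarrow> S \<subseteq> H2 \<and>
     (\<forall>x\<in>S. \<forall>y\<in>S. \<forall>z\<in>H2. hdist x z + hdist z y = hdist x y \<longrightarrow> z \<in> S)"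

definition complete_geodesic :: "(real \<Rightarrow> real^3) \<Rightarrow> real^2 \<Rightarrow> real^2 \<Rightarrow> bool" where
  "complete_geodesic c \<xi> \<eta> \<longleftrightarrow>
     (\<forall>t. c t \<in> H2) \<and> (\<forall>s t. hdist (c s) (c t) = \<bar>s - t\<bar>) \<and>
     ((\<lambda>t. to_disk (c t)) \<longlongrightarrow> \<xi>) at_bot \<and> ((\<lambda>t. to_disk (c t)) \<longlongrightarrow> \<eta>) at_top"

definition hyperbolic_hull :: "(real^2) set \<Rightarrow> (real^3) set" where
  "hyperbolic_hull L = \<Inter>{S. geodesically_convex S \<and>
     (\<forall>\<xi>\<in>L. \<forall>\<eta>\<in>L. \<forall>c. complete_geodesic c \<xi> \<eta> \<longrightarrow> range c \<subseteq> S)}"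

definition orbit :: "(real^3^3) set \<Rightarrow> real^3 \<Rightarrow> (real^3) set" where
  "orbit \<Gamma> x = (\<lambda>\<gamma>. \<gamma> *v x) ` \<Gamma>"

text \<open>The convex core is the image of the hull of the limit set under the projection
  \<open>orbit \<Gamma>\<close> to the orbit space; \<open>quotient_map\<close> determines the topology \<open>Q\<close> uniquely.\<close>

definition compact_convex_core :: "(real^3^3) set \<Rightarrow> bool" where
  "compact_convex_core \<Gamma> \<longleftrightarrow>
     (\<exists>Q. quotient_map (top_of_set (hyperbolic_hull (limit_set \<Gamma>))) Q (orbit \<Gamma>) \<and> compact_space Q)"

text \<open>A discrete group of isometries acts properly discontinuously, so its orbit space is a smooth
  hyperbolic surface covered by the hyperbolic plane precisely when the action is free.\<close>

definition acts_freely :: "(real^3^3) set \<Rightarrow> bool" where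
  "acts_freely \<Gamma> \<longleftrightarrow> (\<forall>\<gamma>\<in>\<Gamma>. \<forall>x\<in>H2. \<gamma> *v x = x \<longrightarrow> \<gamma> = mat 1)"

definition convex_cocompact :: "(real^3^3) set \<Rightarrow> bool" where
  "convex_cocompact \<Gamma> \<longleftrightarrow> discrete_isometry_group \<Gamma> \<and> acts_freely \<Gamma> \<and> compact_convex_core \<Gamma>"

text \<open>Without the factor \<open>\<pi> powr (\<delta>/2) / (2 powr \<delta> * Gamma (\<delta>/2 + 1))\<close> that some authors
  include. Meant for \<open>\<delta> > 0\<close>: at \<open>\<delta> = 0\<close> the convention \<open>0 powr 0 = 0\<close> would discard singletons.\<close>

definition hausdorff_content :: "real \<Rightarrow> real \<Rightarrow> 'a::metric_space set \<Rightarrow> ennreal" where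
  "hausdorff_content \<delta> \<epsilon> A =
     (INF U \<in> {U :: nat \<Rightarrow> 'a set. A \<subseteq> (\<Union>i. U i) \<and> (\<forall>i. bounded (U i) \<and> diameter (U i) \<le> \<epsilon>)}.
        \<Sum>i. ennreal (diameter (U i) powr \<delta>))"

definition hausdorff_measure :: "real \<Rightarrow> 'a::metric_space set \<Rightarrow> ennreal" where
  "hausdorff_measure \<delta> A = (SUP \<epsilon>\<in>{0<..}. hausdorff_content \<delta> \<epsilon> A)"

text \<open>\<open>X\<close> is a regular subset of the complete metric space \<open>M\<close>. The guard \<open>bounded M\<close> is there
  because \<open>diameter\<close> is unspecified, rather than infinite, on unbounded sets.\<close>

definition regular_set :: "'a::metric_space set \<Rightarrow> 'a set \<Rightarrow> real \<Rightarrow> real \<Rightarrow> bool" where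
  "regular_set M X \<delta> C \<longleftrightarrow>
     complete M \<and> closedin (top_of_set M) X \<and> (\<exists>x\<in>X. \<exists>y\<in>X. x \<noteq> y) \<and>
     (\<forall>x\<in>X. \<forall>r. 0 < r \<and> (bounded M \<longrightarrow> r < diameter M) \<longrightarrow>
        ennreal (inverse C * r powr \<delta>) \<le> hausdorff_measure \<delta> (X \<inter> ball x r) \<and>
        hausdorff_measure \<delta> (X \<inter> ball x r) \<le> ennreal (C * r powr \<delta>))"

text \<open>Lebesgue measure on a one-dimensional subspace \<open>V\<close> of a Euclidean space, transported by a
  linear isometry from the line; \<open>line_lebesgue_eq\<close> shows that the choice does not matter.\<close>

definition line_lebesgue :: "'a::euclidean_space set \<Rightarrow> 'a measure" where
  "line_lebesgue V = distr lborel borel (\<lambda>t::real. t *\<^sub>R (SOME e. e \<in> V \<and> norm e = 1))"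

lemma line_lebesgue_eq:
  fixes V :: "'a::euclidean_space set"
  assumes V: "subspace V" "dim V = 1" and e: "e \<in> V" "norm e = 1"
  shows "line_lebesgue V = distr lborel borel (\<lambda>t::real. t *\<^sub>R e)"
proof -
  define e' where "e' = (SOME e. e \<in> V \<and> norm e = 1)"
  have e': "e' \<in> V" "norm e' = 1"
    using someI[of "\<lambda>e. e \<in> V \<and> norm e = 1" e] e by (auto simp: e'_def)
  have "{e} \<subseteq> V" "dim V \<le> dim {e}"
    using V e by (auto simp: dim_singleton)
  then have "span {e} = span V"
    by (rule dim_eq_span)
  also have "span V = V"
    using V(1) by (simp add: span_eq_iff)
  finally have "e' \<in> span {e}"
    using e' by simp
  then obtain k where k: "e' = k *\<^sub>R e"
    by (auto simp: span_singleton)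
  then have "\<bar>k\<bar> = 1" using e e' by simp
  then consider "e' = e" | "e' = - e" using k by (cases "k \<ge> 0") force+
  then show ?thesis
  proof cases
    case 1
    then show ?thesis by (simp add: line_lebesgue_def flip: e'_def)
  next
    case 2
    have "distr lborel borel (\<lambda>t::real. t *\<^sub>R e)
        = distr (distr lborel borel uminus) borel (\<lambda>t::real. t *\<^sub>R e)"
      by (simp add: lborel_distr_uminus)
    also have "\<dots> = distr lborel borel ((\<lambda>t::real. t *\<^sub>R e) \<circ> uminus)"
      by (rule distr_distr) measurable
    finally show ?thesis using 2 by (simp add: line_lebesgue_def o_def flip: e'_def)
  qed
qed

definition nbhd_in :: "'a::euclidean_space set \<Rightarrow> 'a set \<Rightarrow> real \<Rightarrow> 'a set" where
  "nbhd_in V X \<alpha> = V \<inter> (\<Union>x\<in>X. ball x \<alpha>)"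

definition additive_energy :: "'a::euclidean_space set \<Rightarrow> 'a set \<Rightarrow> real \<Rightarrow> ennreal" where
  "additive_energy V X \<alpha> =
     ennreal (\<alpha> powi (-4)) *
     emeasure (line_lebesgue V \<Otimes>\<^sub>M line_lebesgue V \<Otimes>\<^sub>M line_lebesgue V \<Otimes>\<^sub>M line_lebesgue V)
       {(\<eta>1, \<eta>2, \<eta>3, \<eta>4).
          \<eta>1 \<in> nbhd_in V X \<alpha> \<and> \<eta>2 \<in> nbhd_in V X \<alpha> \<and> \<eta>3 \<in> nbhd_in V X \<alpha> \<and> \<eta>4 \<in> nbhd_in V X \<alpha> \<and>
          norm (\<eta>1 - \<eta>2 + \<eta>3 - \<eta>4) \<le> \<alpha>}"

definition tangent_line :: "real^2 \<Rightarrow> (real^2) set" where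
  "tangent_line y = {v. v \<bullet> y = 0}"

definition stereo :: "real^2 \<Rightarrow> real^2 \<Rightarrow> real^2" where
  "stereo y y' = (1 / (1 - y \<bullet> y')) *\<^sub>R (y' - (y \<bullet> y') *\<^sub>R y)"

definition additive_energy_bound :: "(real^2) set \<Rightarrow> real \<Rightarrow> real \<Rightarrow> bool" where
  "additive_energy_bound L \<delta> \<beta> \<longleftrightarrow> \<beta> > 0 \<and>
     (\<forall>C1>0. \<exists>C>0. \<forall>\<alpha>\<in>{0<..<1}.
        (SUP y0\<in>L. additive_energy (tangent_line y0) (stereo y0 ` (L - {y0}) \<inter> ball 0 C1) \<alpha>)
          \<le> ennreal (C * \<alpha> powr (- 3 * \<delta> + \<beta>)))"

end

theory Submission
  imports Defs
begin

text \<open>Only the regularity of the limit set matters. In the stereographic coordinate the limit set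
  is a regular subset \<open>X\<close> of the line; replace it by a maximal \<open>\<alpha>\<close>-separated subset \<open>V\<close>.

  If many quadruples satisfy \<open>x + a - b \<approx> x'\<close>, then by Cauchy-Schwarz many tuples
  \<open>(x, a\<^sub>1, b\<^sub>1, \<dots>, a\<^sub>n, b\<^sub>n)\<close> in \<open>V\<close> have \<open>x + a\<^sub>1 - b\<^sub>1 + \<dots> + a\<^sub>n - b\<^sub>n\<close> close to \<open>V\<close>, so it
  suffices to see that this proportion decays by a fixed factor from each scale to a suitable finer
  one. That follows if, for arbitrary balls of equal radius centred in \<open>V\<close>, the sum of the traces of
  \<open>V\<close> on them cannot stay close to \<open>V\<close>. All these traces and \<open>V\<close> have the same dimension \<open>\<delta>\<close>,
  whereas the sum set is too large: a trace has size at most \<open>2\<close> to the number of dyadic scales at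
  which it has a pair of points, and suitable pairs taken from the summands fill all these scales in
  the sum set and in addition one empty scale next to each of the many runs of empty scales
  (there are many because the runs are short and \<open>\<delta> < 1\<close>).\<close>

section \<open>Sums with the vertices of a cube\<close>

text \<open>Where the size of the exponent comes from. Regularity holds up to factors
  \<open>2 ^ k\<close> with \<open>k\<close> of order 1 + log C. Over \<open>W\<close> dyadic scales
  a trace therefore has \<delta> W good scales, and \<open>V\<close> occupies 2 to the power
  \<delta> W intervals, each with an error of order \<open>k\<close> in the exponent. The gain of
  one scale per empty run must beat this error. Empty runs are shorter than \<open>v\<close>, of
  order k / \<delta>, so about (1 - \<delta>) W empty scales form at least (1 - \<delta>) W / v
  runs. This forces \<open>W\<close> of order y / \<delta> with
  \<open>y = k ^ 2 / (1 - \<delta>)\<close>, and the number \<open>p\<close> of summands is of order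
  \<delta> W, that is, of order y. Passing to the finer scale removes only the tuples near one
  particular far sum. In each of the \<open>p\<close> coordinates these make up a proportion exp(-
  O(y)), so one step saves a proportion exp(- O(y^2)). It costs a factor \<open>L\<close> in scale,
  with log L of order y / \<delta>. The quotient of the two is an exponent of the form \<delta>
  exp(- K y^2).\<close>

definition thick :: "real set \<Rightarrow> real \<Rightarrow> real" where
  "thick Y t = measure lebesgue (\<Union>y\<in>Y. {y..<y+t})"

lemma lmeasurable_atLeastLessThan: "{a..<b::real} \<in> lmeasurable"
proof (rule fmeasurableI2[of "cbox a b"])
  show "cbox a b \<in> lmeasurable" by (rule lmeasurable_cbox)
qed auto

lemma thick_lmeasurable:
  fixes t :: real
  shows "finite Y \<Longrightarrow> (\<Union>y\<in>Y. {y..<y+t}) \<in> lmeasurable"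
  by (rule fmeasurable.finite_UN, assumption, rule lmeasurable_atLeastLessThan)

lemma thick_mono:
  assumes "finite Y" "Y' \<subseteq> Y" "t' \<le> t"
  shows "thick Y' t' \<le> thick Y t"
proof -
  have "finite Y'" using assms finite_subset by blast
  then show ?thesis unfolding thick_def
  proof (intro measure_mono_fmeasurable thick_lmeasurable fmeasurableD)
    show "(\<Union>y\<in>Y'. {y..<y + t'}) \<subseteq> (\<Union>y\<in>Y. {y..<y + t})"
      using assms(2,3) by (intro UN_mono) auto
  qed (use assms in auto)
qed

lemma thick_singleton: "0 \<le> t \<Longrightarrow> thick {y} t = t"
  by (simp add: thick_def)

lemma thick_translation: "thick ((+) c ` Y) t = thick Y t"
proof -
  have "(\<Union>y\<in>(+) c ` Y. {y..<y+t}) = (+) c ` (\<Union>y\<in>Y. {y..<y+t})"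
  proof
    show "(\<Union>y\<in>(+) c ` Y. {y..<y+t}) \<subseteq> (+) c ` (\<Union>y\<in>Y. {y..<y+t})"
    proof
      fix x assume "x \<in> (\<Union>y\<in>(+) c ` Y. {y..<y+t})"
      then obtain y where "y \<in> Y" "c + y \<le> x" "x < c + y + t" by auto
      then show "x \<in> (+) c ` (\<Union>y\<in>Y. {y..<y+t})"
        by (intro image_eqI[of _ _ "x - c"]) (auto intro!: bexI[of _ y])
    qed
  qed auto
  then show ?thesis by (simp add: thick_def measure_translation)
qed

text \<open>Concavity in the thickness: a point covered at thickness \<open>t + h + d\<close> but
  not at \<open>t + h\<close>, moved left by \<open>h\<close>, is covered at \<open>t + d\<close>
  but not at \<open>t\<close>.\<close>

lemma thick_increment_decreasing:
  assumes "finite Y" "0 \<le> t" "0 \<le> h" "0 \<le> d"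
  shows "thick Y (t + h + d) - thick Y (t + h) \<le> thick Y (t + d) - thick Y t"
proof -
  let ?Z = "\<lambda>t. \<Union>y\<in>Y. {y..<y+t}"
  have m: "?Z t \<in> lmeasurable" for t using assms thick_lmeasurable by blast
  have diff: "thick Y (t + d) - thick Y t = measure lebesgue (?Z (t+d) - ?Z t)" for t
  proof -
    have "?Z t \<subseteq> ?Z (t+d)" using assms(4) by (intro UN_mono) auto
    then show ?thesis
      unfolding thick_def using m by (intro measurable_measure_Diff[symmetric] fmeasurableD) auto
  qed
  have "?Z (t+h+d) - ?Z (t+h) \<subseteq> (+) h ` (?Z (t+d) - ?Z t)"
  proof
    fix x assume x: "x \<in> ?Z (t+h+d) - ?Z (t+h)"
    then obtain y where y: "y \<in> Y" "y \<le> x" "x < y+t+h+d" by auto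
    have no: "\<not> (y' \<le> x \<and> x < y' + (t+h))" if "y' \<in> Y" for y' using x that by auto
    have "t + h \<le> x - y" using no[OF y(1)] y by linarith
    show "x \<in> (+) h ` (?Z (t+d) - ?Z t)"
    proof (rule image_eqI[of _ _ "x - h"])
      show "x - h \<in> ?Z (t+d) - ?Z t"
      proof
        show "x - h \<notin> ?Z t" using no assms by force
        show "x - h \<in> ?Z (t+d)"
          using y \<open>t + h \<le> x - y\<close> assms by (intro UN_I[OF y(1)]) auto
      qed
    qed simp
  qed
  then have "measure lebesgue (?Z (t+h+d) - ?Z (t+h)) \<le> measure lebesgue ((+) h ` (?Z (t+d) - ?Z t))"
    using m by (intro measure_mono_fmeasurable measurable_translation fmeasurable_Diff fmeasurableD) auto
  also have "\<dots> = measure lebesgue (?Z (t+d) - ?Z t)"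
    by (rule measure_translation)
  finally show ?thesis by (simp add: diff)
qed

lemma thick_double:
  assumes "finite Y" "0 \<le> t"
  shows "thick Y (2 * t) \<le> 2 * thick Y t"
  using thick_increment_decreasing[OF assms(1), of 0 t t] assms by (simp add: thick_def)

text \<open>By concavity and the value 0 at thickness 0, the quotient of \<open>thick Y t\<close> by
  \<open>t\<close> does not increase; this compares it at \<open>2 * t\<close> and
  \<open>3/2 * t\<close>.\<close>

lemma thick_double_three_halves:
  assumes "finite Y" "0 \<le> t"
  shows "3 * thick Y (2 * t) \<le> 4 * thick Y (3/2 * t)"
  using thick_increment_decreasing[OF assms(1), of t "t/2" "t/2"] 
     thick_increment_decreasing[OF assms(1), of "t/2" "t/2" "t/2"] 
     thick_increment_decreasing[OF assms(1), of 0 "t/2" "t/2"] assms by (simp add: thick_def)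

text \<open>Since \<tau> \<le> t, each translated interval starts no later than the original one
  ends, so the two leave no hole.\<close>

lemma thick_Un_translation:
  assumes "finite Y" "0 \<le> \<tau>" "\<tau> \<le> t"
  shows "thick Y (t + \<tau>) \<le> thick (Y \<union> (+) \<tau> ` Y) t"
  unfolding thick_def
proof (intro measure_mono_fmeasurable thick_lmeasurable fmeasurableD)
  show "(\<Union>y\<in>Y. {y..<y + (t + \<tau>)}) \<subseteq> (\<Union>y\<in>Y \<union> (+) \<tau> ` Y. {y..<y + t})"
  proof
    fix x assume "x \<in> (\<Union>y\<in>Y. {y..<y + (t + \<tau>)})"
    then obtain y where y: "y \<in> Y" "y \<le> x" "x < y + t + \<tau>" by auto
    show "x \<in> (\<Union>y\<in>Y \<union> (+) \<tau> ` Y. {y..<y + t})"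
    proof (cases "x < y + t")
      case True
      then show ?thesis using y by (intro UN_I[of y]) auto
    next
      case False
      then show ?thesis using y assms by (intro UN_I[of "\<tau> + y"]) auto
    qed
  qed
qed (use assms in auto)

text \<open>A Hilbert cube. Each index stands for a free choice between the two points of a pair at
  distance \<open>\<tau> j\<close>, with the lower points moved to 0.\<close>

definition cube :: "('j \<Rightarrow> real) \<Rightarrow> 'j set \<Rightarrow> real set" where
  "cube \<tau> S = sum \<tau> ` Pow S"

lemma finite_cube: "finite S \<Longrightarrow> finite (cube \<tau> S)"
  by (simp add: cube_def)

lemma cube_mono: "S \<subseteq> S' \<Longrightarrow> cube \<tau> S \<subseteq> cube \<tau> S'"
  by (auto simp: cube_def)

lemma cube_empty: "cube \<tau> {} = {0}"
  by (simp add: cube_def)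

lemma cube_insert:
  assumes "finite S" "j \<notin> S"
  shows "cube \<tau> (insert j S) = cube \<tau> S \<union> (+) (\<tau> j) ` cube \<tau> S"
proof -
  have "sum \<tau> (insert j T) = \<tau> j + sum \<tau> T" if "T \<in> Pow S" for T
    using that assms finite_subset[of T S] by (subst sum.insert) auto
  then have "sum \<tau> ` insert j ` Pow S = (+) (\<tau> j) ` sum \<tau> ` Pow S"
    by (auto simp: image_image intro!: image_eqI)
  then show ?thesis by (simp add: cube_def Pow_insert image_Un)
qed

text \<open>Every translation is worth at least \<open>s / 2\<close> of thickness. The induction
  hypothesis is applied at a larger thickness, so the condition \<open>s \<le> t\<close>, which
  prevents holes, is preserved.\<close>

lemma thick_cube_Un:
  fixes s t :: real
  assumes "finite K" "finite S" "K \<inter> S = {}" "0 \<le> s" "s \<le> t"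
    and "\<And>j. j \<in> K \<Longrightarrow> s / 2 \<le> \<tau> j \<and> \<tau> j < s"
  shows "thick (cube \<tau> S) (t + card K * s / 2) \<le> thick (cube \<tau> (S \<union> K)) t"
  using assms(1,3,5,6)
proof (induction K arbitrary: t rule: finite_induct)
  case empty
  then show ?case by simp
next
  case (insert j K)
  have fin: "finite (cube \<tau> (S \<union> K))" using insert assms by (simp add: finite_cube)
  have j: "s / 2 \<le> \<tau> j" "\<tau> j < s" using insert by auto
  have "thick (cube \<tau> S) (t + card (insert j K) * s / 2)
      = thick (cube \<tau> S) ((t + s / 2) + card K * s / 2)"
    using insert by (simp add: field_simps)
  also have "\<dots> \<le> thick (cube \<tau> (S \<union> K)) (t + s / 2)"
    using insert assms by (intro insert.IH) auto
  also have "\<dots> \<le> thick (cube \<tau> (S \<union> K)) (t + \<tau> j)"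
    using fin j by (intro thick_mono) auto
  also have "\<dots> \<le> thick (cube \<tau> (S \<union> K) \<union> (+) (\<tau> j) ` cube \<tau> (S \<union> K)) t"
    using fin j insert.prems(2) assms(4) by (intro thick_Un_translation) linarith+
  also have "\<dots> = thick (cube \<tau> (S \<union> insert j K)) t"
    using insert assms by (subst cube_insert[symmetric]) auto
  finally show ?case .
qed

section \<open>Growth of a Hilbert cube through the dyadic scales\<close>

locale dyadic_cube =
  fixes s0 :: real and \<tau> :: "'j \<Rightarrow> real" and g :: "'j \<Rightarrow> nat" and S :: "'j set"
  assumes s0_pos: "0 < s0" and finite_S: "finite S" and g_pos: "j \<in> S \<Longrightarrow> 0 < g j"
    and \<tau>_lower: "j \<in> S \<Longrightarrow> s0 / 2 ^ g j / 2 \<le> \<tau> j"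
    and \<tau>_upper: "j \<in> S \<Longrightarrow> \<tau> j < s0 / 2 ^ g j"
begin

definition fibre :: "nat \<Rightarrow> 'j set" where
  "fibre i = {j \<in> S. g j = i}"

definition lev :: "nat \<Rightarrow> 'j set" where
  "lev i = {j \<in> S. g j \<le> i}"

text \<open>Comparable to the number of intervals of length \<open>s0 / 2 ^ i\<close> needed to
  cover the sums built from scales up to \<open>i\<close>. Measuring instead of counting gives exact
  growth factors without rounding.\<close>

definition cnt :: "nat \<Rightarrow> real" where
  "cnt i = thick (cube \<tau> (lev i)) (s0 / 2 ^ i) / (s0 / 2 ^ i)"

text \<open>Six, because \<open>m\<close> translations multiply the thickness by
  \<open>1 + m / 2\<close>, and \<open>1 + 6 / 2 = 4\<close> amounts to two dyadic scales.\<close>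

definition full :: "nat set" where
  "full = {i. 6 \<le> card (fibre i)}"

lemma cnt_0: "cnt 0 = 1"
proof -
  have "lev 0 = {}" using g_pos by (auto simp: lev_def)
  then show ?thesis using s0_pos by (simp add: cnt_def cube_empty thick_singleton)
qed

lemma finite_cube_lev: "finite (cube \<tau> (lev i))"
  using finite_S by (intro finite_cube) (auto simp: lev_def)

lemma thick_lev_step:
  assumes "m \<le> card (fibre (Suc i))"
  shows "thick (cube \<tau> (lev i)) ((1 + m / 2) * (s0 / 2 ^ Suc i))
       \<le> thick (cube \<tau> (lev (Suc i))) (s0 / 2 ^ Suc i)"
proof -
  let ?s = "s0 / 2 ^ Suc i"
  have eq: "lev (Suc i) = lev i \<union> fibre (Suc i)"
    by (auto simp: lev_def fibre_def)
  have "thick (cube \<tau> (lev i)) ((1 + m / 2) * ?s)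
      \<le> thick (cube \<tau> (lev i)) (?s + card (fibre (Suc i)) * ?s / 2)"
  proof (intro thick_mono finite_cube_lev order_refl)
    have "m * ?s \<le> card (fibre (Suc i)) * ?s"
      using assms s0_pos by (intro mult_right_mono) auto
    moreover have "(1 + x / 2) * t \<le> t + y * t / 2" if "x * t \<le> y * t" for x y t :: real
      using that by (simp add: algebra_simps)
    ultimately show "(1 + m / 2) * ?s \<le> ?s + card (fibre (Suc i)) * ?s / 2"
      by blast
  qed
  also have "\<dots> \<le> thick (cube \<tau> (lev i \<union> fibre (Suc i))) ?s"
  proof (intro thick_cube_Un order_refl)
    show "?s / 2 \<le> \<tau> j \<and> \<tau> j < ?s" if "j \<in> fibre (Suc i)" for j
      using \<tau>_lower[of j] \<tau>_upper[of j] that by (simp add: fibre_def)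
  qed (use finite_S s0_pos in \<open>auto simp: lev_def fibre_def\<close>)
  finally show ?thesis by (simp add: eq)
qed

lemma cnt_mono_Suc: "cnt i \<le> cnt (Suc i)"
  using thick_lev_step[of 0 i] thick_double[OF finite_cube_lev[of i], of "s0 / 2 ^ Suc i"] s0_pos
  by (simp add: cnt_def field_simps)

text \<open>One translation only raises the thickness from \<open>s\<close> to 3/2 \<open>s\<close>,
  short of the previous unit \<open>2 * s\<close>. By concavity this is still 3/4 of the measure at
  \<open>2 * s\<close>, and halving the unit doubles it.\<close>

lemma cnt_step_one:
  assumes "fibre (Suc i) \<noteq> {}"
  shows "3 / 2 * cnt i \<le> cnt (Suc i)"
proof -
  have "1 \<le> card (fibre (Suc i))"
    using assms finite_S by (simp add: Suc_le_eq card_gt_0_iff fibre_def)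
  then show ?thesis
    using thick_lev_step[of 1 i] thick_double_three_halves[OF finite_cube_lev[of i], of "s0 / 2 ^ Suc i"] s0_pos
    by (simp add: cnt_def field_simps)
qed

lemma cnt_step_two:
  assumes "2 \<le> card (fibre (Suc i))"
  shows "2 * cnt i \<le> cnt (Suc i)"
  using thick_lev_step[of 2 i] assms s0_pos by (simp add: cnt_def field_simps)

text \<open>The thickness obtained is the unit of scale \<open>i\<close>, two levels up, so the
  factor 4 is reached whatever happens at the scale in between.\<close>

lemma cnt_step_six:
  assumes "6 \<le> card (fibre (Suc (Suc i)))"
  shows "4 * cnt i \<le> cnt (Suc (Suc i))"
proof -
  have "thick (cube \<tau> (lev i)) (s0 / 2 ^ i) \<le> thick (cube \<tau> (lev (Suc i))) (s0 / 2 ^ i)"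
    by (intro thick_mono finite_cube_lev cube_mono) (auto simp: lev_def)
  then show ?thesis
    using thick_lev_step[of 6 "Suc i"] assms s0_pos by (simp add: cnt_def field_simps)
qed

lemma cnt_support: "(3 / 2) ^ card {i \<in> {1..W}. fibre i \<noteq> {}} \<le> cnt W"
proof (induction W)
  case 0
  then show ?case by (simp add: cnt_0)
next
  case (Suc W)
  show ?case
  proof (cases "fibre (Suc W) = {}")
    case True
    then have "{i \<in> {1..Suc W}. fibre i \<noteq> {}} = {i \<in> {1..W}. fibre i \<noteq> {}}"
      by (auto simp: le_Suc_eq)
    then show ?thesis using Suc cnt_mono_Suc[of W] by simp
  next
    case False
    then have "{i \<in> {1..Suc W}. fibre i \<noteq> {}} = insert (Suc W) {i \<in> {1..W}. fibre i \<noteq> {}}"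
      by (auto simp: le_Suc_eq)
    then show ?thesis using Suc cnt_step_one[OF False] by simp
  qed
qed

text \<open>Six translations at scale \<open>k + 1\<close> also fill scale \<open>k\<close>; this gain of one scale at the coarse
  end of every run of full scales is what makes the sum set grow faster than its summands.\<close>

lemma cnt_full: "2 ^ card {k \<in> {1..W}. k \<in> full \<or> Suc k \<in> full \<and> Suc k \<le> W} \<le> cnt W"
proof (induction W rule: less_induct)
  case (less W)
  let ?J = "\<lambda>W. {k \<in> {1..W}. k \<in> full \<or> Suc k \<in> full \<and> Suc k \<le> W}"
  have fin: "finite (?J W)" for W by simp
  show ?case
  proof (cases W)
    case 0
    then show ?thesis by (simp add: cnt_0)
  next
    case W: (Suc V)
    show ?thesis
    proof (cases "W \<in> full")
      case False
      then have "?J W = ?J V" using W by (auto simp: le_Suc_eq)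
      then show ?thesis using less[of V] cnt_mono_Suc[of V] W by simp
    next
      case True
      then have six: "6 \<le> card (fibre (Suc V))" using W by (simp add: full_def)
      show ?thesis
      proof (cases "V = 0 \<or> V \<in> full")
        case True
        \<comment> \<open>Only \<open>W\<close> is new: a full \<open>V\<close> is already counted,
          and for \<open>V = 0\<close> the scale before \<open>W\<close> lies outside
          \<open>{1..W}\<close>. A factor 2 is enough.\<close>
        then have "?J W \<subseteq> insert W (?J V)" using W by (auto simp: le_Suc_eq)
        then have "card (?J W) \<le> Suc (card (?J V))"
          using card_mono[of "insert W (?J V)" "?J W"] W by simp
        then have "(2::real) ^ card (?J W) \<le> 2 ^ Suc (card (?J V))" by (intro power_increasing) auto
        also have "\<dots> \<le> 2 * cnt V" using less[of V] W by simp
        also have "\<dots> \<le> cnt W" using cnt_step_two[of V] six W by simp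
        finally show ?thesis .
      next
        case False
        then obtain U where U: "V = Suc U" by (cases V) auto
        \<comment> \<open>\<open>V\<close> is counted because \<open>W\<close> is full. As
          \<open>V\<close> itself is not full, it does not make \<open>U\<close> count, so the
          induction can resume at \<open>U\<close> with exactly two new scales.\<close>
        have "?J W \<subseteq> insert W (insert V (?J U))" using W U False by (auto simp: le_Suc_eq)
        then have "card (?J W) \<le> card (insert W (insert V (?J U)))" by (intro card_mono) auto
        also have "\<dots> \<le> Suc (Suc (card (?J U)))"
          using W U by (subst card_insert_disjoint; simp; subst card_insert_disjoint; simp)
        finally have "card (?J W) \<le> Suc (Suc (card (?J U)))" .
        then have "(2::real) ^ card (?J W) \<le> 2 ^ Suc (Suc (card (?J U)))" by (intro power_increasing) auto
        also have "\<dots> \<le> 4 * cnt U" using less[of U] W U by simp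
        also have "\<dots> \<le> cnt W" using cnt_step_six[of U] six W U by simp
        finally show ?thesis .
      qed
    qed
  qed
qed

end

text \<open>From a missing scale the next element of \<open>I\<close> is fewer than \<open>v\<close>
  scales away, unless the end \<open>W\<close> is. Hence the blocks of \<open>v\<close> scales
  ending at the gap ends, and one more block ending at \<open>W\<close>, contain all missing scales;
  the \<open>Suc\<close> is for \<open>W\<close>.\<close>

lemma card_le_gap_ends:
  fixes I :: "nat set"
  assumes window: "\<And>i. 1 \<le> i \<Longrightarrow> i + v \<le> Suc W \<Longrightarrow> \<exists>k\<in>I. i \<le> k \<and> k < i + v"
    and IW: "I \<subseteq> {1..W}"
  shows "card ({1..W} - I) \<le> Suc (card {k \<in> {1..W} - I. Suc k \<in> I}) * v"
proof -
  let ?E = "insert W {k \<in> {1..W} - I. Suc k \<in> I}"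
  have "{1..W} - I \<subseteq> (\<Union>e\<in>?E. {Suc e - v..e})"
  proof
    fix i assume i: "i \<in> {1..W} - I"
    show "i \<in> (\<Union>e\<in>?E. {Suc e - v..e})"
    proof (cases "\<exists>k\<in>I. i \<le> k")
      case False
      then have "\<not> i + v \<le> Suc W" using window[of i] i by auto
      then show ?thesis using i by (intro UN_I[of W]) auto
    next
      case True
      define k where "k = (LEAST k. k \<in> I \<and> i \<le> k)"
      have k: "k \<in> I" "i \<le> k"
        using LeastI_ex[of "\<lambda>k. k \<in> I \<and> i \<le> k"] True unfolding k_def by blast+
      have least: "k \<le> k'" if "k' \<in> I" "i \<le> k'" for k'
        unfolding k_def using that by (intro Least_le) auto
      have "i < k" using k i by (cases "i = k") auto
      then obtain e where e: "k = Suc e" "i \<le> e" by (cases k) auto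
      have "e \<notin> I" using least[of e] e by auto
      then have eE: "e \<in> ?E" using k e i IW by auto
      have "k < i + v"
      proof (cases "i + v \<le> Suc W")
        case True
        then obtain k' where "k' \<in> I" "i \<le> k'" "k' < i + v" using window[of i] i by auto
        then show ?thesis using least[of k'] by simp
      next
        case False
        then show ?thesis using k IW by auto
      qed
      then show ?thesis using e eE by (intro UN_I[of e]) auto
    qed
  qed
  then have "card ({1..W} - I) \<le> card (\<Union>e\<in>?E. {Suc e - v..e})"
    by (intro card_mono) auto
  also have "\<dots> \<le> (\<Sum>e\<in>?E. card {Suc e - v..e})"
    by (intro card_UN_le) auto
  also have "\<dots> \<le> (\<Sum>e\<in>?E. v)"
    by (intro sum_mono) auto
  also have "\<dots> = card ?E * v" by simp
  also have "\<dots> \<le> Suc (card {k \<in> {1..W} - I. Suc k \<in> I}) * v"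
    by (intro mult_right_mono card_insert_le_m1) (auto simp: card_insert_if)
  finally show ?thesis .
qed

lemma sum_halves: "(\<Sum>i\<in>{1..n}. c / 2 ^ i) = c - c / 2 ^ n" for c :: real
proof (induction n)
  case (Suc n)
  have "(\<Sum>i\<in>{1..Suc n}. c / 2 ^ i) = c - c / 2 ^ n + c / 2 ^ Suc n"
    using Suc by simp
  then show ?case by simp
qed simp

text \<open>Scales start at 1, so that a translation of size close to \<open>s0\<close> never occurs
  and the growth starts from \<open>cnt 0 = 1\<close>.\<close>

definition good_scales :: "real \<Rightarrow> nat \<Rightarrow> real set \<Rightarrow> nat set" where
  "good_scales s0 W B =
     {i \<in> {1..W}. \<exists>b\<in>B. \<exists>b'\<in>B. s0 / 2 ^ i / 2 \<le> b' - b \<and> b' - b < s0 / 2 ^ i}"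

definition selection_sums :: "nat \<Rightarrow> (nat \<Rightarrow> real set) \<Rightarrow> real set" where
  "selection_sums p B = (\<lambda>b. \<Sum>j<p. b j) ` PiE {..<p} B"

text \<open>One pair from each of the sets \<open>B j\<close> is spent on a scale that is good for \<open>B j\<close>. Spending
  greedily, at most six pairs per scale, one meets a \<open>B q\<close> all of whose good scales are full,
  because every scale in use multiplies the size of the sum set by at least \<open>3/2\<close>.\<close>

lemma sumset_growth:
  fixes B :: "nat \<Rightarrow> real set"
  assumes s0: "0 < s0" and ne: "\<And>j. j < p \<Longrightarrow> B j \<noteq> {}"
    and card_good: "\<And>j. j < p \<Longrightarrow> g0 \<le> card (good_scales s0 W (B j))"
    and window: "\<And>j i. j < p \<Longrightarrow> 1 \<le> i \<Longrightarrow> i + v \<le> Suc W \<Longrightarrow>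
                   \<exists>k\<in>good_scales s0 W (B j). i \<le> k \<and> k < i + v"
    and p: "12 * D < p" and W: "(D + 1 - g0) * v + D < W"
  shows "\<exists>Y y. finite Y \<and> Y \<subseteq> selection_sums p B \<and> Y \<subseteq> {y..y + 6 * s0} \<and>
           2 ^ D * (s0 / 2 ^ W) < thick Y (s0 / 2 ^ W)"
proof (rule ccontr)
  assume contra: "\<not> ?thesis"
  let ?G = "\<lambda>j. good_scales s0 W (B j)"
  \<comment> \<open>The cap of six is what a full scale requires. It also keeps the sums within a
    geometric series of total length at most \<open>6 * s0\<close>.\<close>
  define P where "P q g \<longleftrightarrow> (\<forall>j<q. g j \<in> ?G j) \<and> (\<forall>i. card {j. j < q \<and> g j = i} \<le> 6)"
    for q and g :: "nat \<Rightarrow> nat"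
  \<comment> \<open>By \<open>contra\<close> the cube of any admissible choice is too thin, that is,
    \<open>cnt W \<le> 2 ^ D\<close>. The two lower bounds for \<open>cnt W\<close> then limit both
    the scales in use and the full scales together with their predecessors.\<close>
  have bound: "(3/2::real) ^ card {i \<in> {1..W}. {j. j < q \<and> g j = i} \<noteq> {}} \<le> 2 ^ D \<and>
      card {k \<in> {1..W}. 6 \<le> card {j. j < q \<and> g j = k} \<or>
               6 \<le> card {j. j < q \<and> g j = Suc k} \<and> Suc k \<le> W} \<le> D"
    if "q \<le> p" "P q g" for q g
  proof -
    have "\<forall>j. \<exists>b b'. j < q \<longrightarrow> b \<in> B j \<and> b' \<in> B j \<and> s0 / 2 ^ g j / 2 \<le> b' - b \<and> b' - b < s0 / 2 ^ g j"
      using that unfolding P_def good_scales_def by blast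
    then obtain lo hi where lohi: "\<And>j. j < q \<Longrightarrow> lo j \<in> B j \<and> hi j \<in> B j \<and>
        s0 / 2 ^ g j / 2 \<le> hi j - lo j \<and> hi j - lo j < s0 / 2 ^ g j"
      by metis
    have gW: "1 \<le> g j \<and> g j \<le> W" if "j < q" for j
      using \<open>P q g\<close> that by (auto simp: P_def good_scales_def)
    define \<tau> where "\<tau> j = hi j - lo j" for j
    interpret dyadic_cube s0 \<tau> g "{..<q}"
      by standard (use s0 lohi gW in \<open>auto simp: \<tau>_def Suc_le_eq\<close>)
    have fibre: "fibre i = {j. j < q \<and> g j = i}" for i
      by (auto simp: fibre_def)
    \<comment> \<open>The lower point of a chosen pair is the origin of its edge; an index without a
      pair contributes one fixed point.\<close>
    define base where "base j = (if j < q then lo j else SOME b. b \<in> B j)" for j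
    have base: "base j \<in> B j" if "j < p" for j
      using that lohi[of j] ne[OF that] by (auto simp: base_def some_in_eq)
    define y where "y = (\<Sum>j<p. base j)"
    define Y where "Y = (+) y ` cube \<tau> {..<q}"
    have "lev W = {..<q}" using gW by (auto simp: lev_def)
    then have thick: "thick Y (s0 / 2 ^ W) = cnt W * (s0 / 2 ^ W)"
      using s0 by (simp add: Y_def thick_translation cnt_def)
    have "Y \<subseteq> selection_sums p B"
    proof
      fix x assume "x \<in> Y"
      then obtain T where T: "T \<subseteq> {..<q}" "x = y + sum \<tau> T"
        by (auto simp: Y_def cube_def)
      define b where "b j = (if j \<in> T then hi j else base j)" for j
      have "sum \<tau> T = (\<Sum>j<p. if j \<in> T then hi j - lo j else 0)"
        using T \<open>q \<le> p\<close> by (subst sum.inter_restrict[symmetric]) (auto simp: \<tau>_def intro!: sum.cong)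
      then have "x = (\<Sum>j<p. base j + (if j \<in> T then hi j - lo j else 0))"
        unfolding T(2) y_def sum.distrib by simp
      also have "\<dots> = (\<Sum>j<p. b j)"
        using T(1) by (intro sum.cong) (auto simp: b_def base_def)
      finally have "x = (\<Sum>j<p. b j)" .
      moreover have "b j \<in> B j" if "j < p" for j
        using base[OF that] lohi T by (auto simp: b_def)
      ultimately show "x \<in> selection_sums p B"
        unfolding selection_sums_def
        by (intro image_eqI[of _ _ "restrict b {..<p}"]) (auto intro!: sum.cong)
    qed
    moreover have "Y \<subseteq> {y..y + 6 * s0}"
    proof
      fix x assume "x \<in> Y"
      then obtain T where T: "T \<subseteq> {..<q}" "x = y + sum \<tau> T"
        by (auto simp: Y_def cube_def)
      have \<tau>pos: "0 \<le> \<tau> j" if "j < q" for j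
        using lohi[OF that] s0 by (auto simp: \<tau>_def intro: order_trans[rotated])
      then have "0 \<le> sum \<tau> T" using T by (intro sum_nonneg) auto
      moreover have "sum \<tau> T \<le> 6 * s0"
      proof -
        have "sum \<tau> T \<le> (\<Sum>j<q. \<tau> j)"
          using T \<tau>pos by (intro sum_mono2) auto
        also have "\<dots> = (\<Sum>i\<in>{1..W}. \<Sum>j\<in>{j\<in>{..<q}. g j = i}. \<tau> j)"
          using gW by (intro sum.group[symmetric]) auto
        also have "\<dots> \<le> (\<Sum>i\<in>{1..W}. 6 * (s0 / 2 ^ i))"
        proof (rule sum_mono)
          fix i
          have "(\<Sum>j\<in>{j\<in>{..<q}. g j = i}. \<tau> j) \<le> (\<Sum>j\<in>{j\<in>{..<q}. g j = i}. s0 / 2 ^ i)"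
            using lohi by (intro sum_mono) (auto simp: \<tau>_def intro: less_imp_le)
          also have "\<dots> = card {j. j < q \<and> g j = i} * (s0 / 2 ^ i)" by simp
          also have "\<dots> \<le> 6 * (s0 / 2 ^ i)"
            using \<open>P q g\<close> s0 by (intro mult_right_mono) (auto simp: P_def)
          finally show "(\<Sum>j\<in>{j\<in>{..<q}. g j = i}. \<tau> j) \<le> 6 * (s0 / 2 ^ i)" .
        qed
        also have "\<dots> = 6 * (s0 - s0 / 2 ^ W)"
          by (simp only: sum_distrib_left[symmetric] sum_halves)
        also have "\<dots> \<le> 6 * s0"
          using s0 by simp
        finally show ?thesis .
      qed
      ultimately show "x \<in> {y..y + 6 * s0}" using T by simp
    qed
    moreover have "finite Y" by (simp add: Y_def finite_cube)
    ultimately have "thick Y (s0 / 2 ^ W) \<le> 2 ^ D * (s0 / 2 ^ W)"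
      using contra by (meson not_le)
    then have cnt: "cnt W \<le> 2 ^ D"
      using s0 unfolding thick by (simp add: divide_le_cancel)
    have "(2::real) ^ card {k \<in> {1..W}. k \<in> full \<or> Suc k \<in> full \<and> Suc k \<le> W} \<le> 2 ^ D"
      using cnt_full[of W] cnt by linarith
    then have "card {k \<in> {1..W}. k \<in> full \<or> Suc k \<in> full \<and> Suc k \<le> W} \<le> D"
      by simp
    then show ?thesis
      using cnt_support[of W] cnt by (simp add: full_def fibre)
  qed
  have notP: "\<not> P p g" for g
  proof
    assume Pg: "P p g"
    let ?supp = "{i \<in> {1..W}. {j. j < p \<and> g j = i} \<noteq> {}}"
    \<comment> \<open>Two scales in use contribute \<open>(3/2) ^ 2 = 9/4\<close>, which exceeds 2.
      At six indices per scale this accommodates at most \<open>12 * D\<close> indices, fewer than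
      \<open>p\<close>.\<close>
    have le: "card ?supp \<le> 2 * D"
    proof (rule ccontr)
      assume "\<not> ?thesis"
      then have "(3/2::real) ^ Suc (2 * D) \<le> (3/2) ^ card ?supp"
        by (intro power_increasing) auto
      also have "\<dots> \<le> 2 ^ D" using bound[OF order_refl Pg] by simp
      also have "\<dots> \<le> (9/4) ^ D" by (intro power_mono) auto
      also have "\<dots> = (3/2) ^ (2 * D)" by (simp add: power_mult power2_eq_square)
      finally show False by simp
    qed
    have "{..<p} \<subseteq> (\<Union>i\<in>?supp. {j. j < p \<and> g j = i})"
      using Pg by (auto simp: P_def good_scales_def)
    then have "p \<le> card (\<Union>i\<in>?supp. {j. j < p \<and> g j = i})"
      using card_mono[of "\<Union>i\<in>?supp. {j. j < p \<and> g j = i}" "{..<p}"] by simp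
    also have "\<dots> \<le> (\<Sum>i\<in>?supp. card {j. j < p \<and> g j = i})"
      by (intro card_UN_le) auto
    also have "\<dots> \<le> (\<Sum>i\<in>?supp. 6)"
      using Pg by (intro sum_mono) (auto simp: P_def)
    also have "\<dots> \<le> 12 * D" using le by simp
    finally show False using p by simp
  qed
  \<comment> \<open>\<open>q\<close> is chosen so that no assignment at all serves the sets up to
    and including \<open>B q\<close>; minimality still provides some assignment for the sets before
    it.\<close>
  define q where "q = (LEAST q. \<not> (\<exists>g. P (Suc q) g))"
  have p_pos: "0 < p" using p by simp
  have notq: "\<not> (\<exists>g. P (Suc q) g)"
    unfolding q_def by (rule LeastI[of _ "p - 1"]) (use notP p_pos in auto)
  have "q \<le> p - 1"
    unfolding q_def by (rule Least_le) (use notP p_pos in auto)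
  then have qp: "q < p" using p_pos by simp
  obtain g where g: "P q g"
  proof (cases q)
    case 0
    then show ?thesis using that by (auto simp: P_def)
  next
    case (Suc q')
    then have "\<exists>g. P (Suc q') g" using not_less_Least[of q' "\<lambda>q. \<not> (\<exists>g. P (Suc q) g)"] by (auto simp: q_def)
    then show ?thesis using that Suc by auto
  qed
  define I where "I = {i \<in> {1..W}. 6 \<le> card {j. j < q \<and> g j = i}}"
  \<comment> \<open>A good scale of \<open>B q\<close> used fewer than six times could be given to
    \<open>q\<close>, extending the assignment.\<close>
  have GI: "?G q \<subseteq> I"
  proof
    fix i assume i: "i \<in> ?G q"
    show "i \<in> I"
    proof (rule ccontr)
      assume "i \<notin> I"
      then have c: "card {j. j < q \<and> g j = i} < 6" using i by (auto simp: I_def good_scales_def)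
      have "P (Suc q) (g(q := i))"
        unfolding P_def
      proof (intro conjI allI impI)
        fix j assume "j < Suc q"
        then show "(g(q := i)) j \<in> ?G j" using i g by (auto simp: P_def less_Suc_eq)
      next
        fix k
        have "{j. j < Suc q \<and> (g(q := i)) j = k} \<subseteq>
            (if k = i then insert q {j. j < q \<and> g j = k} else {j. j < q \<and> g j = k})"
          by (auto simp: less_Suc_eq)
        then have "card {j. j < Suc q \<and> (g(q := i)) j = k}
          \<le> card (if k = i then insert q {j. j < q \<and> g j = k} else {j. j < q \<and> g j = k})"
          by (intro card_mono) auto
        also have "\<dots> \<le> 6" using c g by (auto simp: P_def card_insert_if)
        finally show "card {j. j < Suc q \<and> (g(q := i)) j = k} \<le> 6" .
      qed
      then show False using notq by blast
    qed
  qed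
  let ?J = "{k \<in> {1..W} - I. Suc k \<in> I}"
  have "I \<union> ?J = {k \<in> {1..W}. 6 \<le> card {j. j < q \<and> g j = k} \<or>
               6 \<le> card {j. j < q \<and> g j = Suc k} \<and> Suc k \<le> W}"
    by (auto simp: I_def)
  then have "card (I \<union> ?J) \<le> D" using bound[OF _ g] qp by simp
  moreover have "card (I \<union> ?J) = card I + card ?J"
    by (intro card_Un_disjoint) (auto simp: I_def)
  moreover have "g0 \<le> card I"
    using card_good[OF qp] card_mono[OF _ GI] by (simp add: I_def)
  ultimately have J: "Suc (card ?J) \<le> D + 1 - g0" and ID: "card I \<le> D" by auto
  \<comment> \<open>\<open>I\<close> contains the good scales of \<open>B q\<close> and so inherits
    their window property. Its gaps are short, and \<open>J\<close> makes them few, since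
    \<open>card I\<close> is at least \<open>g0\<close>: then \<open>{1..W}\<close> has at most
    \<open>(D + 1 - g0) * v + D\<close> elements. The subtraction is not truncated, as
    \<open>g0 \<le> card I \<le> D\<close>.\<close>
  have "card ({1..W} - I) \<le> Suc (card ?J) * v"
  proof (rule card_le_gap_ends)
    show "\<exists>k\<in>I. i \<le> k \<and> k < i + v" if "1 \<le> i" "i + v \<le> Suc W" for i
      using window[OF qp that] GI by blast
  qed (auto simp: I_def)
  also have "\<dots> \<le> (D + 1 - g0) * v" using J by (rule mult_right_mono) simp
  finally have "card ({1..W} - I) \<le> (D + 1 - g0) * v" .
  moreover have "card ({1..W} - I) = W - card I"
    by (subst card_Diff_subset) (auto simp: I_def)
  ultimately show False using ID W by simp
qed

section \<open>Separated sets and regular nets\<close>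

definition separated :: "real \<Rightarrow> 'a::metric_space set \<Rightarrow> bool" where
  "separated e F \<longleftrightarrow> (\<forall>x\<in>F. \<forall>y\<in>F. x \<noteq> y \<longrightarrow> e \<le> dist x y)"

lemma ex_separated_net:
  fixes S :: "'a::metric_space set"
  assumes "0 < e"
  obtains Z where "Z \<subseteq> S" "separated e Z" "\<And>x. x \<in> S \<Longrightarrow> \<exists>z\<in>Z. dist x z < e"
proof -
  let ?A = "{Z. Z \<subseteq> S \<and> separated e Z}"
  have "\<exists>Z\<in>?A. \<forall>X\<in>?A. Z \<subseteq> X \<longrightarrow> X = Z"
  proof (rule subset_Zorn)
    fix C assume C: "subset.chain ?A C"
    have "separated e (\<Union>C)"
      unfolding separated_def
    proof (intro ballI impI)
      fix x y assume "x \<in> \<Union>C" "y \<in> \<Union>C" "x \<noteq> y"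
      then obtain X Y where XY: "X \<in> C" "Y \<in> C" "x \<in> X" "y \<in> Y" by auto
      then have "X \<subseteq> Y \<or> Y \<subseteq> X" using C by (simp add: subset_chain_def)
      then obtain U where "U \<in> C" "x \<in> U" "y \<in> U" using XY by blast
      then show "e \<le> dist x y" using C \<open>x \<noteq> y\<close> by (auto simp: subset_chain_def separated_def)
    qed
    then show "\<exists>U\<in>?A. \<forall>X\<in>C. X \<subseteq> U"
      using C by (intro bexI[of _ "\<Union>C"]) (auto simp: subset_chain_def)
  qed
  then obtain Z where Z: "Z \<subseteq> S" "separated e Z"
    and max: "\<And>X. X \<subseteq> S \<Longrightarrow> separated e X \<Longrightarrow> Z \<subseteq> X \<Longrightarrow> X = Z" by auto
  have "\<exists>z\<in>Z. dist x z < e" if "x \<in> S" for x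
  proof (rule ccontr)
    assume "\<not> ?thesis"
    then have far: "e \<le> dist x z" if "z \<in> Z" for z using that by force
    have "separated e (insert x Z)"
      using Z(2) far by (auto simp: separated_def dist_commute)
    then have "insert x Z = Z" using max[of "insert x Z"] Z that by auto
    then show False using far[of x] assms by auto
  qed
  then show ?thesis using that Z by blast
qed

text \<open>Greedy selection from left to right: the induction adds a new maximum, which is kept
  unless a chosen point lies less than \<open>s\<close> to its left. One-sided intervals are wanted
  because they split into just two halves.\<close>

lemma ex_left_net:
  fixes F :: "real set"
  assumes "finite F" "0 < s"
  shows "\<exists>F'\<subseteq>F. separated s F' \<and> (\<forall>x\<in>F. \<exists>z\<in>F'. z \<le> x \<and> x < z + s)"
  using assms(1)
proof (induction F rule: finite_linorder_max_induct)
  case empty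
  then show ?case by (auto simp: separated_def)
next
  case (insert b F)
  then obtain F' where F': "F' \<subseteq> F" "separated s F'" "\<forall>x\<in>F. \<exists>z\<in>F'. z \<le> x \<and> x < z + s"
    by auto
  show ?case
  proof (cases "\<exists>z\<in>F'. b < z + s")
    case True
    then obtain z where "z \<in> F'" "b < z + s" by auto
    moreover from this have "z < b" using insert F' by auto
    ultimately have "\<forall>x\<in>insert b F. \<exists>z\<in>F'. z \<le> x \<and> x < z + s"
      using F' by (auto intro!: bexI[of _ z])
    then show ?thesis using F' by blast
  next
    case False
    then have "s \<le> dist b z" if "z \<in> F'" for z using that by (auto simp: dist_real_def)
    then have "separated s (insert b F')"
      using F'(2) by (auto simp: separated_def dist_commute)
    then show ?thesis using F' assms(2) by (intro exI[of _ "insert b F'"]) auto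
  qed
qed

lemma card_separated_Ico_le_2:
  fixes F :: "real set"
  assumes "separated (s / 2) F"
  shows "card (F \<inter> {z..<z+s}) \<le> 2"
proof -
  have "inj_on (\<lambda>x. x < z + s / 2) (F \<inter> {z..<z+s})"
  proof (rule inj_onI, rule ccontr)
    fix x y assume xy: "x \<in> F \<inter> {z..<z+s}" "y \<in> F \<inter> {z..<z+s}"
      "(x < z + s / 2) = (y < z + s / 2)" "x \<noteq> y"
    then have "s / 2 \<le> dist x y" using assms by (auto simp: separated_def)
    then show False using xy by (auto simp: dist_real_def abs_if split: if_splits)
  qed
  then have "card (F \<inter> {z..<z+s}) \<le> card (UNIV :: bool set)"
    by (intro card_inj_on_le) auto
  then show ?thesis by simp
qed

text \<open>Each of the intervals of length \<open>s0 / 2 ^ i\<close> found by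
  \<open>ex_left_net\<close> holds at most two points of \<open>F\<close>, so one more level at most
  doubles the count. If no difference in \<open>B\<close> falls into the dyadic range of level
  \<open>i\<close>, then \<open>F\<close> is already separated at the coarser level and nothing is
  lost.\<close>

lemma card_separated_le_good:
  fixes B :: "real set"
  assumes "finite F" "F \<subseteq> B" "separated (s0 / 2 ^ i) F" "0 < s0"
    and diam: "\<And>x y. x \<in> B \<Longrightarrow> y \<in> B \<Longrightarrow> y - x < s0"
  shows "card F \<le> 2 ^ card {k\<in>{..<i}. \<exists>b\<in>B. \<exists>b'\<in>B. s0 / 2 ^ k / 2 \<le> b' - b \<and> b' - b < s0 / 2 ^ k}"
    (is "_ \<le> 2 ^ card {k\<in>{..<i}. ?P k}")
  using assms(1-3)
proof (induction i arbitrary: F)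
  case 0
  have "x = y" if "x \<in> F" "y \<in> F" for x y
    using diam[of x y] diam[of y x] 0 that by (force simp: separated_def dist_real_def abs_if split: if_splits)
  then show ?case using 0 by (auto simp: card_le_Suc0_iff_eq)
next
  case (Suc i)
  show ?case
  proof (cases "?P i")
    case True
    let ?s = "s0 / 2 ^ i"
    obtain F' where F': "F' \<subseteq> F" "separated ?s F'" "\<forall>x\<in>F. \<exists>z\<in>F'. z \<le> x \<and> x < z + ?s"
      using ex_left_net[OF Suc.prems(1), of ?s] assms(4) by auto
    have fin: "finite F'" using F' Suc.prems finite_subset by blast
    have "F = (\<Union>z\<in>F'. F \<inter> {z..<z + ?s})" using F'(3) by auto
    then have "card F \<le> (\<Sum>z\<in>F'. card (F \<inter> {z..<z + ?s}))"
      using card_UN_le[OF fin, of "\<lambda>z. F \<inter> {z..<z + ?s}"] by simp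
    also have "\<dots> \<le> (\<Sum>z\<in>F'. 2)"
      using Suc.prems(3) by (intro sum_mono card_separated_Ico_le_2) (simp add: mult.commute)
    also have "\<dots> = 2 * card F'" by simp
    also have "\<dots> \<le> 2 * 2 ^ card {k\<in>{..<i}. ?P k}"
      using Suc.IH[of F'] F' fin Suc.prems by auto
    also have "\<dots> = 2 ^ card (insert i {k\<in>{..<i}. ?P k})" by simp
    also have "insert i {k\<in>{..<i}. ?P k} = {k\<in>{..<Suc i}. ?P k}"
      using True by (auto simp: less_Suc_eq)
    finally show ?thesis .
  next
    case False
    have *: "s0 / 2 ^ i \<le> y - x" if "x \<in> F" "y \<in> F" "x < y" for x y
    proof -
      have "s0 / 2 ^ Suc i \<le> dist x y"
        using Suc.prems(3) that by (auto simp: separated_def simp del: power_Suc)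
      then have "s0 / 2 ^ Suc i \<le> y - x"
        using that by (simp add: dist_real_def)
      then have lo: "s0 / 2 ^ i / 2 \<le> y - x" by (simp add: mult.commute)
      show ?thesis
      proof (rule ccontr)
        assume "\<not> ?thesis"
        then have "?P i" using lo that Suc.prems(2) by (intro bexI[of _ x] bexI[of _ y]) auto
        then show False using False by simp
      qed
    qed
    have "separated (s0 / 2 ^ i) F"
      unfolding separated_def
    proof (intro ballI impI)
      fix x y assume "x \<in> F" "y \<in> F" "x \<noteq> y"
      then show "s0 / 2 ^ i \<le> dist x y"
        using *[of x y] *[of y x] by (cases "x < y") (auto simp: dist_real_def)
    qed
    moreover have "{k\<in>{..<Suc i}. ?P k} = {k\<in>{..<i}. ?P k}"
      using False by (auto simp: less_Suc_eq)
    ultimately show ?thesis using Suc by simp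
  qed
qed

lemma good_scalesI:
  "b \<in> B \<Longrightarrow> b' \<in> B \<Longrightarrow> s0 / 2 ^ i / 2 \<le> b' - b \<Longrightarrow> b' - b < s0 / 2 ^ i \<Longrightarrow> 1 \<le> i \<Longrightarrow> i \<le> W \<Longrightarrow>
     i \<in> good_scales s0 W B"
  unfolding good_scales_def mem_Collect_eq by (intro conjI bexI[of _ b] bexI[of _ b']) auto

lemma good_scales_uminus: "good_scales s0 W (uminus ` B) = good_scales s0 W B"
proof -
  have "good_scales s0 W B \<subseteq> good_scales s0 W (uminus ` B)" for B
  proof
    fix i assume "i \<in> good_scales s0 W B"
    then obtain b b' where "b \<in> B" "b' \<in> B" "s0 / 2 ^ i / 2 \<le> b' - b" "b' - b < s0 / 2 ^ i" "1 \<le> i" "i \<le> W"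
      unfolding good_scales_def by auto
    then show "i \<in> good_scales s0 W (uminus ` B)"
      by (intro good_scalesI[of "- b'" _ "- b"]) auto
  qed
  from this[of B] this[of "uminus ` B"] show ?thesis
    by (simp add: image_image)
qed

text \<open>Ahlfors regularity for counting points at scales between \<alpha> and 1/8. The constant
  is a power of 2 because it is going to be traded against numbers of dyadic scales; 1/8 keeps the
  corresponding arcs of the circle short enough for the regularity hypothesis there.\<close>

definition regular_net :: "real set \<Rightarrow> real \<Rightarrow> real \<Rightarrow> nat \<Rightarrow> bool" where
  "regular_net V \<alpha> \<delta> k \<longleftrightarrow> 0 < \<alpha> \<and> 0 < \<delta> \<and> \<delta> < 1 \<and>
     (\<forall>x\<in>V. \<forall>r. \<alpha> \<le> r \<and> r \<le> 1/8 \<longrightarrow> finite (V \<inter> ball x r) \<and>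
        (r / \<alpha>) powr \<delta> \<le> 2 ^ k * real (card (V \<inter> ball x r)) \<and>
        card (V \<inter> ball x r) \<le> 2 ^ k * (r / \<alpha>) powr \<delta>)"

lemma regular_netD:
  assumes "regular_net V \<alpha> \<delta> k"
  shows "0 < \<alpha>" "0 < \<delta>" "\<delta> < 1"
    and "x \<in> V \<Longrightarrow> \<alpha> \<le> r \<Longrightarrow> r \<le> 1/8 \<Longrightarrow> finite (V \<inter> ball x r)"
    and "x \<in> V \<Longrightarrow> \<alpha> \<le> r \<Longrightarrow> r \<le> 1/8 \<Longrightarrow> (r / \<alpha>) powr \<delta> \<le> 2 ^ k * real (card (V \<inter> ball x r))"
    and "x \<in> V \<Longrightarrow> \<alpha> \<le> r \<Longrightarrow> r \<le> 1/8 \<Longrightarrow> card (V \<inter> ball x r) \<le> 2 ^ k * (r / \<alpha>) powr \<delta>"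
  using assms by (auto simp: regular_net_def)

text \<open>Without a good scale in the window, no point of \<open>V\<close> has its distance from
  \<open>y\<close> in that range, so the balls about \<open>y\<close> of radii
  \<open>2 * R / 2 ^ i\<close> and \<open>2 * R / 2 ^ (i + v)\<close> contain the same points.
  Regularity forces the ratio of their sizes to be at least 2 to the power
  \<open>\<delta> * v - 2 * k\<close>, which exceeds 1.\<close>

lemma window_good:
  assumes V: "regular_net V \<alpha> \<delta> k" and y: "y \<in> V" and R: "R \<le> 1/8"
    and \<alpha>: "\<alpha> \<le> R / 2 ^ W" and v: "2 * k < \<delta> * v"
    and i: "1 \<le> i" "i + v \<le> Suc W"
  shows "\<exists>m\<in>good_scales (2 * R) W (V \<inter> ball y R). i \<le> m \<and> m < i + v"
proof (rule ccontr)
  assume no: "\<not> ?thesis"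
  note D = regular_netD[OF V]
  let ?s = "\<lambda>i::nat. 2 * R / 2 ^ i"
  have "0 < R / 2 ^ W" using \<alpha> D(1) by linarith
  then have R0: "0 < R" by (simp add: zero_less_divide_iff)
  have "?s i \<le> ?s 1" using i R0 by (intro divide_left_mono power_increasing) auto
  then have si: "?s i \<le> R" by simp
  have close: "dist y a < ?s (i + m)" if "a \<in> V" "dist y a < ?s i" "m \<le> v" for a m
    using that(3)
  proof (induction m)
    case 0
    then show ?case using that by simp
  next
    case (Suc m)
    show ?case
    proof (rule ccontr)
      assume "\<not> ?thesis"
      then have lo: "?s (i + m) / 2 \<le> dist y a" by (simp add: mult.commute)
      have hi: "dist y a < ?s (i + m)" using Suc by simp
      have in_ball: "a \<in> V \<inter> ball y R" "y \<in> V \<inter> ball y R" using that si y R0 by auto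
      have "i + m \<in> good_scales (2 * R) W (V \<inter> ball y R)"
      proof (cases "y \<le> a")
        case True
        then have "?s (i + m) / 2 \<le> a - y \<and> a - y < ?s (i + m)"
          using lo hi by (simp add: dist_real_def)
        then show ?thesis
          using i Suc.prems in_ball by (intro good_scalesI[OF in_ball(2,1)]) auto
      next
        case False
        then have "?s (i + m) / 2 \<le> y - a \<and> y - a < ?s (i + m)"
          using lo hi by (simp add: dist_real_def)
        then show ?thesis
          using i Suc.prems in_ball by (intro good_scalesI[OF in_ball]) auto
      qed
      then show False using no Suc.prems by auto
    qed
  qed
  have "?s (Suc W) \<le> ?s (i + v)" using i R0 by (intro divide_left_mono power_increasing) auto
  then have le1: "\<alpha> \<le> ?s (i + v)" using \<alpha> by simp
  have le2: "?s (i + v) \<le> ?s i" using R0 by (intro divide_left_mono power_increasing) auto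
  have sub: "V \<inter> ball y (?s i) \<subseteq> V \<inter> ball y (?s (i + v))" using close[of _ v] by auto
  have "(?s i / \<alpha>) powr \<delta> \<le> 2 ^ k * real (card (V \<inter> ball y (?s i)))"
    by (rule D(5)[OF y]) (use le1 le2 si R in linarith)+
  also have "\<dots> \<le> 2 ^ k * real (card (V \<inter> ball y (?s (i + v))))"
  proof -
    have "finite (V \<inter> ball y (?s (i + v)))"
      by (rule D(4)[OF y le1]) (use le2 si R in linarith)
    from card_mono[OF this sub] show ?thesis by simp
  qed
  also have "\<dots> \<le> 2 ^ k * (2 ^ k * (?s (i + v) / \<alpha>) powr \<delta>)"
    by (intro mult_left_mono D(6)[OF y]) (use le1 le2 si R in \<open>linarith | simp\<close>)+
  also have "\<dots> = 2 ^ (2 * k) * (?s (i + v) / \<alpha>) powr \<delta>"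
    by (simp only: mult.assoc[symmetric] power_add[symmetric] mult_2[symmetric])
  finally have "(?s i / \<alpha>) powr \<delta> \<le> 2 ^ (2 * k) * (?s (i + v) / \<alpha>) powr \<delta>" .
  moreover have "?s i / \<alpha> = 2 ^ v * (?s (i + v) / \<alpha>)" by (simp add: power_add)
  moreover have "(2 ^ v * (?s (i + v) / \<alpha>)) powr \<delta> = (2 ^ v) powr \<delta> * (?s (i + v) / \<alpha>) powr \<delta>"
    by (rule powr_mult)
  ultimately have "(2 ^ v) powr \<delta> * (?s (i + v) / \<alpha>) powr \<delta> \<le> 2 ^ (2 * k) * (?s (i + v) / \<alpha>) powr \<delta>"
    by (simp only:)
  moreover have "0 < (?s (i + v) / \<alpha>) powr \<delta>" using R0 D(1) by simp
  ultimately have "(2 ^ v :: real) powr \<delta> \<le> 2 ^ (2 * k)" by (simp only: mult_le_cancel_right_pos)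
  moreover have "(2 ^ v :: real) powr \<delta> = 2 powr (\<delta> * v)"
    by (simp add: powr_realpow[symmetric] powr_powr mult.commute)
  moreover have "(2::real) ^ (2 * k) = 2 powr (2 * k)"
    by (subst powr_realpow[symmetric]) auto
  ultimately show False using v by simp
qed

text \<open>The trace is covered by balls of radius \<open>R / 2 ^ W\<close> about a net, and the
  net has at most 2 to the number of its occupied scales among \<open>0..W\<close> points.
  Regularity at \<open>R\<close> and at \<open>R / 2 ^ W\<close> each costs \<open>k\<close>; the
  remaining 1 is scale 0, which \<open>good_scales\<close> leaves out.\<close>

lemma card_good_lower:
  assumes V: "regular_net V \<alpha> \<delta> k" and y: "y \<in> V" and R: "R \<le> 1/8"
    and \<alpha>: "\<alpha> \<le> R / 2 ^ W"
  shows "\<delta> * W - 2 * k - 1 \<le> card (good_scales (2 * R) W (V \<inter> ball y R))"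
proof -
  note D = regular_netD[OF V]
  let ?A = "V \<inter> ball y R"
  let ?s = "2 * R / 2 ^ Suc W"
  have "0 < R / 2 ^ W" using \<alpha> D(1) by linarith
  then have R0: "0 < R" by (simp add: zero_less_divide_iff)
  have "R / 2 ^ W \<le> R / 1" using R0 by (intro divide_left_mono) auto
  then have \<alpha>R: "\<alpha> \<le> R" using \<alpha> by simp
  have finA: "finite ?A" using D(4)[OF y \<alpha>R R] .
  obtain F where F: "F \<subseteq> ?A" "separated ?s F" "\<And>x. x \<in> ?A \<Longrightarrow> \<exists>z\<in>F. dist x z < ?s"
    using ex_separated_net[of ?s ?A] R0 by auto
  have finF: "finite F" using F(1) finA finite_subset by blast
  let ?P = "\<lambda>m. \<exists>b\<in>?A. \<exists>b'\<in>?A. 2 * R / 2 ^ m / 2 \<le> b' - b \<and> b' - b < 2 * R / 2 ^ m"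
  have "card F \<le> 2 ^ card {m\<in>{..<Suc W}. ?P m}"
    by (rule card_separated_le_good[OF finF F(1,2)]) (use R0 in \<open>auto simp: dist_real_def\<close>)
  also have "\<dots> \<le> 2 ^ Suc (card (good_scales (2 * R) W ?A))"
  proof (intro power_increasing)
    have "{m\<in>{..<Suc W}. ?P m} \<subseteq> insert 0 (good_scales (2 * R) W ?A)"
      by (auto simp: good_scales_def)
    then have "card {m\<in>{..<Suc W}. ?P m} \<le> card (insert 0 (good_scales (2 * R) W ?A))"
      by (intro card_mono) (auto simp: good_scales_def)
    also have "\<dots> \<le> Suc (card (good_scales (2 * R) W ?A))"
      by (auto simp: good_scales_def card_insert_if)
    finally show "card {m\<in>{..<Suc W}. ?P m} \<le> Suc (card (good_scales (2 * R) W ?A))" .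
  qed auto
  finally have cardF: "card F \<le> 2 ^ Suc (card (good_scales (2 * R) W ?A))" .
  have sR: "\<alpha> \<le> ?s" "?s \<le> 1/8" 
  proof -
    have "?s = R / 2 ^ W" by simp
    then show "\<alpha> \<le> ?s" "?s \<le> 1/8" using \<alpha> R \<open>R / 2 ^ W \<le> R / 1\<close> by linarith+
  qed
  have "?A \<subseteq> (\<Union>z\<in>F. V \<inter> ball z ?s)"
    using F(3) by (auto simp: dist_commute)
  then have "card ?A \<le> card (\<Union>z\<in>F. V \<inter> ball z ?s)"
  proof (intro card_mono finite_UN_I finF)
    show "finite (V \<inter> ball z ?s)" if "z \<in> F" for z
      using that F(1) sR by (intro D(4)) auto
  qed
  also have "\<dots> \<le> (\<Sum>z\<in>F. card (V \<inter> ball z ?s))"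
    using finF by (intro card_UN_le)
  finally have "real (card ?A) \<le> (\<Sum>z\<in>F. real (card (V \<inter> ball z ?s)))"
    by (metis of_nat_le_iff of_nat_sum)
  also have "\<dots> \<le> (\<Sum>z\<in>F. 2 ^ k * (?s / \<alpha>) powr \<delta>)"
    using F(1) by (intro sum_mono D(6) sR) auto
  also have "\<dots> = card F * (2 ^ k * (?s / \<alpha>) powr \<delta>)" by simp
  also have "\<dots> \<le> 2 ^ Suc (card (good_scales (2 * R) W ?A)) * (2 ^ k * (?s / \<alpha>) powr \<delta>)"
    using cardF by (intro mult_right_mono) (auto simp: of_nat_le_iff[where 'a=real, symmetric] simp del: of_nat_le_iff)
  finally have cA: "card ?A \<le> 2 ^ Suc (card (good_scales (2 * R) W ?A)) * (2 ^ k * (?s / \<alpha>) powr \<delta>)" .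
  have "(R / \<alpha>) powr \<delta> \<le> 2 ^ k * real (card ?A)" using D(5)[OF y \<alpha>R R] .
  also have "\<dots> \<le> 2 ^ k * (2 ^ Suc (card (good_scales (2 * R) W ?A)) * (2 ^ k * (?s / \<alpha>) powr \<delta>))"
    using cA by (intro mult_left_mono) auto
  also have "R / \<alpha> = 2 ^ W * (?s / \<alpha>)" by simp
  also have "(2 ^ W * (?s / \<alpha>)) powr \<delta> = (2 ^ W) powr \<delta> * (?s / \<alpha>) powr \<delta>"
    by (rule powr_mult)
  also have "2 ^ k * (2 ^ Suc (card (good_scales (2 * R) W ?A)) * (2 ^ k * (?s / \<alpha>) powr \<delta>))
     = 2 ^ (k + Suc (card (good_scales (2 * R) W ?A)) + k) * (?s / \<alpha>) powr \<delta>"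
    by (simp only: mult.assoc[symmetric] power_add[symmetric] add.assoc)
  also have "k + Suc (card (good_scales (2 * R) W ?A)) + k = 2 * k + Suc (card (good_scales (2 * R) W ?A))"
    by simp
  finally have "(2 ^ W) powr \<delta> * (?s / \<alpha>) powr \<delta>
     \<le> 2 ^ (2 * k + Suc (card (good_scales (2 * R) W ?A))) * (?s / \<alpha>) powr \<delta>" .
  moreover have "0 < (?s / \<alpha>) powr \<delta>" using R0 D(1) by simp
  ultimately have "(2 ^ W :: real) powr \<delta> \<le> 2 ^ (2 * k + Suc (card (good_scales (2 * R) W ?A)))"
    by (simp only: mult_le_cancel_right_pos)
  moreover have "(2 ^ W :: real) powr \<delta> = 2 powr (\<delta> * W)"
    by (simp add: powr_realpow[symmetric] powr_powr mult.commute)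
  moreover have "(2::real) ^ n = 2 powr n" for n :: nat
    by (subst powr_realpow) auto
  ultimately have "2 powr (\<delta> * W) \<le> (2::real) powr real (2 * k + Suc (card (good_scales (2 * R) W ?A)))"
    by (simp only:)
  then have "\<delta> * W \<le> real (2 * k + Suc (card (good_scales (2 * R) W ?A)))"
    by (subst (asm) powr_le_cancel_iff) auto
  then show ?thesis by simp
qed

text \<open>Packing: the balls of radius \<open>\<eta> / 2\<close> about \<open>F\<close> are
  disjoint and lie in the ball of radius \<open>16 * R\<close>;
  \<open>2 * \<alpha> \<le> \<eta>\<close> makes regularity available at radius
  \<open>\<eta> / 2\<close>.\<close>

lemma card_separated_upper:
  assumes V: "regular_net V \<alpha> \<delta> k" and x0: "x0 \<in> V" and F: "F \<subseteq> V \<inter> ball x0 (15 * R)" "separated \<eta> F"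
    and R: "16 * R \<le> 1/8" and \<eta>: "2 * \<alpha> \<le> \<eta>" "\<eta> \<le> 2 * R"
  shows "finite F" "real (card F) \<le> 2 ^ (2 * k) * (32 * R / \<eta>) powr \<delta>"
proof -
  note D = regular_netD[OF V]
  have R0: "0 < R" using \<eta> D(1) by linarith
  have r1: "\<alpha> \<le> 16 * R" "\<alpha> \<le> \<eta> / 2" "\<eta> / 2 \<le> 1/8" using \<eta> R D(1) R0 by linarith+
  have fin: "finite (V \<inter> ball x0 (16 * R))" by (rule D(4)[OF x0 r1(1) R])
  have "F \<subseteq> V \<inter> ball x0 (16 * R)" using F R0 by auto
  then show finF: "finite F" using fin finite_subset by blast
  have "real (card F) * ((\<eta> / 2 / \<alpha>) powr \<delta>) = (\<Sum>x\<in>F. (\<eta> / 2 / \<alpha>) powr \<delta>)" by simp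
  also have "\<dots> \<le> (\<Sum>x\<in>F. 2 ^ k * real (card (V \<inter> ball x (\<eta> / 2))))"
    using F by (intro sum_mono D(5) r1) auto
  also have "\<dots> = 2 ^ k * real (\<Sum>x\<in>F. card (V \<inter> ball x (\<eta> / 2)))"
    by (simp add: sum_distrib_left)
  also have "(\<Sum>x\<in>F. card (V \<inter> ball x (\<eta> / 2))) = card (\<Union>x\<in>F. V \<inter> ball x (\<eta> / 2))"
  proof (rule card_UN_disjoint[symmetric, OF finF])
    show "\<forall>x\<in>F. finite (V \<inter> ball x (\<eta> / 2))"
      using F D(4) r1 by blast
    show "\<forall>x\<in>F. \<forall>y\<in>F. x \<noteq> y \<longrightarrow> (V \<inter> ball x (\<eta> / 2)) \<inter> (V \<inter> ball y (\<eta> / 2)) = {}"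
    proof (intro ballI impI equals0I)
      fix x y z assume xy: "x \<in> F" "y \<in> F" "x \<noteq> y"
        and z: "z \<in> (V \<inter> ball x (\<eta> / 2)) \<inter> (V \<inter> ball y (\<eta> / 2))"
      have "\<eta> \<le> dist x y" using F(2) xy by (simp add: separated_def)
      also have "\<dots> \<le> dist x z + dist y z" by (rule dist_triangle2)
      also have "\<dots> < \<eta>" using z by auto
      finally show False by simp
    qed
  qed
  also have "card (\<Union>x\<in>F. V \<inter> ball x (\<eta> / 2)) \<le> card (V \<inter> ball x0 (16 * R))"
  proof (rule card_mono[OF fin])
    show "(\<Union>x\<in>F. V \<inter> ball x (\<eta> / 2)) \<subseteq> V \<inter> ball x0 (16 * R)"
    proof
      fix z assume "z \<in> (\<Union>x\<in>F. V \<inter> ball x (\<eta> / 2))"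
      then obtain x where "x \<in> F" "z \<in> V" "dist x z < \<eta> / 2" by auto
      moreover have "dist x0 x < 15 * R" using F \<open>x \<in> F\<close> by auto
      ultimately show "z \<in> V \<inter> ball x0 (16 * R)"
        using dist_triangle[of x0 z x] \<eta> by (auto simp: dist_commute)
    qed
  qed
  finally have "real (card F) * ((\<eta> / 2 / \<alpha>) powr \<delta>) \<le> 2 ^ k * real (card (V \<inter> ball x0 (16 * R)))"
    by simp
  also have "\<dots> \<le> 2 ^ k * (2 ^ k * (16 * R / \<alpha>) powr \<delta>)"
    by (intro mult_left_mono D(6)[OF x0 r1(1) R]) simp
  also have "\<dots> = 2 ^ (2 * k) * (16 * R / \<alpha>) powr \<delta>"
    by (simp only: mult.assoc[symmetric] power_add[symmetric] mult_2[symmetric])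
  also have "16 * R / \<alpha> = (32 * R / \<eta>) * (\<eta> / 2 / \<alpha>)"
    using \<eta> D(1) by (simp add: field_simps)
  also have "\<dots> powr \<delta> = (32 * R / \<eta>) powr \<delta> * (\<eta> / 2 / \<alpha>) powr \<delta>"
    by (rule powr_mult)
  finally have "real (card F) * ((\<eta> / 2 / \<alpha>) powr \<delta>) \<le> (2 ^ (2 * k) * (32 * R / \<eta>) powr \<delta>) * ((\<eta> / 2 / \<alpha>) powr \<delta>)"
    by (simp only: mult.assoc)
  moreover have "0 < (\<eta> / 2 / \<alpha>) powr \<delta>" using \<eta> D(1) by simp
  ultimately show "real (card F) \<le> 2 ^ (2 * k) * (32 * R / \<eta>) powr \<delta>"
    by (simp only: mult_le_cancel_right_pos)
qed

lemma thick_le_card_net: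
  assumes "finite Y" "finite F" "0 \<le> \<eta>" and cover: "\<And>y. y \<in> Y \<Longrightarrow> \<exists>x\<in>F. \<bar>y - x\<bar> \<le> 2 * \<eta>"
  shows "thick Y \<eta> \<le> 5 * \<eta> * card F"
proof -
  have sub: "(\<Union>y\<in>Y. {y..<y+\<eta>}) \<subseteq> (\<Union>x\<in>F. {x - 2 * \<eta>..x + 3 * \<eta>})"
  proof
    fix z assume "z \<in> (\<Union>y\<in>Y. {y..<y+\<eta>})"
    then obtain y where y: "y \<in> Y" "y \<le> z" "z < y + \<eta>" by auto
    with cover obtain x where "x \<in> F" "\<bar>y - x\<bar> \<le> 2 * \<eta>" by blast
    then show "z \<in> (\<Union>x\<in>F. {x - 2 * \<eta>..x + 3 * \<eta>})" using y by (intro UN_I[of x]) (auto simp: abs_le_iff)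
  qed
  have "thick Y \<eta> \<le> measure lebesgue (\<Union>x\<in>F. {x - 2 * \<eta>..x + 3 * \<eta>})"
    unfolding thick_def
  proof (rule measure_mono_fmeasurable[OF sub])
    show "(\<Union>y\<in>Y. {y..<y+\<eta>}) \<in> sets lebesgue" using thick_lmeasurable[OF assms(1)] by blast
    show "(\<Union>x\<in>F. {x - 2 * \<eta>..x + 3 * \<eta>}) \<in> lmeasurable"
      using assms(2) by (intro fmeasurable.finite_UN) auto
  qed
  also have "\<dots> \<le> (\<Sum>x\<in>F. measure lebesgue {x - 2 * \<eta>..x + 3 * \<eta>})"
    using assms(2) by (intro measure_UNION_le) auto
  also have "\<dots> = 5 * \<eta> * card F" using assms(3) by simp
  finally show ?thesis .
qed

lemma two_power_powr: "(2 ^ n :: real) powr a = 2 powr (n * a)"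
  by (simp add: powr_realpow[symmetric] powr_powr)

text \<open>If every sum in the thick set \<open>Y\<close> were near \<open>V\<close>, then
  \<open>Y\<close> would be covered through an \<eta>-separated part of \<open>V\<close> near it,
  which has at most \<open>2 ^ (2 * k) * (32 * R / \<eta>) powr \<delta>\<close> points. As
  \<open>32 * R / \<eta> = 2 ^ (W + 4)\<close> and the thickening costs a factor
  \<open>5 \<le> 2 ^ 3\<close>, this stays below \<open>2 ^ D\<close>; that is the origin of
  \<open>7 + 2 * k + \<delta> * W\<close>. Signs are harmless because reflection preserves good
  scales.\<close>

lemma exists_sum_far:
  fixes \<alpha> \<delta> R :: real and D g0 v W k p :: nat
  assumes V: "regular_net V \<alpha> \<delta> k" and y: "\<And>j. j < p \<Longrightarrow> y j \<in> V"
    and sg: "\<And>j. j < p \<Longrightarrow> sg j = 1 \<or> sg j = (-1::real)"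
    and R: "16 * R \<le> 1/8" and \<alpha>: "\<alpha> \<le> R / 2 ^ W"
    and v: "2 * k < \<delta> * v" and D: "7 + 2 * k + \<delta> * W \<le> D" and p: "12 * D < p"
    and g0: "g0 \<le> \<delta> * W - 2 * k - 1" and W: "(D + 1 - g0) * v + D < W"
  obtains a where "\<And>j. j < p \<Longrightarrow> a j \<in> V \<inter> ball (y j) R"
    and "\<And>x. x \<in> V \<Longrightarrow> 2 * R / 2 ^ W < \<bar>(\<Sum>j<p. sg j * a j) - x\<bar>"
proof -
  note N = regular_netD[OF V]
  define \<eta> where "\<eta> = 2 * R / 2 ^ W"
  have "0 < R / 2 ^ W" using \<alpha> N(1) by linarith
  then have R0: "0 < R" by (simp add: zero_less_divide_iff)
  have "R / 2 ^ W \<le> R / 1" using R0 by (intro divide_left_mono) auto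
  then have \<eta>: "2 * \<alpha> \<le> \<eta>" "\<eta> \<le> 2 * R" "0 < \<eta>" and R8: "R \<le> 1/8" and R16: "16 * R \<le> 1/8"
    using \<alpha> R R0 by (auto simp: \<eta>_def)
  have "0 < W" using W by simp
  then have "(2::real) ^ 1 \<le> 2 ^ W" by (intro power_increasing) auto
  then have \<eta>R: "\<eta> \<le> R" using R0 by (simp add: \<eta>_def field_simps)
  define B where "B j = (\<lambda>a. sg j * a) ` (V \<inter> ball (y j) R)" for j
  have good_B: "good_scales (2 * R) W (B j) = good_scales (2 * R) W (V \<inter> ball (y j) R)" if "j < p" for j
  proof -
    have "B j = V \<inter> ball (y j) R \<or> B j = uminus ` (V \<inter> ball (y j) R)"
      using sg[OF that] by (auto simp: B_def)
    then show ?thesis using good_scales_uminus by metis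
  qed
  have "\<exists>Y z. finite Y \<and> Y \<subseteq> selection_sums p B \<and> Y \<subseteq> {z..z + 6 * (2 * R)} \<and>
      2 ^ D * (2 * R / 2 ^ W) < thick Y (2 * R / 2 ^ W)"
  proof (rule sumset_growth[OF _ _ _ _ p W])
    show "0 < 2 * R" using R0 by simp
    show "B j \<noteq> {}" if "j < p" for j using y[OF that] R0 by (auto simp: B_def)
    show "g0 \<le> card (good_scales (2 * R) W (B j))" if "j < p" for j
      using card_good_lower[OF V y[OF that] R8 \<alpha>] g0 by (simp add: good_B[OF that])
    show "\<exists>m\<in>good_scales (2 * R) W (B j). i \<le> m \<and> m < i + v"
      if "j < p" "1 \<le> i" "i + v \<le> Suc W" for j i
      unfolding good_B[OF that(1)] by (rule window_good[OF V y[OF that(1)] R8 \<alpha> v that(2,3)])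
  qed
  then obtain Y z where Y: "finite Y" "Y \<subseteq> selection_sums p B" "Y \<subseteq> {z..z + 12 * R}"
    and big: "2 ^ D * \<eta> < thick Y \<eta>" by (auto simp: \<eta>_def)
  have "\<exists>w\<in>Y. \<forall>x\<in>V. \<eta> < \<bar>w - x\<bar>"
  proof (rule ccontr)
    assume "\<not> ?thesis"
    then have near: "\<exists>x\<in>V. \<bar>w - x\<bar> \<le> \<eta>" if "w \<in> Y" for w using that by force
    define V' where "V' = {x\<in>V. \<exists>w\<in>Y. \<bar>w - x\<bar> \<le> \<eta>}"
    obtain F where F: "F \<subseteq> V'" "separated \<eta> F" "\<And>x. x \<in> V' \<Longrightarrow> \<exists>u\<in>F. dist x u < \<eta>"
      using ex_separated_net[OF \<eta>(3), of V'] by blast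
    have "Y \<noteq> {}" using big \<eta> by (auto simp: thick_def mult_less_0_iff)
    then obtain x0 where x0: "x0 \<in> F" using near F(3) unfolding V'_def by blast
    \<comment> \<open>\<open>Y\<close> has length \<open>6 * (2 * R)\<close>, and either end adds at
      most \<open>\<eta> \<le> R\<close>.\<close>
    have "dist x0 x < 15 * R" if x: "x \<in> F" for x
    proof -
      obtain w w0 where w: "w \<in> Y" "\<bar>w - x\<bar> \<le> \<eta>" "w0 \<in> Y" "\<bar>w0 - x0\<bar> \<le> \<eta>"
        using x x0 F(1) unfolding V'_def by blast
      then have "w \<in> {z..z + 12 * R}" "w0 \<in> {z..z + 12 * R}" using Y(3) by blast+
      then have "\<bar>w - w0\<bar> \<le> 12 * R" by (simp add: abs_le_iff)
      with w show ?thesis using \<eta>R R0 by (simp add: dist_real_def)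
    qed
    then have F15: "F \<subseteq> V \<inter> ball x0 (15 * R)" using F(1) by (auto simp: V'_def)
    have x0V: "x0 \<in> V" using x0 F(1) by (auto simp: V'_def)
    note up = card_separated_upper[OF V x0V F15 F(2) R16 \<eta>(1,2)]
    have "2 ^ D * \<eta> < thick Y \<eta>" by (rule big)
    also have "\<dots> \<le> 5 * \<eta> * card F"
    proof (rule thick_le_card_net[OF Y(1) up(1)])
      fix w assume w: "w \<in> Y"
      then obtain x where "x \<in> V'" "\<bar>w - x\<bar> \<le> \<eta>" using near[OF w] unfolding V'_def by blast
      moreover then obtain u where "u \<in> F" "\<bar>x - u\<bar> < \<eta>" using F(3) by (auto simp: dist_real_def)
      ultimately show "\<exists>x\<in>F. \<bar>w - x\<bar> \<le> 2 * \<eta>" by (intro bexI[of _ u]) auto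
    qed (use \<eta> in auto)
    also have "\<dots> \<le> 5 * \<eta> * (2 ^ (2 * k) * (32 * R / \<eta>) powr \<delta>)"
      using up(2) \<eta> by (intro mult_left_mono) auto
    also have "32 * R / \<eta> = 2 ^ (W + 4)"
      using R0 by (simp add: \<eta>_def power_add)
    finally have "2 ^ D < 5 * (2 ^ (2 * k) * (2 ^ (W + 4)) powr \<delta> :: real)"
      using \<eta> by simp
    also have "\<dots> = 5 * 2 powr (2 * k + \<delta> * W + 4 * \<delta>)"
      by (simp only: two_power_powr powr_realpow[symmetric] powr_add[symmetric])
        (simp add: powr_powr powr_add[symmetric] algebra_simps)
    also have "\<dots> \<le> 2 powr 3 * 2 powr (2 * k + \<delta> * W + 4)"
      using N(3) by (intro mult_mono powr_mono) auto
    also have "\<dots> = 2 powr (7 + 2 * k + \<delta> * W)"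
      by (subst powr_add[symmetric]) (simp add: algebra_simps)
    also have "\<dots> \<le> 2 powr D" using D by simp
    also have "\<dots> = 2 ^ D" by (simp add: powr_realpow)
    finally show False by simp
  qed
  then obtain w where w: "w \<in> Y" "\<And>x. x \<in> V \<Longrightarrow> \<eta> < \<bar>w - x\<bar>" by blast
  obtain b where b: "b \<in> PiE {..<p} B" "w = (\<Sum>j<p. b j)"
    using w(1) Y(2) by (auto simp: selection_sums_def)
  have "b j \<in> B j" if "j < p" for j using b(1) that by (auto simp: PiE_iff)
  then have "\<forall>j. \<exists>a. j < p \<longrightarrow> a \<in> V \<inter> ball (y j) R \<and> b j = sg j * a"
    unfolding B_def by blast
  then obtain a where a: "\<And>j. j < p \<Longrightarrow> a j \<in> V \<inter> ball (y j) R \<and> b j = sg j * a j" by metis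
  show ?thesis
  proof (rule that)
    show "a j \<in> V \<inter> ball (y j) R" if "j < p" for j using a that by blast
    show "2 * R / 2 ^ W < \<bar>(\<Sum>j<p. sg j * a j) - x\<bar>" if "x \<in> V" for x
      using w(2)[OF that] b(2) a by (simp add: \<eta>_def)
  qed
qed

section \<open>Tuples whose signed sum is close to a net\<close>

definition near_tuples :: "real set \<Rightarrow> real set \<Rightarrow> nat \<Rightarrow> (nat \<Rightarrow> real) \<Rightarrow> real \<Rightarrow> (nat \<Rightarrow> real) set" where
  "near_tuples V U p sg \<rho> = {t \<in> PiE {..<p} (\<lambda>_. U). \<exists>x\<in>V. \<bar>(\<Sum>j<p. sg j * t j) - x\<bar> \<le> \<rho>}"

text \<open>Cut the line into intervals of length 1/8; the part of \<open>V\<close> in one of them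
  lies in a ball of radius 1/8 about any of its own points.\<close>

lemma regular_net_Icc:
  assumes V: "regular_net V \<alpha> \<delta> k" and \<alpha>: "\<alpha> \<le> 1/8" and M: "0 \<le> M"
  shows "finite (V \<inter> {-M..M})"
    and "real (card (V \<inter> {-M..M})) \<le> (16 * M + 2) * (2 ^ k * (1/8 / \<alpha>) powr \<delta>)"
proof -
  note D = regular_netD[OF V]
  let ?c = "2 ^ k * (1/8 / \<alpha>) powr \<delta>"
  define S where "S j = V \<inter> {real_of_int j / 8..<(real_of_int j + 1) / 8}" for j
  have S: "finite (S j) \<and> real (card (S j)) \<le> ?c" for j
  proof (cases "S j = {}")
    case False
    then obtain x where x: "x \<in> S j" by auto
    have sub: "S j \<subseteq> V \<inter> ball x (1/8)"
      using x by (auto simp: S_def dist_real_def abs_if)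
    have xV: "x \<in> V" using x by (auto simp: S_def)
    have fin: "finite (V \<inter> ball x (1/8))" by (rule D(4)[OF xV \<alpha> order_refl])
    have "real (card (S j)) \<le> real (card (V \<inter> ball x (1/8)))"
      using card_mono[OF fin sub] by simp
    also have "\<dots> \<le> ?c" by (rule D(6)[OF xV \<alpha> order_refl])
    finally show ?thesis using finite_subset[OF sub fin] by simp
  qed auto
  let ?J = "{\<lfloor>- 8 * M\<rfloor>..\<lfloor>8 * M\<rfloor>}"
  have sub: "V \<inter> {-M..M} \<subseteq> (\<Union>j\<in>?J. S j)"
  proof
    fix x assume x: "x \<in> V \<inter> {-M..M}"
    have "x \<in> S \<lfloor>8 * x\<rfloor>" using x by (simp add: S_def) linarith
    moreover have "\<lfloor>8 * x\<rfloor> \<in> ?J" using x by (auto intro!: floor_mono)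
    ultimately show "x \<in> (\<Union>j\<in>?J. S j)" by blast
  qed
  have fin: "finite (\<Union>j\<in>?J. S j)" using S by auto
  show "finite (V \<inter> {-M..M})" using finite_subset[OF sub fin] .
  have "real (card (V \<inter> {-M..M})) \<le> real (card (\<Union>j\<in>?J. S j))"
    using card_mono[OF fin sub] by simp
  also have "\<dots> \<le> real (\<Sum>j\<in>?J. card (S j))"
    using card_UN_le[of ?J S] by (simp only: of_nat_le_iff) simp
  also have "\<dots> \<le> (\<Sum>j\<in>?J. ?c)"
    unfolding of_nat_sum using S by (intro sum_mono) auto
  also have "\<dots> = real (card ?J) * ?c" by simp
  also have "\<dots> \<le> (16 * M + 2) * ?c"
  proof (rule mult_right_mono)
    have "\<lfloor>- 8 * M\<rfloor> \<le> \<lfloor>8 * M\<rfloor>" using M by (intro floor_mono) auto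
    then show "real (card ?J) \<le> 16 * M + 2" by simp linarith
  qed simp
  finally show "real (card (V \<inter> {-M..M})) \<le> (16 * M + 2) * ?c" .
qed

text \<open>The centres form a maximal \<open>r\<close>-separated subset of \<open>U\<close>. The
  inner balls are taken in \<open>V\<close>, not only in \<open>U\<close>, because the points with a
  far sum are found in \<open>V\<close> near the centres and may lie outside
  \<open>U\<close>.\<close>

lemma ex_cells:
  fixes V U :: "'a::metric_space set"
  assumes "0 < r" "U \<subseteq> V"
  obtains Z cell where "Z \<subseteq> U" "\<And>z. z \<in> Z \<Longrightarrow> V \<inter> ball z (r / 2) \<subseteq> cell z"
    "\<And>z. z \<in> Z \<Longrightarrow> cell z \<subseteq> V \<inter> ball z r"
    "\<And>z z'. z \<in> Z \<Longrightarrow> z' \<in> Z \<Longrightarrow> z \<noteq> z' \<Longrightarrow> cell z \<inter> cell z' = {}"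
    "U \<subseteq> (\<Union>z\<in>Z. cell z)"
proof -
  obtain Z where Z: "Z \<subseteq> U" "separated r Z" "\<And>x. x \<in> U \<Longrightarrow> \<exists>z\<in>Z. dist x z < r"
    using ex_separated_net[OF assms(1), of U] by blast
  then obtain f where f: "\<And>x. x \<in> U \<Longrightarrow> f x \<in> Z \<and> dist x (f x) < r" by metis
  define cell where "cell z = {x \<in> V. dist x z < r / 2 \<or> x \<in> U \<and> (\<forall>z'\<in>Z. r / 2 \<le> dist x z') \<and> z = f x}" for z
  show ?thesis
  proof (rule that[OF Z(1)])
    show "V \<inter> ball z (r / 2) \<subseteq> cell z" if "z \<in> Z" for z
      by (auto simp: cell_def dist_commute)
    show "cell z \<subseteq> V \<inter> ball z r" if "z \<in> Z" for z
      using f assms(1) by (auto simp: cell_def dist_commute)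
    show "cell z \<inter> cell z' = {}" if z: "z \<in> Z" "z' \<in> Z" "z \<noteq> z'" for z z'
    proof (rule equals0I)
      fix x assume x: "x \<in> cell z \<inter> cell z'"
      show False
      proof (cases "dist x z < r / 2")
        case True
        then have "dist x z' < r / 2" using x z(1) by (auto simp: cell_def)
        then have "dist z z' < r" using True dist_triangle3[of z z' x] by linarith
        then show False using Z(2) z by (force simp: separated_def)
      next
        case False
        then show False using x z by (auto simp: cell_def)
      qed
    qed
    show "U \<subseteq> (\<Union>z\<in>Z. cell z)"
    proof
      fix x assume x: "x \<in> U"
      show "x \<in> (\<Union>z\<in>Z. cell z)"
      proof (cases "\<exists>z\<in>Z. dist x z < r / 2")
        case True
        then show ?thesis using x assms(2) by (auto simp: cell_def)
      next
        case False
        then show ?thesis using x assms(2) f[OF x]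
          by (intro UN_I[of "f x"]) (auto simp: cell_def not_less)
      qed
    qed
  qed
qed

text \<open>Consider a product of cells containing one tuple that is near at the fine scale. Sums
  vary little on it, so all its tuples are near at the coarse scale; yet around a far sum it
  contains a sub-product, of proportion at least \<open>e ^ p\<close>, with no near tuple at the
  fine scale. Cells may stick out of \<open>U\<close>, which is why the window grows by
  \<rho>.\<close>

lemma near_tuples_step:
  fixes \<rho> \<delta> :: real and D g0 v W k p :: nat
  assumes V: "regular_net V \<alpha> \<delta> k"
    and sg: "\<And>j. j < p \<Longrightarrow> sg j = 1 \<or> sg j = (-1::real)"
    and v: "2 * k < \<delta> * v" and D: "7 + 2 * k + \<delta> * W \<le> D" and p: "12 * D < p"
    and g0: "g0 \<le> \<delta> * W - 2 * k - 1" and W: "(D + 1 - g0) * v + D < W"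
    and \<rho>: "\<rho> \<le> 1" and \<alpha>: "\<alpha> \<le> \<rho> / ((2 * p + 1) * ((p + 1) * 2 ^ (W + 1)))" and M: "0 \<le> M"
  shows "real (card (near_tuples V (V \<inter> {-M..M}) p sg (\<rho> / ((2 * p + 1) * ((p + 1) * 2 ^ (W + 1))))))
     \<le> (1 - (1 / (2 ^ (2 * k) * ((p + 1) * 2 ^ (W + 1)) powr \<delta>)) ^ p)
       * real (card (near_tuples V (V \<inter> {-(M + \<rho>)..M + \<rho>}) p sg \<rho>))"
proof -
  note N = regular_netD[OF V]
  \<comment> \<open>The intermediate scale \<open>r\<close> serves two purposes.
    \<open>\<rho> = (2 * p + 1) * r\<close> absorbs the variation \<open>2 * p * r\<close> of sums
    over a box. And the distance \<open>r / 2 ^ (W + 1)\<close> granted by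
    \<open>exists_sum_far\<close> with radius \<open>r / 4\<close> is
    \<open>(p + 1) * \<rho>'\<close>, so it survives moving \<open>p\<close> points by \<rho>' and
    still exceeds \<rho>'.\<close>
  define q where "q = (real p + 1) * 2 ^ (W + 1)"
  define r where "r = \<rho> / (2 * p + 1)"
  define \<rho>' where "\<rho>' = r / q"
  define e where "e = 1 / (2 ^ (2 * k) * q powr \<delta>)"
  have \<rho>'_eq: "\<rho>' = \<rho> / ((2 * p + 1) * ((p + 1) * 2 ^ (W + 1)))"
    by (simp add: \<rho>'_def r_def q_def algebra_simps)
  have "0 \<le> \<delta> * W" using N(2) by simp
  then have D16: "7 \<le> real D" using D by linarith
  then have p16: "84 \<le> p" using p by simp
  have q4: "4 \<le> q"
  proof -
    have "4 * 1 \<le> (real p + 1) * 2 ^ (W + 1)"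
      using p16 by (intro mult_mono one_le_power) auto
    then show ?thesis by (simp add: q_def)
  qed
  have \<rho>'0: "0 < \<rho>'" and \<alpha>\<rho>': "\<alpha> \<le> \<rho>'" using \<alpha> N(1) unfolding \<rho>'_eq[symmetric] by auto
  have r_eq: "r = q * \<rho>'" using q4 by (simp add: \<rho>'_def)
  then have r0: "0 < r" using q4 \<rho>'0 by simp
  have \<rho>_eq: "\<rho> = (2 * p + 1) * r" by (simp add: r_def)
  have "4 * \<rho>' \<le> q * \<rho>'" using q4 \<rho>'0 by (intro mult_right_mono) auto
  then have \<rho>'r: "4 * \<rho>' \<le> r" using r_eq by simp
  have "169 * r \<le> (2 * p + 1) * r" using p16 r0 by (intro mult_right_mono) auto
  then have r169: "169 * r \<le> 1" using \<rho> \<rho>_eq by simp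
  define U where "U = V \<inter> {-M..M}"
  define U' where "U' = V \<inter> {-(M + \<rho>)..M + \<rho>}"
  obtain Z cell where Z: "Z \<subseteq> U" and inner: "\<And>z. z \<in> Z \<Longrightarrow> V \<inter> ball z (r / 2) \<subseteq> cell z"
    and outer: "\<And>z. z \<in> Z \<Longrightarrow> cell z \<subseteq> V \<inter> ball z r"
    and disj: "\<And>z z'. z \<in> Z \<Longrightarrow> z' \<in> Z \<Longrightarrow> z \<noteq> z' \<Longrightarrow> cell z \<inter> cell z' = {}"
    and cover: "U \<subseteq> (\<Union>z\<in>Z. cell z)"
    using ex_cells[OF r0, of U V] by (auto simp: U_def)
  have \<alpha>8: "\<alpha> \<le> 1/8" using \<alpha>\<rho>' \<rho>'r r169 \<rho>'0 by linarith
  have \<rho>0: "0 < \<rho>" using \<rho>_eq r0 by (simp add: add_pos_pos)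
  have finU: "finite U" unfolding U_def by (rule regular_net_Icc(1)[OF V \<alpha>8 M])
  have finU': "finite U'" unfolding U'_def by (rule regular_net_Icc(1)[OF V \<alpha>8]) (use M \<rho>0 in auto)
  have finZ: "finite Z" using Z finU finite_subset by blast
  have ZV: "z \<in> V" if "z \<in> Z" for z using that Z by (auto simp: U_def)
  have r_le_\<rho>: "r \<le> \<rho>" using r0 by (simp add: \<rho>_eq algebra_simps)
  have cellU': "cell z \<subseteq> U'" if "z \<in> Z" for z
  proof
    fix x assume "x \<in> cell z"
    then have "x \<in> V" "dist z x < r" "z \<in> {-M..M}" using outer[OF that] Z that by (auto simp: U_def)
    then show "x \<in> U'" using r_le_\<rho> by (auto simp: U'_def dist_real_def)
  qed
  have fincell: "finite (cell z)" if "z \<in> Z" for z using cellU'[OF that] finU' finite_subset by blast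
  define T where "T = near_tuples V U' p sg \<rho>"
  define T' where "T' = near_tuples V U p sg \<rho>'"
  define box where "box \<zeta> = PiE {..<p} (\<lambda>j. cell (\<zeta> j))" for \<zeta> :: "nat \<Rightarrow> real"
  define Al where "Al = {\<zeta> \<in> PiE {..<p} (\<lambda>_. Z). box \<zeta> \<inter> T' \<noteq> {}}"
  have finAl: "finite Al" unfolding Al_def using finZ by (simp add: finite_PiE)
  have AlZ: "\<zeta> j \<in> Z" if "\<zeta> \<in> Al" "j < p" for \<zeta> j using that by (auto simp: Al_def)
  have finbox: "finite (box \<zeta>)" if "\<zeta> \<in> Al" for \<zeta>
    unfolding box_def using AlZ[OF that] fincell by (intro finite_PiE) auto
  have box_disj: "box \<zeta> \<inter> box \<zeta>' = {}" if \<zeta>: "\<zeta> \<in> Al" "\<zeta>' \<in> Al" "\<zeta> \<noteq> \<zeta>'" for \<zeta> \<zeta>'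
  proof -
    have "\<zeta> \<in> PiE {..<p} (\<lambda>_. Z)" "\<zeta>' \<in> PiE {..<p} (\<lambda>_. Z)" using \<zeta> by (auto simp: Al_def)
    then obtain j where j: "j < p" "\<zeta> j \<noteq> \<zeta>' j"
      using PiE_ext[of \<zeta> "{..<p}" "\<lambda>_. Z" \<zeta>'] \<zeta>(3) by auto
    have "cell (\<zeta> j) \<inter> cell (\<zeta>' j) = {}" using disj AlZ \<zeta> j by blast
    then show ?thesis using j by (auto simp: box_def PiE_iff)
  qed
  have T'_sub: "T' \<subseteq> (\<Union>\<zeta>\<in>Al. box \<zeta> \<inter> T')"
  proof
    fix t assume t: "t \<in> T'"
    then have "\<forall>j. \<exists>z. j < p \<longrightarrow> z \<in> Z \<and> t j \<in> cell z"
      using cover by (fastforce simp: T'_def near_tuples_def)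
    then obtain \<zeta> where \<zeta>: "\<And>j. j < p \<Longrightarrow> \<zeta> j \<in> Z \<and> t j \<in> cell (\<zeta> j)" by metis
    have "t \<in> box (restrict \<zeta> {..<p})"
      using \<zeta> t by (auto simp: box_def T'_def near_tuples_def PiE_iff)
    moreover from this have "restrict \<zeta> {..<p} \<in> Al" using \<zeta> t by (auto simp: Al_def)
    ultimately show "t \<in> (\<Union>\<zeta>\<in>Al. box \<zeta> \<inter> T')" using t by blast
  qed
  have box_T: "box \<zeta> \<subseteq> T" if \<zeta>: "\<zeta> \<in> Al" for \<zeta>
  proof
    fix t assume t: "t \<in> box \<zeta>"
    obtain t0 x where t0: "t0 \<in> box \<zeta>" "x \<in> V" "\<bar>(\<Sum>j<p. sg j * t0 j) - x\<bar> \<le> \<rho>'"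
      using \<zeta> by (auto simp: Al_def T'_def near_tuples_def)
    have "\<bar>(\<Sum>j<p. sg j * t j) - (\<Sum>j<p. sg j * t0 j)\<bar> = \<bar>\<Sum>j<p. sg j * t j - sg j * t0 j\<bar>"
      by (simp add: sum_subtractf)
    also have "\<dots> \<le> (\<Sum>j<p. \<bar>sg j * t j - sg j * t0 j\<bar>)" by (rule sum_abs)
    also have "\<dots> \<le> (\<Sum>j<p. 2 * r)"
    proof (rule sum_mono)
      fix j assume "j \<in> {..<p}"
      then have j: "j < p" by simp
      then have "t j \<in> cell (\<zeta> j)" "t0 j \<in> cell (\<zeta> j)" using t t0 by (auto simp: box_def)
      then have "dist (\<zeta> j) (t j) < r" "dist (\<zeta> j) (t0 j) < r" using outer[OF AlZ[OF \<zeta> j]] by auto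
      then have "\<bar>t j - t0 j\<bar> \<le> 2 * r" by (simp add: dist_real_def)
      moreover have "\<bar>sg j * t j - sg j * t0 j\<bar> = \<bar>t j - t0 j\<bar>"
        using sg[OF j] by auto
      ultimately show "\<bar>sg j * t j - sg j * t0 j\<bar> \<le> 2 * r" by simp
    qed
    also have "\<dots> = 2 * p * r" by simp
    finally have "\<bar>(\<Sum>j<p. sg j * t j) - (\<Sum>j<p. sg j * t0 j)\<bar> \<le> 2 * p * r" .
    then have "\<bar>(\<Sum>j<p. sg j * t j) - x\<bar> \<le> 2 * p * r + \<rho>'" using t0(3) by linarith
    also have "\<dots> \<le> \<rho>" using \<rho>'r \<rho>'0 by (simp add: \<rho>_eq algebra_simps)
    finally have "\<bar>(\<Sum>j<p. sg j * t j) - x\<bar> \<le> \<rho>" .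
    moreover have "t \<in> PiE {..<p} (\<lambda>_. U')"
      using t cellU' AlZ[OF \<zeta>] by (auto simp: box_def PiE_iff)
    ultimately show "t \<in> T" using t0(2) by (auto simp: T_def near_tuples_def)
  qed
  have box_T': "real (card (box \<zeta> \<inter> T')) \<le> (1 - e ^ p) * real (card (box \<zeta>))" if \<zeta>: "\<zeta> \<in> Al" for \<zeta>
  proof -
    have R4: "16 * (r / 4) \<le> 1/8" using r169 r0 by simp
    have \<eta>_eq: "2 * (r / 4) / 2 ^ W = (p + 1) * \<rho>'"
      using q4 by (simp add: r_eq q_def)
    have "2 * \<alpha> \<le> (p + 1) * \<rho>'"
      using p16 \<alpha>\<rho>' N(1) by (intro mult_mono) auto
    then have \<alpha>R: "\<alpha> \<le> r / 4 / 2 ^ W" using \<eta>_eq by simp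
    have \<zeta>V: "\<zeta> j \<in> V" if "j < p" for j using AlZ[OF \<zeta> that] ZV by blast
    obtain a where a: "\<And>j. j < p \<Longrightarrow> a j \<in> V \<inter> ball (\<zeta> j) (r / 4)"
      and far: "\<And>x. x \<in> V \<Longrightarrow> 2 * (r / 4) / 2 ^ W < \<bar>(\<Sum>j<p. sg j * a j) - x\<bar>"
      using exists_sum_far[where y = \<zeta> and sg = sg, OF V \<zeta>V sg R4 \<alpha>R v D p g0 W] by blast
    define sub where "sub = PiE {..<p} (\<lambda>j. V \<inter> ball (a j) \<rho>')"
    have ballcell: "V \<inter> ball (a j) \<rho>' \<subseteq> cell (\<zeta> j)" if "j < p" for j
    proof -
      have "V \<inter> ball (a j) \<rho>' \<subseteq> V \<inter> ball (\<zeta> j) (r / 2)"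
      proof
        fix x assume "x \<in> V \<inter> ball (a j) \<rho>'"
        then show "x \<in> V \<inter> ball (\<zeta> j) (r / 2)"
          using a[OF that] \<rho>'r dist_triangle[of "\<zeta> j" x "a j"] by auto
      qed
      then show ?thesis using inner[OF AlZ[OF \<zeta> that]] by blast
    qed
    have sub_box: "sub \<subseteq> box \<zeta>"
      unfolding sub_def box_def using ballcell by (intro PiE_mono) auto
    have sub_T': "sub \<inter> T' = {}"
    proof (rule equals0I)
      fix t assume t: "t \<in> sub \<inter> T'"
      then obtain x where x: "x \<in> V" "\<bar>(\<Sum>j<p. sg j * t j) - x\<bar> \<le> \<rho>'"
        by (auto simp: T'_def near_tuples_def)
      have "\<bar>(\<Sum>j<p. sg j * t j) - (\<Sum>j<p. sg j * a j)\<bar> = \<bar>\<Sum>j<p. sg j * t j - sg j * a j\<bar>"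
        by (simp add: sum_subtractf)
      also have "\<dots> \<le> (\<Sum>j<p. \<bar>sg j * t j - sg j * a j\<bar>)" by (rule sum_abs)
      also have "\<dots> \<le> (\<Sum>j<p. \<rho>')"
      proof (rule sum_mono)
        fix j assume "j \<in> {..<p}"
        then have j: "j < p" by simp
        have "t \<in> PiE {..<p} (\<lambda>j. V \<inter> ball (a j) \<rho>')" using t by (simp add: sub_def)
        then have "t j \<in> V \<inter> ball (a j) \<rho>'" by (rule PiE_mem) (simp add: j)
        then have "\<bar>t j - a j\<bar> \<le> \<rho>'" by (simp add: dist_real_def abs_minus_commute)
        moreover have "\<bar>sg j * t j - sg j * a j\<bar> = \<bar>t j - a j\<bar>"
          using sg[OF j] by auto
        ultimately show "\<bar>sg j * t j - sg j * a j\<bar> \<le> \<rho>'"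
          by simp
      qed
      also have "\<dots> = p * \<rho>'" by simp
      finally have "\<bar>(\<Sum>j<p. sg j * a j) - x\<bar> \<le> (p + 1) * \<rho>'"
        using x(2) by (simp add: algebra_simps)
      then show False using far[OF x(1)] \<eta>_eq by simp
    qed
    \<comment> \<open>\<open>e\<close> is a lower bound, from regularity at
      \<open>r = q * \<rho>'\<close> and at \<rho>', for the proportion of a cell taken up by the
      ball of radius \<rho>'.\<close>
    have "e ^ p * real (card (box \<zeta>)) = (\<Prod>j<p. e * real (card (cell (\<zeta> j))))"
      by (simp add: box_def card_PiE prod.distrib)
    also have "\<dots> \<le> (\<Prod>j<p. real (card (V \<inter> ball (a j) \<rho>')))"
    proof (rule prod_mono)
      fix j assume "j \<in> {..<p}"
      then have j: "j < p" by simp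
      have fin: "finite (V \<inter> ball (\<zeta> j) r)" 
        by (rule N(4)[OF \<zeta>V[OF j]]) (use \<alpha>\<rho>' \<rho>'r \<rho>'0 r169 r0 in linarith)+
      have "real (card (cell (\<zeta> j))) \<le> real (card (V \<inter> ball (\<zeta> j) r))"
        using card_mono[OF fin outer[OF AlZ[OF \<zeta> j]]] by simp
      also have "\<dots> \<le> 2 ^ k * (r / \<alpha>) powr \<delta>"
        by (rule N(6)[OF \<zeta>V[OF j]]) (use \<alpha>\<rho>' \<rho>'r \<rho>'0 r169 r0 in linarith)+
      also have "r / \<alpha> = q * (\<rho>' / \<alpha>)" by (simp add: r_eq)
      also have "\<dots> powr \<delta> = q powr \<delta> * (\<rho>' / \<alpha>) powr \<delta>" by (rule powr_mult)
      also have "2 ^ k * (q powr \<delta> * (\<rho>' / \<alpha>) powr \<delta>)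
          \<le> 2 ^ k * (q powr \<delta> * (2 ^ k * real (card (V \<inter> ball (a j) \<rho>'))))"
      proof (intro mult_left_mono)
        show "(\<rho>' / \<alpha>) powr \<delta> \<le> 2 ^ k * real (card (V \<inter> ball (a j) \<rho>'))"
          by (rule N(5)) (use a[OF j] \<alpha>\<rho>' \<rho>'r \<rho>'0 r169 r0 in \<open>blast | linarith\<close>)+
      qed auto
      also have "\<dots> = 2 ^ (2 * k) * q powr \<delta> * real (card (V \<inter> ball (a j) \<rho>'))"
        by (simp add: mult_2 power_add)
      finally have "real (card (cell (\<zeta> j))) \<le> 2 ^ (2 * k) * q powr \<delta> * real (card (V \<inter> ball (a j) \<rho>'))" .
      then show "0 \<le> e * real (card (cell (\<zeta> j))) \<and>
          e * real (card (cell (\<zeta> j))) \<le> real (card (V \<inter> ball (a j) \<rho>'))"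
        using q4 by (auto simp: e_def divide_le_eq mult.commute)
    qed
    also have "\<dots> = real (card sub)" by (simp add: sub_def card_PiE)
    finally have big: "e ^ p * real (card (box \<zeta>)) \<le> real (card sub)" .
    have "card (box \<zeta> \<inter> T') + card sub = card ((box \<zeta> \<inter> T') \<union> sub)"
      using sub_T' finbox[OF \<zeta>] sub_box finite_subset by (intro card_Un_disjoint[symmetric]) auto
    also have "\<dots> \<le> card (box \<zeta>)"
      using sub_box by (intro card_mono finbox[OF \<zeta>]) auto
    finally have "real (card (box \<zeta> \<inter> T')) + real (card sub) \<le> real (card (box \<zeta>))"
      by (simp only: of_nat_add[symmetric] of_nat_le_iff)
    then show ?thesis using big by (simp add: algebra_simps)
  qed
  have e1: "0 \<le> 1 - e ^ p"
  proof -
    have "1 * 1 \<le> 2 ^ (2 * k) * q powr \<delta>" using q4 N(2) by (intro mult_mono ge_one_powr_ge_zero) auto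
    then have "0 \<le> e" "e \<le> 1" by (auto simp: e_def)
    then show ?thesis by (simp add: power_le_one)
  qed
  have finT: "finite T" unfolding T_def near_tuples_def using finU' by (simp add: finite_PiE)
  have "card T' \<le> card (\<Union>\<zeta>\<in>Al. box \<zeta> \<inter> T')"
    using T'_sub finAl finbox by (intro card_mono) auto
  also have "\<dots> \<le> (\<Sum>\<zeta>\<in>Al. card (box \<zeta> \<inter> T'))" by (rule card_UN_le[OF finAl])
  finally have "real (card T') \<le> (\<Sum>\<zeta>\<in>Al. real (card (box \<zeta> \<inter> T')))"
    by (metis of_nat_le_iff of_nat_sum)
  also have "\<dots> \<le> (\<Sum>\<zeta>\<in>Al. (1 - e ^ p) * real (card (box \<zeta>)))"
    by (intro sum_mono box_T')
  also have "\<dots> = (1 - e ^ p) * real (\<Sum>\<zeta>\<in>Al. card (box \<zeta>))"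
    by (simp add: sum_distrib_left)
  also have "(\<Sum>\<zeta>\<in>Al. card (box \<zeta>)) = card (\<Union>\<zeta>\<in>Al. box \<zeta>)"
    using finAl finbox box_disj by (intro card_UN_disjoint[symmetric]) auto
  also have "(1 - e ^ p) * real (card (\<Union>\<zeta>\<in>Al. box \<zeta>)) \<le> (1 - e ^ p) * real (card T)"
    using e1 finT box_T by (intro mult_left_mono) (auto intro!: card_mono)
  finally show ?thesis
    by (simp only: T_def T'_def U_def U'_def \<rho>'_eq e_def q_def)
       (simp add: algebra_simps)
qed

lemma finite_near_tuples: "finite U \<Longrightarrow> finite (near_tuples V U p sg \<rho>)"
  by (simp add: near_tuples_def finite_PiE)

lemma near_tuples_mono:
  assumes "U \<subseteq> U'" "\<rho> \<le> \<rho>'"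
  shows "near_tuples V U p sg \<rho> \<subseteq> near_tuples V U' p sg \<rho>'"
  using assms PiE_mono[of "{..<p}" "\<lambda>_. U" "\<lambda>_. U'"] unfolding near_tuples_def by force

lemma card_near_tuples_le: "finite U \<Longrightarrow> card (near_tuples V U p sg \<rho>) \<le> card U ^ p"
proof -
  assume "finite U"
  then have "card (near_tuples V U p sg \<rho>) \<le> card (PiE {..<p} (\<lambda>_. U))"
    by (intro card_mono finite_PiE) (auto simp: near_tuples_def)
  then show ?thesis by (simp add: card_PiE)
qed

text \<open>The window grows by \<open>1 / L ^ i\<close> at the step from scale
  \<open>1 / L ^ i\<close>. As \<open>2 \<le> L\<close>, the total is at most 2 whatever
  \<open>m\<close> is, and at scale 1 all tuples are counted.\<close>

lemma near_tuples_iterate: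
  fixes L \<epsilon> M :: real
  assumes step: "\<And>M \<rho>. 0 \<le> M \<Longrightarrow> \<rho> \<le> 1 \<Longrightarrow> \<alpha> \<le> \<rho> / L \<Longrightarrow>
      real (card (near_tuples V (V \<inter> {-M..M}) p sg (\<rho> / L)))
        \<le> \<epsilon> * real (card (near_tuples V (V \<inter> {-(M + \<rho>)..M + \<rho>}) p sg \<rho>))"
    and fin: "\<And>M. 0 \<le> M \<Longrightarrow> finite (V \<inter> {-M..M})"
    and L: "2 \<le> L" and \<epsilon>: "0 \<le> \<epsilon>" and \<alpha>: "0 < \<alpha>" "\<alpha> \<le> 1 / L ^ m" and M: "0 \<le> M"
  shows "real (card (near_tuples V (V \<inter> {-M..M}) p sg (1 / L ^ m)))
     \<le> \<epsilon> ^ m * real (card (V \<inter> {-(M + 2)..M + 2})) ^ p"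
proof -
  have *: "real (card (near_tuples V (V \<inter> {-M..M}) p sg (1 / L ^ m)))
     \<le> \<epsilon> ^ m * real (card (near_tuples V (V \<inter> {-(M + (\<Sum>i<m. 1 / L ^ i))..M + (\<Sum>i<m. 1 / L ^ i)}) p sg 1))"
    using \<alpha>(2) M
  proof (induction m arbitrary: M)
    case 0
    then show ?case by simp
  next
    case (Suc m)
    let ?\<rho> = "1 / L ^ m"
    have \<rho>: "0 < ?\<rho>" "?\<rho> \<le> 1" "1 / L ^ Suc m = ?\<rho> / L" using L by (auto simp: one_le_power)
    have "?\<rho> / L \<le> ?\<rho>" using L by (intro order.trans[OF divide_left_mono[of 1 L]]) auto
    then have \<alpha>\<rho>: "\<alpha> \<le> ?\<rho>" using Suc.prems(1) unfolding \<rho>(3) by linarith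
    have "real (card (near_tuples V (V \<inter> {-M..M}) p sg (1 / L ^ Suc m)))
      \<le> \<epsilon> * real (card (near_tuples V (V \<inter> {-(M + ?\<rho>)..M + ?\<rho>}) p sg ?\<rho>))"
      unfolding \<rho>(3) using Suc.prems \<rho> by (intro step) (auto simp: mult.commute)
    also have "\<dots> \<le> \<epsilon> * (\<epsilon> ^ m * real (card (near_tuples V
        (V \<inter> {-((M + ?\<rho>) + (\<Sum>i<m. 1 / L ^ i))..(M + ?\<rho>) + (\<Sum>i<m. 1 / L ^ i)}) p sg 1)))"
      using Suc.prems \<rho> \<alpha>\<rho> \<epsilon> by (intro mult_left_mono Suc.IH) auto
    finally show ?case by (simp add: algebra_simps)
  qed
  have "(\<Sum>i<m. 1 / L ^ i) \<le> (\<Sum>i<m. 1 / 2 ^ i)"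
    using L by (intro sum_mono divide_left_mono power_mono) auto
  also have "\<dots> = 2 - 2 / 2 ^ m"
  proof (induction m)
    case (Suc m)
    have "(\<Sum>i<Suc m. 1 / 2 ^ i) = 2 - 2 / 2 ^ m + 1 / (2::real) ^ m" using Suc by simp
    then show ?case by simp
  qed simp
  also have "\<dots> \<le> 2" by simp
  finally have S: "(\<Sum>i<m. 1 / L ^ i) \<le> 2" .
  have fin2: "finite (V \<inter> {-(M + 2)..M + 2})" using M by (intro fin) auto
  have "card (near_tuples V (V \<inter> {-(M + (\<Sum>i<m. 1 / L ^ i))..M + (\<Sum>i<m. 1 / L ^ i)}) p sg 1)
      \<le> card (near_tuples V (V \<inter> {-(M + 2)..M + 2}) p sg 1)"
    using S by (intro card_mono finite_near_tuples fin2 near_tuples_mono) auto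
  also have "\<dots> \<le> card (V \<inter> {-(M + 2)..M + 2}) ^ p"
    by (rule card_near_tuples_le[OF fin2])
  finally have "real (card (near_tuples V (V \<inter> {-(M + (\<Sum>i<m. 1 / L ^ i))..M + (\<Sum>i<m. 1 / L ^ i)}) p sg 1))
      \<le> real (card (V \<inter> {-(M + 2)..M + 2})) ^ p"
    by (metis of_nat_le_iff of_nat_power)
  then show ?thesis using * \<epsilon> by (meson mult_left_mono order_trans zero_le_power)
qed

lemma card_tuples_Suc:
  fixes sg :: "nat \<Rightarrow> real"
  assumes "finite U"
  shows "card {t \<in> PiE {..<Suc m} (\<lambda>_. U). P (\<Sum>j<Suc m. sg j * t j)} =
    (\<Sum>a\<in>U. card {t \<in> PiE {..<m} (\<lambda>_. U). P ((\<Sum>j<m. sg j * t j) + sg m * a)})"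
proof -
  let ?A = "\<lambda>a. {t \<in> PiE {..<m} (\<lambda>_. U). P ((\<Sum>j<m. sg j * t j) + sg m * a)}"
  have fin: "finite (?A a)" for a using assms by (simp add: finite_PiE)
  have "bij_betw (\<lambda>(a, t). t(m := a)) (SIGMA a:U. ?A a)
     {t \<in> PiE {..<Suc m} (\<lambda>_. U). P (\<Sum>j<Suc m. sg j * t j)}"
    unfolding bij_betw_def
  proof
    show "inj_on (\<lambda>(a, t). t(m := a)) (SIGMA a:U. ?A a)"
    proof (rule inj_onI, clarify)
      fix a t a' t' assume t: "t \<in> PiE {..<m} (\<lambda>_. U)" "t' \<in> PiE {..<m} (\<lambda>_. U)" and eq: "t(m := a) = t'(m := a')"
      have "a = a'" using fun_cong[OF eq, of m] by simp
      moreover have "t = t'"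
      proof (rule PiE_ext[OF t])
        fix j assume "j \<in> {..<m}"
        then show "t j = t' j" using fun_cong[OF eq, of j] by simp
      qed
      ultimately show "a = a' \<and> t = t'" by simp
    qed
    have sum_upd: "(\<Sum>j<m. sg j * (t(m := a)) j) = (\<Sum>j<m. sg j * t j)" for t a
      by (intro sum.cong) auto
    show "(\<lambda>(a, t). t(m := a)) ` (SIGMA a:U. ?A a) = {t \<in> PiE {..<Suc m} (\<lambda>_. U). P (\<Sum>j<Suc m. sg j * t j)}"
    proof (intro equalityI subsetI)
      fix u assume "u \<in> (\<lambda>(a, t). t(m := a)) ` (SIGMA a:U. ?A a)"
      then obtain a t where "a \<in> U" "t \<in> ?A a" "u = t(m := a)" by auto
      then show "u \<in> {t \<in> PiE {..<Suc m} (\<lambda>_. U). P (\<Sum>j<Suc m. sg j * t j)}"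
        by (auto simp: sum_upd PiE_iff less_Suc_eq extensional_def)
    next
      fix u assume u: "u \<in> {t \<in> PiE {..<Suc m} (\<lambda>_. U). P (\<Sum>j<Suc m. sg j * t j)}"
      have "(\<Sum>j<m. sg j * restrict u {..<m} j) = (\<Sum>j<m. sg j * u j)"
        by (intro sum.cong) auto
      then have "restrict u {..<m} \<in> ?A (u m)" using u by (auto simp: PiE_iff)
      moreover have "(restrict u {..<m})(m := u m) = u"
        using u by (auto simp: fun_eq_iff PiE_iff extensional_def less_Suc_eq)
      ultimately show "u \<in> (\<lambda>(a, t). t(m := a)) ` (SIGMA a:U. ?A a)"
        using u by (intro image_eqI[of _ _ "(u m, restrict u {..<m})"]) (auto simp: PiE_iff)
    qed
  qed
  from bij_betw_same_card[OF this] show ?thesis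
    using assms fin by simp
qed

section \<open>Alternating sums and walks\<close>

definition alt_sign :: "nat \<Rightarrow> real" where
  "alt_sign j = (if even j then 1 else -1)"

text \<open>The offset \<open>z\<close> is any real number, because the recursion passes through
  points \<open>z + a - b\<close> that need not belong to the net.\<close>

definition offset_tuples :: "real set \<Rightarrow> real set \<Rightarrow> nat \<Rightarrow> real \<Rightarrow> real \<Rightarrow> nat" where
  "offset_tuples V U n z \<rho> = card {t \<in> PiE {..<2 * n} (\<lambda>_. U).
     \<exists>x\<in>V. \<bar>z + (\<Sum>j<2 * n. alt_sign j * t j) - x\<bar> \<le> \<rho>}"

lemma offset_tuples_Suc:
  assumes "finite U"
  shows "offset_tuples V U (Suc n) z \<rho> = (\<Sum>b\<in>U. \<Sum>a\<in>U. offset_tuples V U n (z + a - b) \<rho>)"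
proof -
  have "offset_tuples V U (Suc n) z \<rho> = (\<Sum>b\<in>U. card {t \<in> PiE {..<Suc (2 * n)} (\<lambda>_. U).
     \<exists>x\<in>V. \<bar>z + ((\<Sum>j<Suc (2 * n). alt_sign j * t j) + alt_sign (Suc (2 * n)) * b) - x\<bar> \<le> \<rho>})"
    unfolding offset_tuples_def mult_Suc_right numeral_2_eq_2 add_Suc add_0
    using card_tuples_Suc[OF assms, of "Suc (2 * n)" "\<lambda>s. \<exists>x\<in>V. \<bar>z + s - x\<bar> \<le> \<rho>" alt_sign]
    by (simp only: numeral_2_eq_2)
  also have "\<dots> = (\<Sum>b\<in>U. \<Sum>a\<in>U. card {t \<in> PiE {..<2 * n} (\<lambda>_. U).
     \<exists>x\<in>V. \<bar>z + (((\<Sum>j<2 * n. alt_sign j * t j) + alt_sign (2 * n) * a) + alt_sign (Suc (2 * n)) * b) - x\<bar> \<le> \<rho>})"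
    by (intro sum.cong refl
      card_tuples_Suc[OF assms, of "2 * n" "\<lambda>s. \<exists>x\<in>V. \<bar>z + (s + alt_sign (Suc (2 * n)) * _) - x\<bar> \<le> \<rho>" alt_sign])
  also have "\<dots> = (\<Sum>b\<in>U. \<Sum>a\<in>U. offset_tuples V U n (z + a - b) \<rho>)"
    by (simp add: offset_tuples_def alt_sign_def algebra_simps)
  finally show ?thesis .
qed

text \<open>The last entry has the even index \<open>2 * n\<close>, hence sign 1, and becomes the
  offset.\<close>

lemma card_near_tuples_odd:
  assumes "finite U"
  shows "card (near_tuples V U (Suc (2 * n)) alt_sign \<rho>) = (\<Sum>a\<in>U. offset_tuples V U n a \<rho>)"
  unfolding near_tuples_def offset_tuples_def
  using card_tuples_Suc[OF assms, of "2 * n" "\<lambda>s. \<exists>x\<in>V. \<bar>s - x\<bar> \<le> \<rho>" alt_sign]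
  by (simp add: alt_sign_def algebra_simps)

lemma offset_tuples_mono:
  assumes "finite U" "\<bar>z - z'\<bar> \<le> \<sigma>"
  shows "offset_tuples V U n z \<rho> \<le> offset_tuples V U n z' (\<rho> + \<sigma>)"
  unfolding offset_tuples_def
proof (rule card_mono)
  show "finite {t \<in> PiE {..<2 * n} (\<lambda>_. U). \<exists>x\<in>V. \<bar>z' + (\<Sum>j<2 * n. alt_sign j * t j) - x\<bar> \<le> \<rho> + \<sigma>}"
    using assms by (simp add: finite_PiE)
  show "{t \<in> PiE {..<2 * n} (\<lambda>_. U). \<exists>x\<in>V. \<bar>z + (\<Sum>j<2 * n. alt_sign j * t j) - x\<bar> \<le> \<rho>}
     \<subseteq> {t \<in> PiE {..<2 * n} (\<lambda>_. U). \<exists>x\<in>V. \<bar>z' + (\<Sum>j<2 * n. alt_sign j * t j) - x\<bar> \<le> \<rho> + \<sigma>}"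
  proof clarify
    fix t x assume "x \<in> V" "\<bar>z + (\<Sum>j<2 * n. alt_sign j * t j) - x\<bar> \<le> \<rho>"
    then show "\<exists>x\<in>V. \<bar>z' + (\<Sum>j<2 * n. alt_sign j * t j) - x\<bar> \<le> \<rho> + \<sigma>"
      using assms(2) by (intro bexI[of _ x]) linarith+
  qed
qed

text \<open>\<open>trans_count\<close> is a symmetric matrix A on \<open>U\<close>, and
  \<open>walk_count n\<close> is A^n applied to the constant function 1. The sum of
  \<open>walk_count 1\<close> over \<open>U\<close> counts the quadruples of the energy.\<close>

locale walks =
  fixes U :: "real set" and \<tau> :: real
  assumes finite_U: "finite U"
begin

definition trans_count :: "real \<Rightarrow> real \<Rightarrow> real" where
  "trans_count x x' = (\<Sum>b\<in>U. \<Sum>a\<in>U. if \<bar>x + a - b - x'\<bar> \<le> \<tau> then 1 else 0)"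

fun walk_count :: "nat \<Rightarrow> real \<Rightarrow> real" where
  "walk_count 0 x = 1"
| "walk_count (Suc n) x = (\<Sum>x'\<in>U. trans_count x x' * walk_count n x')"

lemma trans_count_nonneg: "0 \<le> trans_count x x'"
  by (simp add: trans_count_def sum_nonneg)

lemma walk_count_nonneg: "0 \<le> walk_count n x"
  by (induction n arbitrary: x) (auto intro!: sum_nonneg mult_nonneg_nonneg trans_count_nonneg)

lemma trans_count_commute: "trans_count x x' = trans_count x' x"
  unfolding trans_count_def
  by (subst sum.swap) (intro sum.cong refl if_cong, simp add: abs_if, linarith)

text \<open>Self-adjointness of A: the inner product of A^(k+j) 1 with 1 equals that of A^k 1 with
  A^j 1.\<close>

lemma walk_count_add: "(\<Sum>x\<in>U. walk_count (k + j) x) = (\<Sum>x\<in>U. walk_count k x * walk_count j x)"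
proof (induction k arbitrary: j)
  case 0
  then show ?case by simp
next
  case (Suc k)
  have "(\<Sum>x\<in>U. walk_count (Suc k) x * walk_count j x)
      = (\<Sum>x\<in>U. \<Sum>x'\<in>U. trans_count x x' * walk_count k x' * walk_count j x)"
    by (simp add: sum_distrib_right)
  also have "\<dots> = (\<Sum>x'\<in>U. \<Sum>x\<in>U. trans_count x x' * walk_count k x' * walk_count j x)"
    by (rule sum.swap)
  also have "\<dots> = (\<Sum>x'\<in>U. walk_count k x' * walk_count (Suc j) x')"
    by (simp add: sum_distrib_left trans_count_commute mult_ac)
  also have "\<dots> = (\<Sum>x\<in>U. walk_count (k + Suc j) x)" using Suc[of "Suc j"] by simp
  finally show ?case by simp
qed

lemma walk_count_double:
  "(\<Sum>x\<in>U. walk_count k x)\<^sup>2 \<le> card U * (\<Sum>x\<in>U. walk_count (2 * k) x)"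
proof -
  have "(\<Sum>x\<in>U. walk_count k x)\<^sup>2 \<le> card U * (\<Sum>x\<in>U. (walk_count k x)\<^sup>2)"
    using finite_U sum_squared_le_sum_of_squares[of "walk_count k" U] by (simp add: mult.commute)
  then show ?thesis
    using walk_count_add[of k k] by (simp add: power2_eq_square mult_2)
qed

text \<open>For nonempty \<open>U\<close>: the mean of \<open>walk_count n\<close> is at least the
  \<open>n\<close>-th power of the mean of \<open>walk_count 1\<close>. Each use of Cauchy-Schwarz
  doubles the length of the walks, hence the powers of 2.\<close>

lemma energy_power_le_walks:
  assumes "n = 2 ^ l"
  shows "(\<Sum>x\<in>U. walk_count 1 x) ^ n * card U \<le> real (card U) ^ n * (\<Sum>x\<in>U. walk_count n x)"
  using assms
proof (induction l arbitrary: n)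
  case 0
  then show ?case by simp
next
  case (Suc l)
  let ?n = "2 ^ l"
  let ?Q = "\<Sum>x\<in>U. walk_count 1 x"
  show ?case
  proof (cases "card U = 0")
    case True
    then show ?thesis using Suc.prems by (simp add: power_0_left)
  next
    case False
    have Q: "0 \<le> ?Q" by (intro sum_nonneg walk_count_nonneg)
    have n: "n = ?n + ?n" using Suc.prems by simp
    have "(?Q ^ n * card U) * card U = (?Q ^ ?n * card U)\<^sup>2"
      unfolding n power_add power2_eq_square by (simp only: mult_ac)
    also have "\<dots> \<le> (real (card U) ^ ?n * (\<Sum>x\<in>U. walk_count ?n x))\<^sup>2"
      using Q by (intro power_mono Suc.IH refl) auto
    also have "\<dots> = real (card U) ^ (2 * ?n) * (\<Sum>x\<in>U. walk_count ?n x)\<^sup>2"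
      by (simp only: power_mult_distrib power_mult[symmetric] mult.commute)
    also have "\<dots> \<le> real (card U) ^ (2 * ?n) * (card U * (\<Sum>x\<in>U. walk_count (2 * ?n) x))"
      by (intro mult_left_mono walk_count_double) auto
    also have "\<dots> = (real (card U) ^ n * (\<Sum>x\<in>U. walk_count n x)) * card U"
      using Suc.prems by (simp only: power_Suc mult_ac)
    finally have "(?Q ^ n * card U) * card U \<le> (real (card U) ^ n * (\<Sum>x\<in>U. walk_count n x)) * card U" .
    then show ?thesis using False by (simp only: mult_le_cancel_right_pos of_nat_0_less_iff)
  qed
qed

text \<open>The pairs \<open>a\<close>, \<open>b\<close> used along a walk form an offset tuple,
  since the walk ends in \<open>V\<close> and each step contributes an error of at most \<tau>.
  Conversely, given these pairs, each new vertex is within \<tau> of a known point, which leaves at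
  most \<open>c\<close> choices.\<close>

lemma walk_count_le_offset:
  fixes c :: real
  assumes near: "\<And>z. card {x' \<in> U. \<bar>z - x'\<bar> \<le> \<tau>} \<le> c" and "U \<subseteq> V" and x: "x \<in> V"
  shows "walk_count n x \<le> c ^ n * offset_tuples V U n x (n * \<tau>)"
  using x
proof (induction n arbitrary: x)
  case 0
  \<comment> \<open>The only tuple over the empty index set is the constant
    \<open>undefined\<close>, and \<open>x\<close> itself witnesses nearness to
    \<open>V\<close>.\<close>
  have "{t \<in> PiE {..<2 * 0::nat} (\<lambda>_. U). \<exists>x'\<in>V. \<bar>x + (\<Sum>j<2 * 0. alt_sign j * t j) - x'\<bar> \<le> 0} = {\<lambda>_. undefined}"
    using 0 by (auto intro!: bexI[of _ x])
  then show ?case by (simp add: offset_tuples_def)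
next
  case (Suc n)
  have c0: "0 \<le> c" using near[of 0] by (meson of_nat_0_le_iff order_trans)
  let ?o = "\<lambda>z. real (offset_tuples V U n z (Suc n * \<tau>))"
  have "walk_count (Suc n) x \<le> (\<Sum>x'\<in>U. trans_count x x' * (c ^ n * real (offset_tuples V U n x' (n * \<tau>))))"
    using assms(2) by (auto intro!: sum_mono mult_left_mono Suc.IH trans_count_nonneg)
  also have "\<dots> = (\<Sum>x'\<in>U. \<Sum>b\<in>U. \<Sum>a\<in>U. if \<bar>x + a - b - x'\<bar> \<le> \<tau> then c ^ n * real (offset_tuples V U n x' (n * \<tau>)) else 0)"
    by (simp add: trans_count_def sum_distrib_right if_distrib[where f = "\<lambda>y. y * _"] cong: if_cong)
  also have "\<dots> \<le> (\<Sum>x'\<in>U. \<Sum>b\<in>U. \<Sum>a\<in>U. if \<bar>x + a - b - x'\<bar> \<le> \<tau> then c ^ n * ?o (x + a - b) else 0)"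
  proof (intro sum_mono)
    fix x' b a
    show "(if \<bar>x + a - b - x'\<bar> \<le> \<tau> then c ^ n * real (offset_tuples V U n x' (n * \<tau>)) else 0)
      \<le> (if \<bar>x + a - b - x'\<bar> \<le> \<tau> then c ^ n * ?o (x + a - b) else 0)"
    proof (cases "\<bar>x + a - b - x'\<bar> \<le> \<tau>")
      case True
      then have "offset_tuples V U n x' (n * \<tau>) \<le> offset_tuples V U n (x + a - b) (n * \<tau> + \<tau>)"
        by (intro offset_tuples_mono[OF finite_U]) (simp add: abs_minus_commute)
      then have "offset_tuples V U n x' (n * \<tau>) \<le> offset_tuples V U n (x + a - b) (Suc n * \<tau>)"
        by (simp add: algebra_simps)
      then show ?thesis using c0 by (auto intro!: mult_left_mono)
    qed simp
  qed
  also have "\<dots> = (\<Sum>b\<in>U. \<Sum>x'\<in>U. \<Sum>a\<in>U. if \<bar>x + a - b - x'\<bar> \<le> \<tau> then c ^ n * ?o (x + a - b) else 0)"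
    by (rule sum.swap)
  also have "\<dots> = (\<Sum>b\<in>U. \<Sum>a\<in>U. \<Sum>x'\<in>U. if \<bar>x + a - b - x'\<bar> \<le> \<tau> then c ^ n * ?o (x + a - b) else 0)"
    by (intro sum.cong refl sum.swap)
  also have "\<dots> = (\<Sum>b\<in>U. \<Sum>a\<in>U. real (card {x' \<in> U. \<bar>(x + a - b) - x'\<bar> \<le> \<tau>}) * (c ^ n * ?o (x + a - b)))"
    using finite_U by (simp add: sum.If_cases Int_def conj_commute)
  also have "\<dots> \<le> (\<Sum>b\<in>U. \<Sum>a\<in>U. c * (c ^ n * ?o (x + a - b)))"
    using near c0 by (intro sum_mono mult_right_mono) auto
  also have "\<dots> = c ^ Suc n * real (offset_tuples V U (Suc n) x (Suc n * \<tau>))"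
    by (simp add: offset_tuples_Suc[OF finite_U] sum_distrib_left mult.assoc)
  finally show ?case .
qed

end

section \<open>Additive energy of regular nets\<close>

lemma ex_power2_between:
  assumes "0 < (d::nat)"
  obtains l where "d \<le> 2 ^ l" "2 ^ l \<le> 2 * d"
proof -
  define l where "l = (LEAST l. d \<le> 2 ^ l)"
  have ex: "d \<le> 2 ^ d" by (simp add: less_imp_le)
  have le: "d \<le> 2 ^ l" unfolding l_def by (rule LeastI[of "\<lambda>l. d \<le> 2 ^ l", OF ex])
  have "2 ^ l \<le> 2 * d"
  proof (cases l)
    case 0
    then show ?thesis using assms by simp
  next
    case (Suc l')
    then have "\<not> d \<le> 2 ^ l'" using not_less_Least[of l' "\<lambda>l. d \<le> 2 ^ l"] by (simp add: l_def)
    then show ?thesis using Suc by simp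
  qed
  then show ?thesis using that le by blast
qed

text \<open>The decisive condition is \<open>(D + 1 - g0) * v + D < W\<close>. \<open>D\<close> and
  \<open>g0\<close> both equal \<delta> W up to O(k), so \<open>D + 1 - g0\<close> is at most 15 k,
  and \<open>v\<close> is at most 3 k / \<delta>. Together with the excess \<open>8 + 2 * k\<close>
  of \<open>D\<close> over \<delta> W this gives 55 k^2 / \<delta>, against (1 - \<delta>) W, which
  is at least 71 k^2 / \<delta>.\<close>

lemma ex_parameters:
  fixes \<delta> :: real and k :: nat
  assumes \<delta>: "0 < \<delta>" "\<delta> < 1" and k: "1 \<le> k"
  defines "y \<equiv> real k ^ 2 / (1 - \<delta>)"
  obtains W v D g0 l :: nat where
    "2 * k < \<delta> * v" "7 + 2 * k + \<delta> * W \<le> D" "12 * D < 2 * 2 ^ l + 1"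
    "g0 \<le> \<delta> * W - 2 * k - 1" "(D + 1 - g0) * v + D < W"
    "2 ^ l \<le> 1000 * y" "\<delta> * W \<le> 72 * y" "1 \<le> y" "real k \<le> y"
proof -
  have k1: "1 \<le> real k" using k by simp
  have "real k * 1 \<le> real k * real k" using k1 by (intro mult_left_mono) auto
  then have kk: "real k \<le> real k ^ 2" by (simp add: power2_eq_square)
  have "real k ^ 2 / 1 \<le> y" unfolding y_def using \<delta> by (intro divide_left_mono) auto
  then have "real k ^ 2 \<le> y" by simp
  then have ky: "real k \<le> y" using kk by (rule order_trans[rotated])
  then have y1: "1 \<le> y" using k1 by (rule order_trans[rotated])
  define W where "W = nat \<lceil>71 * y / \<delta>\<rceil>"
  have "0 \<le> 71 * y / \<delta>" using y1 \<delta> by simp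
  then have W: "71 * y / \<delta> \<le> W" "W \<le> 71 * y / \<delta> + 1"
    unfolding W_def by linarith+
  have \<delta>W: "71 * y \<le> \<delta> * W" "\<delta> * W \<le> 72 * y"
  proof -
    show "71 * y \<le> \<delta> * W" using W(1) \<delta> by (simp add: field_simps)
    have "\<delta> * W \<le> \<delta> * (71 * y / \<delta> + 1)" using W(2) \<delta> by (intro mult_left_mono) auto
    also have "\<dots> = 71 * y + \<delta>" using \<delta> by (simp add: field_simps)
    finally show "\<delta> * W \<le> 72 * y" using \<delta> y1 by linarith
  qed
  define v where "v = nat \<lfloor>2 * k / \<delta>\<rfloor> + 1"
  have "0 \<le> 2 * k / \<delta>" using \<delta> by simp
  then have v: "2 * k / \<delta> < v" "v \<le> 2 * k / \<delta> + 1" unfolding v_def by linarith+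
  define D where "D = nat \<lceil>7 + 2 * k + \<delta> * W\<rceil>"
  have "0 \<le> 7 + 2 * k + \<delta> * W" using \<delta> by simp
  then have D: "7 + 2 * k + \<delta> * W \<le> D" "D \<le> 8 + 2 * k + \<delta> * W" unfolding D_def by linarith+
  define g0 where "g0 = nat \<lfloor>\<delta> * W - 2 * k - 1\<rfloor>"
  have "0 \<le> \<delta> * W - 2 * k - 1" using \<delta>W(1) ky y1 by linarith
  then have g0: "g0 \<le> \<delta> * W - 2 * k - 1" "\<delta> * W - 2 * k - 2 \<le> g0" unfolding g0_def by linarith+
  have D0: "0 < 6 * D" using D(1) \<delta>W(1) y1 by simp
  obtain l where l: "6 * D \<le> 2 ^ l" "2 ^ l \<le> 2 * (6 * D)"
    using ex_power2_between[OF D0] by blast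
  have "real (D + 1 - g0) \<le> 11 + 4 * real k"
    using D(2) g0 \<delta>W k1 by linarith
  also have "\<dots> \<le> 15 * real k" using k1 by simp
  finally have "real (D + 1 - g0) * real v \<le> 15 * real k * (3 * real k / \<delta>)"
  proof (intro mult_mono)
    have "1 \<le> real k / \<delta>" using k1 \<delta> by (simp add: field_simps)
    then show "real v \<le> 3 * real k / \<delta>" using v(2) by simp
  qed auto
  also have "\<dots> = 45 * (real k ^ 2 / \<delta>)" by (simp add: power2_eq_square)
  finally have 1: "real (D + 1 - g0) * real v \<le> 45 * (real k ^ 2 / \<delta>)" .
  have 2: "8 + 2 * real k \<le> 10 * (real k ^ 2 / \<delta>)"
  proof -
    have "real k ^ 2 / 1 \<le> real k ^ 2 / \<delta>" using \<delta> by (intro divide_left_mono) auto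
    then have "real k ^ 2 \<le> real k ^ 2 / \<delta>" by simp
    then show ?thesis using kk k1 by linarith
  qed
  have 3: "71 * (real k ^ 2 / \<delta>) \<le> (1 - \<delta>) * W"
  proof -
    have "71 * (real k ^ 2 / \<delta>) = (1 - \<delta>) * (71 * y / \<delta>)" using \<delta> by (simp add: y_def)
    also have "\<dots> \<le> (1 - \<delta>) * W" using W(1) \<delta> by (intro mult_left_mono) auto
    finally show ?thesis .
  qed
  have "0 < real k ^ 2 / \<delta>" using k1 \<delta> by simp
  then have "real (D + 1 - g0) * real v + D < W"
    using 1 2 3 D(2) by (simp add: algebra_simps)
  then have f5: "(D + 1 - g0) * v + D < W"
    by (metis of_nat_add of_nat_less_iff of_nat_mult)
  have "real (2 ^ l) \<le> real (12 * D)" using l(2) by (simp only: of_nat_le_iff)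
  then have f6: "2 ^ l \<le> 1000 * y" using D(2) \<delta>W(2) ky y1 by simp
  have f1: "2 * k < \<delta> * v" using v(1) \<delta> by (simp add: field_simps)
  have f3: "12 * D < 2 * 2 ^ l + 1" using l(1) by linarith
  show ?thesis by (rule that[OF f1 D(1) f3 g0(1) f5 f6 \<delta>W(2) y1 ky])
qed

text \<open>Energy is bounded by walks, walks by near tuples, and these by iteration over
  \<open>m\<close> scales. One factor \<open>card U\<close> cancels, and
  \<open>(n - 1) + p = 3 * n\<close> leaves the trivial exponent 3 of the energy, raised to the
  power \<open>n\<close>.\<close>

lemma energy_bound_of_parameters:
  fixes \<alpha> \<delta> M L e :: real and W v D g0 l k m n p :: nat
  assumes V: "regular_net V \<alpha> \<delta> k"
    and par: "2 * k < \<delta> * v" "7 + 2 * k + \<delta> * W \<le> D" "12 * D < p"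
      "g0 \<le> \<delta> * W - 2 * k - 1" "(D + 1 - g0) * v + D < W"
    and p: "p = 2 * n + 1" and n: "n = 2 ^ l"
    and \<alpha>: "19 * \<alpha> \<le> 1/8" and M: "0 \<le> M"
    and L_def: "L = real ((2 * p + 1) * ((p + 1) * 2 ^ (W + 1)))"
    and e_def: "e = 1 - (1 / (2 ^ (2 * k) * real ((p + 1) * 2 ^ (W + 1)) powr \<delta>)) ^ p"
    and m: "9 * n * \<alpha> \<le> 1 / L ^ m"
    and N2: "real (card (V \<inter> {-(M + 2)..M + 2})) \<le> N2"
  shows "(\<Sum>x\<in>V \<inter> {-M..M}. walks.walk_count (V \<inter> {-M..M}) (9 * \<alpha>) 1 x) ^ n
     \<le> (19 * 2 ^ k) ^ n * e ^ m * N2 ^ (3 * n)"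
proof -
  note R = regular_netD[OF V]
  define U where "U = V \<inter> {-M..M}"
  have \<alpha>8: "\<alpha> \<le> 1/8" using \<alpha> R(1) by linarith
  have fin: "finite (V \<inter> {-M..M})" if "0 \<le> M" for M by (rule regular_net_Icc(1)[OF V \<alpha>8 that])
  have finU: "finite U" using fin[OF M] by (simp add: U_def)
  interpret walks U "9 * \<alpha>" by standard (rule finU)
  let ?Q = "\<Sum>x\<in>U. walk_count 1 x"
  have sg: "alt_sign j = 1 \<or> alt_sign j = -1" for j by (auto simp: alt_sign_def)
  have n1: "1 \<le> n" by (simp add: n)
  have L2: "2 \<le> L"
  proof -
    have "1 * (1 * 2) \<le> (2 * p + 1) * ((p + 1) * 2 ^ (W + 1))"
      by (intro mult_le_mono) simp_all
    then have "real (1 * (1 * 2)) \<le> L" unfolding L_def by (simp only: of_nat_le_iff)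
    then show ?thesis by simp
  qed
  have e0: "0 \<le> e"
  proof -
    have "1 * 1 \<le> (p + 1) * 2 ^ (W + 1)" by (intro mult_le_mono) simp_all
    then have "real (1 * 1) \<le> real ((p + 1) * 2 ^ (W + 1))" by (simp only: of_nat_le_iff)
    then have "1 \<le> real ((p + 1) * 2 ^ (W + 1))" unfolding mult_1 of_nat_1 .
    then have "1 * 1 \<le> (2 ^ (2 * k) :: real) * real ((p + 1) * 2 ^ (W + 1)) powr \<delta>"
      using R(2) by (intro mult_mono ge_one_powr_ge_zero) (auto simp: one_le_power)
    then show ?thesis by (simp add: e_def power_le_one)
  qed
  have \<alpha>m: "\<alpha> \<le> 1 / L ^ m"
  proof -
    have "1 * \<alpha> \<le> (9 * n) * \<alpha>" using n1 R(1) by (intro mult_right_mono) auto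
    then show ?thesis using m by simp
  qed
  have "card (near_tuples V U p alt_sign (n * (9 * \<alpha>))) \<le> card (near_tuples V U p alt_sign (1 / L ^ m))"
    using m finU by (intro card_mono finite_near_tuples near_tuples_mono) (auto simp: mult_ac)
  then have "real (card (near_tuples V U p alt_sign (n * (9 * \<alpha>)))) \<le> real (card (near_tuples V U p alt_sign (1 / L ^ m)))"
    by simp
  also have "\<dots> \<le> e ^ m * real (card (V \<inter> {-(M + 2)..M + 2})) ^ p"
    unfolding U_def
  proof (rule near_tuples_iterate[OF _ fin L2 e0 R(1) \<alpha>m M])
    fix M \<rho> :: real assume "0 \<le> M" "\<rho> \<le> 1" "\<alpha> \<le> \<rho> / L"
    then show "real (card (near_tuples V (V \<inter> {-M..M}) p alt_sign (\<rho> / L)))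
        \<le> e * real (card (near_tuples V (V \<inter> {-(M + \<rho>)..M + \<rho>}) p alt_sign \<rho>))"
      unfolding L_def e_def by (intro near_tuples_step[OF V sg par])
  qed
  also have "\<dots> \<le> e ^ m * N2 ^ p"
    using e0 N2 by (intro mult_left_mono power_mono) auto
  finally have near: "real (card (near_tuples V U p alt_sign (n * (9 * \<alpha>)))) \<le> e ^ m * N2 ^ p" .
  \<comment> \<open>Two such points are at most \<open>18 * \<alpha>\<close> apart, so a ball of
    radius \<open>19 * \<alpha>\<close> contains them all, and \<open>19 powr \<delta>\<close> is at
    most 19.\<close>
  have close: "real (card {x' \<in> U. \<bar>z - x'\<bar> \<le> 9 * \<alpha>}) \<le> 19 * 2 ^ k" for z
  proof (cases "{x' \<in> U. \<bar>z - x'\<bar> \<le> 9 * \<alpha>} = {}")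
    case False
    then obtain x1 where x1: "x1 \<in> V" "\<bar>z - x1\<bar> \<le> 9 * \<alpha>" by (auto simp: U_def)
    have \<alpha>19: "\<alpha> \<le> 19 * \<alpha>" using R(1) by simp
    have "{x' \<in> U. \<bar>z - x'\<bar> \<le> 9 * \<alpha>} \<subseteq> V \<inter> ball x1 (19 * \<alpha>)"
      using x1 R(1) by (auto simp: U_def dist_real_def)
    then have "card {x' \<in> U. \<bar>z - x'\<bar> \<le> 9 * \<alpha>} \<le> card (V \<inter> ball x1 (19 * \<alpha>))"
      by (intro card_mono R(4)[OF x1(1) \<alpha>19 \<alpha>])
    then have "real (card {x' \<in> U. \<bar>z - x'\<bar> \<le> 9 * \<alpha>}) \<le> real (card (V \<inter> ball x1 (19 * \<alpha>)))" by simp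
    also have "\<dots> \<le> 2 ^ k * (19 * \<alpha> / \<alpha>) powr \<delta>" by (rule R(6)[OF x1(1) \<alpha>19 \<alpha>])
    also have "19 * \<alpha> / \<alpha> = 19" using R(1) by simp
    also have "(19::real) powr \<delta> \<le> 19 powr 1" using R(3) by (intro powr_mono) auto
    finally show ?thesis by simp
  next
    case True
    show ?thesis unfolding True by simp
  qed
  have "?Q ^ n * card U \<le> real (card U) ^ n * (\<Sum>x\<in>U. walk_count n x)"
    by (rule energy_power_le_walks[OF n])
  also have "\<dots> \<le> real (card U) ^ n * (\<Sum>x\<in>U. (19 * 2 ^ k) ^ n * real (offset_tuples V U n x (n * (9 * \<alpha>))))"
    by (intro mult_left_mono sum_mono walk_count_le_offset[OF close]) (auto simp: U_def)
  also have "\<dots> = real (card U) ^ n * ((19 * 2 ^ k) ^ n * real (card (near_tuples V U p alt_sign (n * (9 * \<alpha>)))))"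
    using card_near_tuples_odd[OF finU, of V n] p by (simp add: sum_distrib_left)
  also have "\<dots> \<le> real (card U) ^ n * ((19 * 2 ^ k) ^ n * (e ^ m * N2 ^ p))"
    using near by (intro mult_left_mono) auto
  finally have main: "?Q ^ n * card U \<le> real (card U) ^ n * ((19 * 2 ^ k) ^ n * (e ^ m * N2 ^ p))" .
  have UN2: "real (card U) \<le> N2"
  proof -
    have "card U \<le> card (V \<inter> {-(M + 2)..M + 2})"
      using fin[of "M + 2"] M by (intro card_mono) (auto simp: U_def)
    then show ?thesis using N2 by linarith
  qed
  have "?Q ^ n \<le> (19 * 2 ^ k) ^ n * e ^ m * N2 ^ (3 * n)"
  proof (cases "card U = 0")
    case True
    then have "U = {}" using finU by simp
    then show ?thesis using n1 e0 UN2 by (simp add: power_0_left)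
  next
    case False
    have "?Q ^ n * card U \<le> (real (card U) ^ (n - 1) * card U) * ((19 * 2 ^ k) ^ n * (e ^ m * N2 ^ p))"
      using main n1 by (cases n) (auto simp: mult_ac)
    then have "?Q ^ n * card U \<le> (real (card U) ^ (n - 1) * ((19 * 2 ^ k) ^ n * (e ^ m * N2 ^ p))) * card U"
      by (simp only: mult_ac)
    then have "?Q ^ n \<le> real (card U) ^ (n - 1) * ((19 * 2 ^ k) ^ n * (e ^ m * N2 ^ p))"
      using False by (subst (asm) mult_le_cancel_right_pos) auto
    also have "\<dots> \<le> N2 ^ (n - 1) * ((19 * 2 ^ k) ^ n * (e ^ m * N2 ^ p))"
      using e0 UN2 by (intro mult_right_mono power_mono) (auto intro!: mult_nonneg_nonneg order.trans[OF _ UN2])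
    also have "\<dots> = (19 * 2 ^ k) ^ n * e ^ m * N2 ^ ((n - 1) + p)"
      by (simp only: power_add mult_ac)
    also have "(n - 1) + p = 3 * n" using n1 p by simp
    finally show ?thesis .
  qed
  then show ?thesis by (simp add: U_def)
qed

lemma ln_add_one_le: "ln (real m + 1) \<le> m"
  using ln_add_one_self_le_self[of "real m"] by (simp add: add.commute)

text \<open>A saving of \<epsilon> per factor \<open>L\<close> in scale, after an
  \<open>n\<close>-th root, is the exponent \<epsilon> / (n ln L). Here - ln \<epsilon> is a product
  of two numbers at most 2001 y and 2076 y, and n ln L is at most 7000000 y^2 / \<delta>; 20000000
  exceeds the sum of 4200000 and 7000000. The 1 / \<delta> enters through \<open>W\<close> and
  reappears as the factor \<delta> outside the exponential.\<close>

lemma exponent_lower_bound: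
  fixes \<delta> y \<epsilon> L :: real and k W n p :: nat
  assumes \<delta>: "0 < \<delta>" "\<delta> < 1" and y: "1 \<le> y" "k \<le> y" "\<delta> * W \<le> 72 * y"
    and n: "1 \<le> n" "n \<le> 1000 * y" and p: "p = 2 * n + 1"
    and L: "L = real ((2 * p + 1) * ((p + 1) * 2 ^ (W + 1)))"
    and \<epsilon>: "\<epsilon> = (1 / (2 ^ (2 * k) * real ((p + 1) * 2 ^ (W + 1)) powr \<delta>)) ^ p"
  shows "1 \<le> ln L" "0 < \<epsilon>" "\<epsilon> \<le> 1" "\<delta> * exp (- 20000000 * y\<^sup>2) \<le> \<epsilon> / (n * ln L)"
proof -
  define q where "q = real ((p + 1) * 2 ^ (W + 1))"
  have q_eq: "q = (real p + 1) * 2 ^ (W + 1)" by (simp add: q_def algebra_simps)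
  have q1: "1 * 1 \<le> q" unfolding q_eq by (intro mult_mono one_le_power) auto
  have L_eq: "L = (2 * real p + 1) * q" by (simp add: L q_def algebra_simps)
  have p_le: "real p \<le> 2001 * y" using p n y by simp
  have ln2: "ln 2 \<le> (1::real)" using ln_le_minus_one[of 2] by simp
  have lnq: "ln q \<le> p + (W + 1)"
  proof -
    have "ln q = ln (real p + 1) + ln (2 ^ (W + 1))"
      unfolding q_eq by (rule ln_mult_pos) auto
    also have "ln (2 ^ (W + 1)) = real (W + 1) * ln 2"
      by (rule ln_realpow)
    also have "ln (real p + 1) + real (W + 1) * ln 2 \<le> real p + real (W + 1) * 1"
      using ln2 by (intro add_mono ln_add_one_le mult_left_mono) auto
    finally show ?thesis by simp
  qed
  have lnq0: "0 \<le> ln q" using q1 by simp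
  have "7 * 1 \<le> (2 * real p + 1) * q" using p n q1 by (intro mult_mono) auto
  then have "exp 1 \<le> L" using exp_le unfolding L_eq by linarith
  then have "ln (exp 1) \<le> ln L" by (intro ln_mono) auto
  then show lnL1: "1 \<le> ln L" by simp
  have lnL: "ln L \<le> 3 * p + (W + 1)"
  proof -
    have "ln L = ln (real (2 * p) + 1) + ln q"
      unfolding L_eq using q1 by (subst ln_mult_pos) auto
    then show ?thesis using ln_add_one_le[of "2 * p"] lnq by simp
  qed
  define d where "d = 2 ^ (2 * k) * q powr \<delta>"
  have d1: "1 * 1 \<le> d" unfolding d_def using q1 \<delta> by (intro mult_mono one_le_power ge_one_powr_ge_zero) auto
  have \<epsilon>_eq: "\<epsilon> = (1 / d) ^ p" by (simp only: \<epsilon> d_def q_def)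
  show \<epsilon>0: "0 < \<epsilon>" and "\<epsilon> \<le> 1" using d1 by (auto simp: \<epsilon>_eq power_le_one)
  have ln\<epsilon>: "- ln \<epsilon> \<le> 4200000 * y\<^sup>2"
  proof -
    have "ln d = real (2 * k) * ln 2 + \<delta> * ln q"
      unfolding d_def using q1 by (subst ln_mult_pos) (auto simp: ln_realpow ln_powr)
    also have "\<dots> \<le> real (2 * k) * 1 + (\<delta> * p + \<delta> * W + \<delta>)"
    proof (rule add_mono)
      show "real (2 * k) * ln 2 \<le> real (2 * k) * 1" by (rule mult_left_mono[OF ln2]) simp
      have "\<delta> * ln q \<le> \<delta> * (p + (W + 1))" using lnq \<delta> by (intro mult_left_mono) auto
      then show "\<delta> * ln q \<le> \<delta> * p + \<delta> * W + \<delta>" by (simp add: algebra_simps)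
    qed
    also have "\<dots> \<le> 2 * y + (2001 * y + 72 * y + y)"
    proof -
      have "\<delta> * p \<le> 1 * real p" using \<delta> by (intro mult_right_mono) auto
      then show ?thesis using \<delta> y p_le by simp
    qed
    finally have "ln d \<le> 2076 * y" by simp
    moreover have "0 \<le> ln d" using d1 by simp
    ultimately have "p * ln d \<le> 2001 * y * (2076 * y)"
      using p_le y by (intro mult_mono) auto
    also have "\<dots> \<le> 4200000 * y\<^sup>2" by (simp add: power2_eq_square)
    finally show ?thesis using d1 by (simp add: \<epsilon>_eq ln_realpow ln_div)
  qed
  then have "exp (- 4200000 * y\<^sup>2) \<le> exp (ln \<epsilon>)" by simp
  then have \<epsilon>_lower: "exp (- 4200000 * y\<^sup>2) \<le> \<epsilon>" using \<epsilon>0 by simp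
  have "y * \<delta> \<le> y * 1" using \<delta> y by (intro mult_left_mono) auto
  then have y\<delta>: "y \<le> y / \<delta>" using \<delta> by (simp add: field_simps)
  have "n * ln L \<le> 1000 * y * (7000 * (y / \<delta>))"
  proof (intro mult_mono)
    have "real W \<le> 72 * (y / \<delta>)" using y(3) \<delta> by (simp add: field_simps)
    then show "ln L \<le> 7000 * (y / \<delta>)" using lnL p_le y y\<delta> by simp
  qed (use n y lnL1 in auto)
  also have "\<dots> = 7000000 * y\<^sup>2 / \<delta>" by (simp add: power2_eq_square)
  also have "\<dots> \<le> exp (7000000 * y\<^sup>2) / \<delta>"
  proof (rule divide_right_mono)
    show "7000000 * y\<^sup>2 \<le> exp (7000000 * y\<^sup>2)"
      using exp_ge_add_one_self[of "7000000 * y\<^sup>2"] by linarith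
  qed (use \<delta> in simp)
  finally have nlnL: "n * ln L \<le> exp (7000000 * y\<^sup>2) / \<delta>" .
  have "\<delta> * exp (- 20000000 * y\<^sup>2) \<le> \<delta> * exp (- 4200000 * y\<^sup>2 - 7000000 * y\<^sup>2)"
    using \<delta> by (intro mult_left_mono) auto
  also have "\<dots> = exp (- 4200000 * y\<^sup>2) / (exp (7000000 * y\<^sup>2) / \<delta>)"
    using \<delta> by (simp only: exp_diff) simp
  also have "\<dots> \<le> \<epsilon> / (n * ln L)"
    using \<epsilon>_lower nlnL n lnL1 \<epsilon>0 by (intro frac_le) auto
  finally show "\<delta> * exp (- 20000000 * y\<^sup>2) \<le> \<epsilon> / (n * ln L)" .
qed

text \<open>\<open>m\<close> is the number of whole steps by a factor \<open>L\<close> between 1 and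
  \<open>x\<close>. Rounding it down costs at most a factor e, because \<epsilon> \<le> 1; this is
  the 3.\<close>

lemma power_one_minus_le:
  fixes \<epsilon> L x :: real
  assumes L: "1 \<le> ln L" and L0: "0 < L" and \<epsilon>: "0 < \<epsilon>" "\<epsilon> \<le> 1" and x: "0 < x" "x \<le> 1"
  obtains m where "x \<le> 1 / L ^ m" "(1 - \<epsilon>) ^ m \<le> 3 * x powr (\<epsilon> / ln L)"
proof -
  define m where "m = nat \<lfloor>- ln x / ln L\<rfloor>"
  have "0 \<le> - ln x / ln L" using x L by (intro divide_nonneg_pos) auto
  then have m: "m \<le> - ln x / ln L" "- ln x / ln L \<le> m + 1" unfolding m_def by linarith+
  have "m * ln L \<le> - ln x" using m(1) L by (simp add: field_simps)
  then have "ln x \<le> ln (1 / L ^ m)" using L0 by (simp add: ln_div ln_realpow)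
  then have 1: "x \<le> 1 / L ^ m" using x L0 by (subst (asm) ln_le_cancel_iff) auto
  have "(1 - \<epsilon>) ^ m \<le> exp (- \<epsilon>) ^ m"
    using \<epsilon> exp_ge_add_one_self[of "- \<epsilon>"] by (intro power_mono) auto
  also have "\<dots> = exp (- (\<epsilon> * m))" by (simp add: exp_of_nat_mult[symmetric] mult.commute)
  also have "\<dots> \<le> exp (1 + \<epsilon> / ln L * ln x)"
  proof -
    have "\<epsilon> * (- ln x / ln L) \<le> \<epsilon> * (m + 1)" using m(2) \<epsilon> by (intro mult_left_mono) auto
    then have "- (\<epsilon> * m) \<le> 1 + \<epsilon> / ln L * ln x" using \<epsilon> by (simp add: algebra_simps)
    then show ?thesis by simp
  qed
  also have "\<dots> = exp 1 * x powr (\<epsilon> / ln L)" using x by (simp add: exp_add powr_def)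
  also have "\<dots> \<le> 3 * x powr (\<epsilon> / ln L)" using exp_le by (intro mult_right_mono) auto
  finally show ?thesis using that 1 by blast
qed

lemma discrete_energy_bound:
  fixes \<delta> M :: real and k :: nat
  assumes \<delta>: "0 < \<delta>" "\<delta> < 1" and k: "1 \<le> k" and M: "0 \<le> M"
  defines "\<beta> \<equiv> \<delta> * exp (- 20000000 * (real k ^ 2 / (1 - \<delta>))\<^sup>2)"
  obtains C \<alpha>0 where "0 < C" "0 < \<alpha>0" "\<alpha>0 \<le> 1/152"
    "\<And>\<alpha> V. \<alpha> < \<alpha>0 \<Longrightarrow> regular_net V \<alpha> \<delta> k \<Longrightarrow>
       (\<Sum>x\<in>V \<inter> {-M..M}. walks.walk_count (V \<inter> {-M..M}) (9 * \<alpha>) 1 x) \<le> C * \<alpha> powr (- 3 * \<delta> + \<beta>)"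
proof -
  define y where "y = real k ^ 2 / (1 - \<delta>)"
  obtain W v D g0 l :: nat where par: "2 * k < \<delta> * v" "7 + 2 * k + \<delta> * W \<le> D" "12 * D < 2 * 2 ^ l + 1"
    "g0 \<le> \<delta> * W - 2 * k - 1" "(D + 1 - g0) * v + D < W"
    and bd: "2 ^ l \<le> 1000 * y" "\<delta> * W \<le> 72 * y" "1 \<le> y" "real k \<le> y"
    unfolding y_def by (rule ex_parameters[OF \<delta> k])
  define n p :: nat where "n = 2 ^ l" and "p = 2 * n + 1"
  define L where "L = real ((2 * p + 1) * ((p + 1) * 2 ^ (W + 1)))"
  define \<epsilon> where "\<epsilon> = (1 / (2 ^ (2 * k) * real ((p + 1) * 2 ^ (W + 1)) powr \<delta>)) ^ p"
  have n1: "1 \<le> n" by (simp add: n_def)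
  have n_le: "n \<le> 1000 * y" using bd(1) by (simp add: n_def)
  note ex = exponent_lower_bound[OF \<delta> bd(3,4,2) n1 n_le p_def L_def \<epsilon>_def]
  have L0: "0 < L" unfolding L_def of_nat_0_less_iff by simp
  have p12: "12 * D < p" using par(3) by (simp add: p_def n_def)
  define A where "A = (16 * (M + 2) + 2) * 2 ^ k"
  have "1 * 1 \<le> (16 * (M + 2) + 2) * 2 ^ k" using M by (intro mult_mono one_le_power) auto
  then have A1: "1 \<le> A" by (simp add: A_def)
  \<comment> \<open>What remains after the \<open>n\<close>-th root: the choices per walk step, the
    loss 3 from rounding \<open>m\<close> times the ratio \<open>9 * n\<close> of the starting scale
    to \<alpha>, and three counts of the net.\<close>
  define C where "C = 19 * 2 ^ k * (27 * n) * A ^ 3"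
  \<comment> \<open>152 is 8 times 19, so that \<open>19 * \<alpha> \<le> 1/8\<close>; the factor
    \<open>n\<close> ensures \<open>9 * n * \<alpha> \<le> 1\<close>.\<close>
  define \<alpha>0 where "\<alpha>0 = 1 / (152 * n)"
  have C0: "0 < C" using A1 n1 by (simp add: C_def)
  have \<alpha>0: "0 < \<alpha>0" "\<alpha>0 \<le> 1/152" using n1 by (auto simp: \<alpha>0_def)
  show ?thesis
  proof (rule that[OF C0 \<alpha>0])
    fix \<alpha> V assume \<alpha>: "\<alpha> < \<alpha>0" and V: "regular_net V \<alpha> \<delta> k"
    note R = regular_netD[OF V]
    let ?Q = "\<Sum>x\<in>V \<inter> {-M..M}. walks.walk_count (V \<inter> {-M..M}) (9 * \<alpha>) 1 x"
    have \<alpha>19: "19 * \<alpha> \<le> 1/8" and \<alpha>8: "\<alpha> \<le> 1/8" and \<alpha>1: "\<alpha> < 1" using \<alpha> \<alpha>0 by auto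
    have "n * \<alpha> < n * \<alpha>0" using \<alpha> n1 by simp
    then have n\<alpha>: "9 * n * \<alpha> \<le> 1" using n1 by (simp add: \<alpha>0_def)
    have n\<alpha>0: "0 < 9 * n * \<alpha>" using n1 R(1) by simp
    obtain m where m: "9 * n * \<alpha> \<le> 1 / L ^ m" "(1 - \<epsilon>) ^ m \<le> 3 * (9 * n * \<alpha>) powr (\<epsilon> / ln L)"
      using power_one_minus_le[OF ex(1) L0 ex(2,3) n\<alpha>0 n\<alpha>] by blast
    have "real (card (V \<inter> {-(M + 2)..M + 2})) \<le> (16 * (M + 2) + 2) * (2 ^ k * (1/8 / \<alpha>) powr \<delta>)"
      by (rule regular_net_Icc(2)[OF V \<alpha>8]) (use M in simp)
    also have "\<dots> \<le> (16 * (M + 2) + 2) * (2 ^ k * (1 / \<alpha>) powr \<delta>)"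
      using M \<delta> R(1) by (intro mult_left_mono powr_mono2) (auto simp: field_simps)
    also have "\<dots> = A * \<alpha> powr (- \<delta>)"
      using R(1) by (simp add: A_def powr_minus_divide powr_divide)
    finally have N2: "real (card (V \<inter> {-(M + 2)..M + 2})) \<le> A * \<alpha> powr (- \<delta>)" .
    have "?Q ^ n \<le> (19 * 2 ^ k) ^ n * (1 - \<epsilon>) ^ m * (A * \<alpha> powr (- \<delta>)) ^ (3 * n)"
      by (rule energy_bound_of_parameters[OF V par(1,2) p12 par(4,5) p_def n_def \<alpha>19 M L_def _ m(1) N2])
         (simp only: \<epsilon>_def)
    also have "\<dots> \<le> (19 * 2 ^ k) ^ n * ((27 * n) ^ n * (\<alpha> powr \<beta>) ^ n) * (A * \<alpha> powr (- \<delta>)) ^ (3 * n)"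
    proof (intro mult_right_mono mult_left_mono)
      have "(9 * n * \<alpha>) powr (\<epsilon> / ln L) = (9 * n) powr (\<epsilon> / ln L) * \<alpha> powr (\<epsilon> / ln L)"
        by (simp add: powr_mult)
      also have "\<dots> \<le> (9 * n) powr 1 * \<alpha> powr (\<beta> * n)"
      proof (rule mult_mono)
        have "\<epsilon> / ln L \<le> 1" using ex by (simp add: divide_le_eq)
        then show "(9 * n) powr (\<epsilon> / ln L) \<le> (9 * n) powr 1" using n1 by (intro powr_mono) auto
        have "\<beta> * n \<le> \<epsilon> / (n * ln L) * n"
          using ex(4) unfolding \<beta>_def y_def by (intro mult_right_mono) auto
        also have "\<dots> = \<epsilon> / ln L" using n1 by simp
        finally show "\<alpha> powr (\<epsilon> / ln L) \<le> \<alpha> powr (\<beta> * n)"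
          using R(1) \<alpha>1 by (intro powr_mono') auto
      qed (use n1 in auto)
      also have "\<dots> = 9 * n * (\<alpha> powr \<beta>) ^ n"
        using R(1) by (simp add: powr_realpow[symmetric] powr_powr)
      finally have "3 * (9 * n * \<alpha>) powr (\<epsilon> / ln L) \<le> 27 * n * (\<alpha> powr \<beta>) ^ n" by simp
      also have "\<dots> \<le> (27 * n) ^ n * (\<alpha> powr \<beta>) ^ n"
      proof (intro mult_right_mono)
        have "real (27 * n) ^ 1 \<le> real (27 * n) ^ n" using n1 by (intro power_increasing) auto
        then show "real (27 * n) \<le> real ((27 * n) ^ n)" by simp
      qed auto
      finally show "(1 - \<epsilon>) ^ m \<le> (27 * n) ^ n * (\<alpha> powr \<beta>) ^ n" using m(2) by linarith
    qed (use A1 in auto)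
    also have "\<dots> = (19 * 2 ^ k * (27 * n) * \<alpha> powr \<beta> * (A * \<alpha> powr (- \<delta>)) ^ 3) ^ n"
      by (simp only: power_mult_distrib power_mult of_nat_power of_nat_mult of_nat_numeral mult.assoc)
    also have "19 * 2 ^ k * (27 * n) * \<alpha> powr \<beta> * (A * \<alpha> powr (- \<delta>)) ^ 3 = C * (\<alpha> powr \<beta> * (\<alpha> powr (- \<delta>)) ^ 3)"
      by (simp add: C_def power_mult_distrib)
    also have "(\<alpha> powr (- \<delta>)) ^ 3 = \<alpha> powr (- 3 * \<delta>)"
      using R(1) by (simp add: powr_realpow[symmetric] powr_powr mult.commute)
    also have "\<alpha> powr \<beta> * \<alpha> powr (- 3 * \<delta>) = \<alpha> powr (- 3 * \<delta> + \<beta>)"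
      by (simp add: powr_add[symmetric])
    finally have "?Q ^ n \<le> (C * \<alpha> powr (- 3 * \<delta> + \<beta>)) ^ n" .
    moreover have "0 \<le> C * \<alpha> powr (- 3 * \<delta> + \<beta>)" using C0 by simp
    ultimately show "?Q \<le> C * \<alpha> powr (- 3 * \<delta> + \<beta>)"
      using n1 by (meson less_le_trans not_le power_strict_mono zero_less_one)
  qed
qed

section \<open>Hausdorff measure of unions\<close>

definition covers :: "real \<Rightarrow> 'a::metric_space set \<Rightarrow> (nat \<Rightarrow> 'a set) set" where
  "covers \<epsilon> A = {U. A \<subseteq> (\<Union>i. U i) \<and> (\<forall>i. bounded (U i) \<and> diameter (U i) \<le> \<epsilon>)}"

lemma hausdorff_content_covers:
  "hausdorff_content \<delta> \<epsilon> A = (INF U \<in> covers \<epsilon> A. \<Sum>i. ennreal (diameter (U i) powr \<delta>))"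
  by (simp add: hausdorff_content_def covers_def)

lemma hausdorff_content_mono: "A \<subseteq> B \<Longrightarrow> hausdorff_content \<delta> \<epsilon> A \<le> hausdorff_content \<delta> \<epsilon> B"
  unfolding hausdorff_content_covers by (rule INF_superset_mono) (auto simp: covers_def)

lemma hausdorff_content_antimono: "\<epsilon> \<le> \<epsilon>' \<Longrightarrow> hausdorff_content \<delta> \<epsilon>' A \<le> hausdorff_content \<delta> \<epsilon> A"
  unfolding hausdorff_content_covers by (rule INF_superset_mono) (auto simp: covers_def intro: order_trans)

lemma hausdorff_measure_mono: "A \<subseteq> B \<Longrightarrow> hausdorff_measure \<delta> A \<le> hausdorff_measure \<delta> B"
  unfolding hausdorff_measure_def by (intro SUP_mono' hausdorff_content_mono)

lemma hausdorff_content_le_measure: "0 < \<epsilon> \<Longrightarrow> hausdorff_content \<delta> \<epsilon> A \<le> hausdorff_measure \<delta> A"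
  unfolding hausdorff_measure_def by (rule SUP_upper) simp

lemma hausdorff_measure_empty: "hausdorff_measure \<delta> ({} :: 'a::metric_space set) = 0"
proof -
  have "hausdorff_content \<delta> \<epsilon> ({} :: 'a set) \<le> 0" if "0 < \<epsilon>" for \<epsilon>
    unfolding hausdorff_content_covers
    by (rule INF_lower2[of "\<lambda>_. {}"]) (use that in \<open>auto simp: covers_def\<close>)
  then show ?thesis by (simp add: hausdorff_measure_def SUP_eq_const)
qed

lemma INF_add_const_ennreal:
  fixes f :: "'i \<Rightarrow> ennreal"
  assumes "I \<noteq> {}"
  shows "(INF i\<in>I. f i + c) = (INF i\<in>I. f i) + c"
  using continuous_at_Inf_mono[of "\<lambda>x. x + c" "f ` I"] assms
  using continuous_add[of "at_right (Inf (f ` I))", of "\<lambda>x. x" "\<lambda>x. c"]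
  by (auto simp: mono_def image_comp)

lemma suminf_interleave_le:
  fixes f g :: "nat \<Rightarrow> ennreal"
  shows "(\<Sum>i. if even i then f (i div 2) else g (i div 2)) \<le> (\<Sum>i. f i) + (\<Sum>i. g i)"
proof (rule suminf_le_const)
  let ?h = "\<lambda>i. if even i then f (i div 2) else g (i div 2)"
  fix n
  have double: "(\<Sum>i<2 * n. ?h i) = (\<Sum>i<n. f i) + (\<Sum>i<n. g i)" for n
    by (induction n) (auto simp: algebra_simps)
  have "(\<Sum>i<n. ?h i) \<le> (\<Sum>i<2 * n. ?h i)"
    by (intro sum_mono2) auto
  also have "\<dots> = (\<Sum>i<n. f i) + (\<Sum>i<n. g i)" by (rule double)
  also have "\<dots> \<le> (\<Sum>i. f i) + (\<Sum>i. g i)"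
    by (intro add_mono sum_le_suminf) auto
  finally show "(\<Sum>i<n. ?h i) \<le> (\<Sum>i. f i) + (\<Sum>i. g i)" .
qed auto

text \<open>Two covers are merged into one sequence by placing them at the even and the odd
  indices.\<close>

lemma hausdorff_content_Un_le:
  "hausdorff_content \<delta> \<epsilon> (A \<union> B) \<le> hausdorff_content \<delta> \<epsilon> A + hausdorff_content \<delta> \<epsilon> B"
proof -
  let ?d = "\<lambda>U::'a set. ennreal (diameter U powr \<delta>)"
  have le: "hausdorff_content \<delta> \<epsilon> (A \<union> B) \<le> (\<Sum>i. ?d (U i)) + (\<Sum>i. ?d (V i))"
    if U: "U \<in> covers \<epsilon> A" and V: "V \<in> covers \<epsilon> B" for U V
  proof -
    let ?W = "\<lambda>i. if even i then U (i div 2) else V (i div 2)"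
    have "(\<Union>i. U i) \<subseteq> (\<Union>i. ?W i)"
    proof (rule UN_least)
      show "U i \<subseteq> (\<Union>i. ?W i)" for i by (rule order.trans[OF _ UN_upper[of "2 * i"]]) auto
    qed
    moreover have "(\<Union>i. V i) \<subseteq> (\<Union>i. ?W i)"
    proof (rule UN_least)
      show "V i \<subseteq> (\<Union>i. ?W i)" for i by (rule order.trans[OF _ UN_upper[of "2 * i + 1"]]) auto
    qed
    moreover have "A \<subseteq> (\<Union>i. U i)" "B \<subseteq> (\<Union>i. V i)" using U V by (simp_all add: covers_def)
    ultimately have "A \<union> B \<subseteq> (\<Union>i. ?W i)" by (meson Un_least order.trans)
    then have W: "?W \<in> covers \<epsilon> (A \<union> B)" using U V by (simp add: covers_def)
    have "hausdorff_content \<delta> \<epsilon> (A \<union> B) \<le> (\<Sum>i. ?d (?W i))"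
      unfolding hausdorff_content_covers by (rule INF_lower[OF W])
    also have "(\<lambda>i. ?d (?W i)) = (\<lambda>i. if even i then ?d (U (i div 2)) else ?d (V (i div 2)))" by auto
    also have "(\<Sum>i. if even i then ?d (U (i div 2)) else ?d (V (i div 2))) \<le> (\<Sum>i. ?d (U i)) + (\<Sum>i. ?d (V i))"
      by (rule suminf_interleave_le)
    finally show ?thesis .
  qed
  have "hausdorff_content \<delta> \<epsilon> (A \<union> B) \<le> hausdorff_content \<delta> \<epsilon> A + (\<Sum>i. ?d (V i))"
    if V: "V \<in> covers \<epsilon> B" for V
  \<comment> \<open>In a general metric space there may be no countable cover by small sets; the
    content is then infinite.\<close>
  proof (cases "covers \<epsilon> A = {}")
    case True
    then show ?thesis by (simp add: hausdorff_content_covers)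
  next
    case False
    then have "hausdorff_content \<delta> \<epsilon> A + (\<Sum>i. ?d (V i)) = (INF U\<in>covers \<epsilon> A. (\<Sum>i. ?d (U i)) + (\<Sum>i. ?d (V i)))"
      by (simp add: hausdorff_content_covers INF_add_const_ennreal)
    then show ?thesis using le[OF _ V] by (auto intro!: INF_greatest)
  qed
  note le2 = this
  show ?thesis
  proof (cases "covers \<epsilon> B = {}")
    case True
    then show ?thesis by (simp add: hausdorff_content_covers)
  next
    case False
    then have "hausdorff_content \<delta> \<epsilon> A + hausdorff_content \<delta> \<epsilon> B = (INF V\<in>covers \<epsilon> B. hausdorff_content \<delta> \<epsilon> A + (\<Sum>i. ?d (V i)))"
      by (simp add: hausdorff_content_covers[of \<delta> \<epsilon> B] INF_add_const_ennreal add.commute[of "hausdorff_content \<delta> \<epsilon> A"])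
    then show ?thesis using le2 by (auto intro!: INF_greatest)
  qed
qed

lemma hausdorff_measure_Un_le:
  "hausdorff_measure \<delta> (A \<union> B) \<le> hausdorff_measure \<delta> A + hausdorff_measure \<delta> B"
  unfolding hausdorff_measure_def[of \<delta> "A \<union> B"]
proof (rule SUP_least)
  fix \<epsilon> :: real assume "\<epsilon> \<in> {0<..}"
  then show "hausdorff_content \<delta> \<epsilon> (A \<union> B) \<le> hausdorff_measure \<delta> A + hausdorff_measure \<delta> B"
    by (intro order.trans[OF hausdorff_content_Un_le] add_mono hausdorff_content_le_measure) auto
qed

lemma hausdorff_measure_UN_le:
  "finite F \<Longrightarrow> hausdorff_measure \<delta> (\<Union>v\<in>F. S v) \<le> (\<Sum>v\<in>F. hausdorff_measure \<delta> (S v))"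
proof (induction F rule: finite_induct)
  case empty
  then show ?case by (simp add: hausdorff_measure_empty)
next
  case (insert v F)
  then show ?case
    using hausdorff_measure_Un_le[of \<delta> "S v" "\<Union>v\<in>F. S v"] by (auto intro: order.trans add_left_mono)
qed

text \<open>A set of diameter at most \<epsilon> < \<sigma> cannot meet both \<open>A\<close> and
  \<open>B\<close>, so a cover of the union splits into two. Discarded sets become
  \<open>{}\<close>, which has diameter 0 and contributes
  \<open>0 powr \<delta> = 0\<close>.\<close>

lemma hausdorff_content_Un_separated:
  fixes A B :: "'a::metric_space set"
  assumes sep: "\<And>a b. a \<in> A \<Longrightarrow> b \<in> B \<Longrightarrow> \<sigma> \<le> dist a b" and \<epsilon>: "0 < \<epsilon>" "\<epsilon> < \<sigma>"
  shows "hausdorff_content \<delta> \<epsilon> A + hausdorff_content \<delta> \<epsilon> B \<le> hausdorff_content \<delta> \<epsilon> (A \<union> B)"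
  unfolding hausdorff_content_covers[of \<delta> \<epsilon> "A \<union> B"]
proof (rule INF_greatest)
  fix U assume U: "U \<in> covers \<epsilon> (A \<union> B)"
  let ?d = "\<lambda>U::'a set. ennreal (diameter U powr \<delta>)"
  define P where "P A i = (if U i \<inter> A = {} then {} else U i)" for A i
  have P: "P A \<in> covers \<epsilon> A" "P B \<in> covers \<epsilon> B"
    using U \<epsilon> unfolding covers_def P_def by (auto, blast+)
  have "hausdorff_content \<delta> \<epsilon> A + hausdorff_content \<delta> \<epsilon> B \<le> (\<Sum>i. ?d (P A i)) + (\<Sum>i. ?d (P B i))"
    unfolding hausdorff_content_covers by (intro add_mono INF_lower P)
  also have "\<dots> = (\<Sum>i. ?d (P A i) + ?d (P B i))"
    by (intro suminf_add) auto
  also have "\<dots> \<le> (\<Sum>i. ?d (U i))"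
  proof (intro suminf_le)
    fix i
    have "U i \<inter> A = {} \<or> U i \<inter> B = {}"
    proof (rule ccontr)
      assume "\<not> ?thesis"
      then obtain a b where ab: "a \<in> U i" "a \<in> A" "b \<in> U i" "b \<in> B" by auto
      have "dist a b \<le> diameter (U i)"
        using U ab by (intro diameter_bounded_bound) (auto simp: covers_def)
      also have "\<dots> \<le> \<epsilon>" using U by (auto simp: covers_def)
      finally show False using sep[OF ab(2,4)] \<epsilon> by simp
    qed
    then show "?d (P A i) + ?d (P B i) \<le> ?d (U i)" by (auto simp: P_def)
  qed auto
  finally show "hausdorff_content \<delta> \<epsilon> A + hausdorff_content \<delta> \<epsilon> B \<le> (\<Sum>i. ?d (U i))" .
qed

lemma hausdorff_measure_Un_separated:
  fixes A B :: "'a::metric_space set"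
  assumes sep: "\<And>a b. a \<in> A \<Longrightarrow> b \<in> B \<Longrightarrow> \<sigma> \<le> dist a b" and \<sigma>: "0 < \<sigma>"
  shows "hausdorff_measure \<delta> A + hausdorff_measure \<delta> B \<le> hausdorff_measure \<delta> (A \<union> B)"
proof -
  have le: "hausdorff_content \<delta> \<epsilon> A + hausdorff_content \<delta> \<epsilon>' B \<le> hausdorff_measure \<delta> (A \<union> B)"
    if "0 < \<epsilon>" "0 < \<epsilon>'" for \<epsilon> \<epsilon>'
  proof -
    let ?e = "min (min \<epsilon> \<epsilon>') (\<sigma> / 2)"
    have "hausdorff_content \<delta> \<epsilon> A + hausdorff_content \<delta> \<epsilon>' B \<le> hausdorff_content \<delta> ?e A + hausdorff_content \<delta> ?e B"
      by (intro add_mono hausdorff_content_antimono) auto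
    also have "\<dots> \<le> hausdorff_content \<delta> ?e (A \<union> B)"
      by (rule hausdorff_content_Un_separated[OF sep]) (use that \<sigma> in auto)
    also have "\<dots> \<le> hausdorff_measure \<delta> (A \<union> B)"
      using that \<sigma> by (intro hausdorff_content_le_measure) auto
    finally show ?thesis .
  qed
  have "hausdorff_measure \<delta> A + hausdorff_content \<delta> \<epsilon>' B \<le> hausdorff_measure \<delta> (A \<union> B)" if "0 < \<epsilon>'" for \<epsilon>'
    unfolding hausdorff_measure_def[of \<delta> A]
    by (subst ennreal_SUP_add_left[symmetric]) (auto intro!: SUP_least le that)
  then show ?thesis
    unfolding hausdorff_measure_def[of \<delta> B]
    by (subst add.commute, subst ennreal_SUP_add_left[symmetric]) (auto intro!: SUP_least simp: add.commute)
qed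

lemma hausdorff_measure_UN_separated:
  fixes S :: "'b \<Rightarrow> 'a::metric_space set"
  assumes "finite F" and \<sigma>: "0 < \<sigma>"
    and sep: "\<And>u v a b. u \<in> F \<Longrightarrow> v \<in> F \<Longrightarrow> u \<noteq> v \<Longrightarrow> a \<in> S u \<Longrightarrow> b \<in> S v \<Longrightarrow> \<sigma> \<le> dist a b"
  shows "(\<Sum>v\<in>F. hausdorff_measure \<delta> (S v)) \<le> hausdorff_measure \<delta> (\<Union>v\<in>F. S v)"
  using assms(1,3)
proof (induction F rule: finite_induct)
  case empty
  then show ?case by simp
next
  case (insert v F)
  have "(\<Sum>u\<in>F. hausdorff_measure \<delta> (S u)) \<le> hausdorff_measure \<delta> (\<Union>u\<in>F. S u)"
    using insert.prems by (intro insert.IH) blast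
  then have "(\<Sum>u\<in>insert v F. hausdorff_measure \<delta> (S u)) \<le> hausdorff_measure \<delta> (S v) + hausdorff_measure \<delta> (\<Union>u\<in>F. S u)"
    using insert.hyps by (simp add: add_left_mono)
  also have "\<dots> \<le> hausdorff_measure \<delta> (S v \<union> (\<Union>u\<in>F. S u))"
    using insert.hyps insert.prems by (intro hausdorff_measure_Un_separated[OF _ \<sigma>]) blast
  finally show ?case by simp
qed

section \<open>Stereographic coordinates\<close>

text \<open>The Japanese bracket. In the stereographic coordinate the arc length element of the
  circle is 2 dt / (jap t)^2, and chords have length
  \<open>2 * \<bar>t - t'\<bar> / (jap t * jap t')\<close>.\<close>

definition jap :: "real \<Rightarrow> real" where
  "jap t = sqrt (1 + t\<^sup>2)"

lemma jap_ge_1: "1 \<le> jap t"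
  by (simp add: jap_def)

lemma jap_nonneg: "0 \<le> jap t"
  by (simp add: jap_def)

lemma jap_le_add: "jap t' \<le> jap t + \<bar>t' - t\<bar>"
proof -
  have "sqrt ((1 + 0)\<^sup>2 + (t + (t' - t))\<^sup>2) \<le> sqrt (1\<^sup>2 + t\<^sup>2) + sqrt (0\<^sup>2 + (t' - t)\<^sup>2)"
    by (rule real_sqrt_sum_squares_triangle_ineq)
  then show ?thesis by (simp add: jap_def)
qed

lemma jap_close:
  assumes "\<bar>t' - t\<bar> \<le> 1/2"
  shows "jap t / 2 \<le> jap t'" "jap t' \<le> 3/2 * jap t"
  using jap_le_add[of t t'] jap_le_add[of t' t] jap_ge_1[of t] assms by (auto simp: abs_minus_commute)

lemma powr_mult_le_linear:
  fixes a x \<delta> :: real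
  assumes "1 \<le> a" "0 \<le> \<delta>" "\<delta> \<le> 1"
  shows "(a * x) powr \<delta> \<le> a * x powr \<delta>"
proof -
  have "a powr \<delta> \<le> a powr 1" using assms by (intro powr_mono) auto
  then show ?thesis using assms by (simp add: powr_mult mult_right_mono)
qed

text \<open>The chart is far from an isometry near the pole, but its conformal factor changes only
  by a bounded ratio over a coordinate distance 1/2. Regularity is invariant under scaling, so the
  factor cancels from the ratio of two radii, and the constant depends neither on the position nor
  on \<alpha>.\<close>

lemma regular_net_of_chart:
  fixes \<Lambda> :: "'a::metric_space set" and x :: "'a \<Rightarrow> real" and k :: nat
  assumes lower: "\<And>y r. y \<in> \<Lambda> \<Longrightarrow> 0 < r \<Longrightarrow> r < 2 \<Longrightarrow>
      ennreal (inverse C * r powr \<delta>) \<le> hausdorff_measure \<delta> (\<Lambda> \<inter> ball y r)"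
    and upper: "\<And>y r. y \<in> \<Lambda> \<Longrightarrow> 0 < r \<Longrightarrow> r < 2 \<Longrightarrow>
      hausdorff_measure \<delta> (\<Lambda> \<inter> ball y r) \<le> ennreal (C * r powr \<delta>)"
    and chord: "\<And>y y'. y \<in> \<Lambda> - {y0} \<Longrightarrow> y' \<in> \<Lambda> - {y0} \<Longrightarrow> dist y y' = 2 * \<bar>x y - x y'\<bar> / (jap (x y) * jap (x y'))"
    and pole: "\<And>y. y \<in> \<Lambda> - {y0} \<Longrightarrow> dist y y0 = 2 / jap (x y)"
    and V: "V \<subseteq> x ` (\<Lambda> - {y0})" "separated \<alpha> V"
    and net: "\<And>t. t \<in> x ` (\<Lambda> - {y0}) \<Longrightarrow> \<exists>u\<in>V. dist t u < \<alpha>"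
    and \<alpha>: "0 < \<alpha>" and \<delta>: "0 < \<delta>" "\<delta> < 1" and C: "1 \<le> C" "32 * C\<^sup>2 \<le> 2 ^ k"
  shows "regular_net V \<alpha> \<delta> k"
proof -
  let ?H = "\<lambda>S. hausdorff_measure \<delta> (\<Lambda> \<inter> S)"
  define pt where "pt = inv_into (\<Lambda> - {y0}) x"
  have pt: "pt u \<in> \<Lambda> - {y0} \<and> x (pt u) = u" if "u \<in> V" for u
    using subsetD[OF V(1) that] unfolding pt_def by (simp only: inv_into_into f_inv_into_f simp_thms)
  have "finite (V \<inter> ball v r) \<and> (r / \<alpha>) powr \<delta> \<le> 2 ^ k * real (card (V \<inter> ball v r)) \<and>
      card (V \<inter> ball v r) \<le> 2 ^ k * (r / \<alpha>) powr \<delta>"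
    if v: "v \<in> V" and r: "\<alpha> \<le> r" "r \<le> 1/8" for v r
  proof -
    \<comment> \<open>The conformal factor at \<open>v\<close>: coordinate distances near
      \<open>v\<close>, multiplied by \<open>w\<close>, are comparable to distances on the
      circle.\<close>
    define w where "w = 2 / (jap v)\<^sup>2"
    have j1: "1 \<le> jap v" by (rule jap_ge_1)
    have w0: "0 < w" using j1 by (simp add: w_def)
    have "1 \<le> (jap v)\<^sup>2" using j1 by simp
    then have w2: "w \<le> 2" by (simp add: w_def divide_le_eq)
    have r0: "0 < r" using r \<alpha> by linarith
    have rw: "r * w \<le> 1/8 * 2" using r r0 w0 w2 by (intro mult_mono) auto
    have \<alpha>w: "\<alpha> * w \<le> r * w" using r w0 by (intro mult_right_mono) auto
    have \<alpha>w0: "0 < \<alpha> * w" using \<alpha> w0 by simp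
    have pv: "pt v \<in> \<Lambda> - {y0}" "x (pt v) = v" using pt[OF v] by auto
    have chord_upper: "dist y y' \<le> 2 * \<bar>x y - x y'\<bar> * (2 / (jap (x y))\<^sup>2)"
      if y: "y \<in> \<Lambda> - {y0}" "y' \<in> \<Lambda> - {y0}" "\<bar>x y - x y'\<bar> \<le> 1/2" for y y'
    proof -
      have "jap (x y) / 2 \<le> jap (x y')" using jap_close(1)[of "x y'" "x y"] y(3) by (simp add: abs_minus_commute)
      then have "2 * \<bar>x y - x y'\<bar> / (jap (x y) * jap (x y')) \<le> 2 * \<bar>x y - x y'\<bar> / (jap (x y) * (jap (x y) / 2))"
        using jap_ge_1[of "x y"] jap_ge_1[of "x y'"] by (intro divide_left_mono mult_left_mono mult_pos_pos) auto
      then show ?thesis using chord[OF y(1,2)] by (simp add: power2_eq_square)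
    qed
    have card_le: "finite F \<Longrightarrow> F \<subseteq> V \<inter> ball v r \<Longrightarrow> real (card F) \<le> 2 ^ k * (r / \<alpha>) powr \<delta>" for F
    proof -
      assume F: "finite F" "F \<subseteq> V \<inter> ball v r"
      \<comment> \<open>By \<open>jap_close\<close> the points of \<open>F\<close> are at least
        \<open>4 * (\<alpha> * w / 9)\<close> apart on the circle, the 9 coming from two factors
        3/2. Balls of radius \<open>\<alpha> * w / 9\<close> therefore stay separated and their
        measures add up.\<close>
      define S where "S u = \<Lambda> \<inter> ball (pt u) (\<alpha> * w / 9)" for u
      have Fu: "u \<in> V" "\<bar>u - v\<bar> < r" if "u \<in> F" for u
        using that F by (auto simp: dist_real_def abs_minus_commute)
      have sep: "\<alpha> * w / 9 \<le> dist a b" if u: "u \<in> F" "u' \<in> F" "u \<noteq> u'" "a \<in> S u" "b \<in> S u'" for u u' a b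
      proof -
        have "\<alpha> \<le> \<bar>u - u'\<bar>" using V(2) Fu u by (auto simp: separated_def dist_real_def)
        then have "2 * \<alpha> / ((3/2 * jap v) * (3/2 * jap v)) \<le> 2 * \<bar>u - u'\<bar> / (jap u * jap u')"
          using jap_close(2)[of u v] jap_close(2)[of u' v] Fu(2)[OF u(1)] Fu(2)[OF u(2)] r \<alpha>
            jap_ge_1[of u] jap_ge_1[of u'] j1
          by (intro frac_le mult_mono) auto
        also have "\<dots> = dist (pt u) (pt u')"
          using chord[of "pt u" "pt u'"] pt Fu u by simp
        also have "2 * \<alpha> / ((3/2 * jap v) * (3/2 * jap v)) = 4 * (\<alpha> * w / 9)"
          by (simp add: w_def power2_eq_square)
        finally have "4 * (\<alpha> * w / 9) \<le> dist (pt u) (pt u')" .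
        also have "\<dots> \<le> dist (pt u) a + dist a b + dist b (pt u')"
          using dist_triangle[of "pt u" "pt u'" a] dist_triangle[of a "pt u'" b] by linarith
        finally show ?thesis using u(4,5) \<alpha>w0 by (simp add: S_def dist_commute)
      qed
      have S_sub: "S u \<subseteq> \<Lambda> \<inter> ball (pt v) (3 * (r * w))" if "u \<in> F" for u
      proof
        fix a assume a: "a \<in> S u"
        have "dist (pt v) (pt u) \<le> 2 * \<bar>v - u\<bar> * w"
          using chord_upper[of "pt v" "pt u"] pt[of u] pv Fu[OF that] r by (auto simp: w_def abs_minus_commute)
        also have "\<dots> \<le> 2 * r * w"
          using Fu(2)[OF that] w0 by (intro mult_right_mono) (auto simp: abs_minus_commute)
        finally have "dist (pt v) (pt u) \<le> 2 * (r * w)" by simp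
        moreover have "dist (pt u) a < \<alpha> * w" using a \<alpha>w0 by (simp add: S_def)
        ultimately have "dist (pt v) a < 3 * (r * w)"
          using dist_triangle[of "pt v" a "pt u"] \<alpha>w by linarith
        then show "a \<in> \<Lambda> \<inter> ball (pt v) (3 * (r * w))" using a by (simp add: S_def)
      qed
      have "(\<Sum>u\<in>F. ennreal (inverse C * (\<alpha> * w / 9) powr \<delta>)) \<le> (\<Sum>u\<in>F. hausdorff_measure \<delta> (S u))"
        unfolding S_def using pt Fu \<alpha>w \<alpha>w0 rw by (intro sum_mono lower) auto
      also have "\<dots> \<le> hausdorff_measure \<delta> (\<Union>u\<in>F. S u)"
        using \<alpha>w0 by (intro hausdorff_measure_UN_separated[OF F(1) _ sep]) auto
      also have "\<dots> \<le> ?H (ball (pt v) (3 * (r * w)))"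
        using S_sub by (intro hausdorff_measure_mono) blast
      also have "\<dots> \<le> ennreal (C * (3 * (r * w)) powr \<delta>)"
        using pv rw r0 w0 by (intro upper) auto
      also have "(\<Sum>u\<in>F. ennreal (inverse C * (\<alpha> * w / 9) powr \<delta>)) = ennreal (card F * (inverse C * (\<alpha> * w / 9) powr \<delta>))"
        using C by (subst sum_ennreal) auto
      finally have le: "card F * (inverse C * (\<alpha> * w / 9) powr \<delta>) \<le> C * (3 * (r * w)) powr \<delta>"
        using C by (subst (asm) ennreal_le_iff) auto
      have "3 * (r * w) = 27 * (r / \<alpha>) * (\<alpha> * w / 9)" using \<alpha> by simp
      then have "(3 * (r * w)) powr \<delta> = (27 * (r / \<alpha>)) powr \<delta> * (\<alpha> * w / 9) powr \<delta>"
        by (simp only: powr_mult)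
      then have "(card F * inverse C) * (\<alpha> * w / 9) powr \<delta> \<le> (C * (27 * (r / \<alpha>)) powr \<delta>) * (\<alpha> * w / 9) powr \<delta>"
        using le by (simp only: mult.assoc)
      moreover have "0 < (\<alpha> * w / 9) powr \<delta>" using \<alpha> w0 by simp
      ultimately have "card F * inverse C \<le> C * (27 * (r / \<alpha>)) powr \<delta>"
        by (simp only: mult_le_cancel_right_pos)
      then have "real (card F) \<le> C\<^sup>2 * (27 * (r / \<alpha>)) powr \<delta>"
        using C by (simp add: field_simps power2_eq_square)
      also have "\<dots> \<le> C\<^sup>2 * (27 * (r / \<alpha>) powr \<delta>)"
        using \<delta> by (intro mult_left_mono powr_mult_le_linear) auto
      also have "\<dots> = (27 * C\<^sup>2) * (r / \<alpha>) powr \<delta>" by simp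
      also have "\<dots> \<le> 2 ^ k * (r / \<alpha>) powr \<delta>"
      proof (rule mult_right_mono)
        have "0 \<le> C\<^sup>2" by simp
        then show "27 * C\<^sup>2 \<le> 2 ^ k" using C(2) by linarith
      qed simp
      finally show ?thesis .
    qed
    have fin: "finite (V \<inter> ball v r)"
    proof (rule ccontr)
      assume "infinite (V \<inter> ball v r)"
      then obtain F where "finite F" "card F = Suc (nat \<lceil>2 ^ k * (r / \<alpha>) powr \<delta>\<rceil>)" "F \<subseteq> V \<inter> ball v r"
        using infinite_arbitrarily_large by blast
      then show False using card_le[of F] by linarith
    qed
    have up: "card (V \<inter> ball v r) \<le> 2 ^ k * (r / \<alpha>) powr \<delta>"
      using card_le[OF fin] by simp
    have "(r / \<alpha>) powr \<delta> \<le> 2 ^ k * real (card (V \<inter> ball v r))"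
    \<comment> \<open>For \<open>r\<close> below \<open>2 * \<alpha>\<close> the centre
      \<open>v\<close> alone suffices. Otherwise a net point within \<alpha> of a coordinate at
      distance at most \<open>r / 2\<close> from \<open>v\<close> is still in the ball of radius
      \<open>r\<close>.\<close>
    proof (cases "2 * \<alpha> \<le> r")
      case False
      have "1 \<le> C\<^sup>2" using C(1) by simp
      then have k2: "2 \<le> (2::real) ^ k" using C(2) by linarith
      have "(r / \<alpha>) powr \<delta> \<le> 2 powr \<delta>" using False \<alpha> r0 \<delta> by (intro powr_mono2) (auto simp: field_simps)
      also have "\<dots> \<le> 2 powr 1" using \<delta> by (intro powr_mono) auto
      also have "\<dots> \<le> 2 ^ k * 1" using k2 by simp
      also have "\<dots> \<le> 2 ^ k * real (card (V \<inter> ball v r))"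
      proof (rule mult_left_mono)
        have "V \<inter> ball v r \<noteq> {}" using v r0 by auto
        then have "0 < card (V \<inter> ball v r)" using fin by (simp add: card_gt_0_iff)
        then show "1 \<le> real (card (V \<inter> ball v r))" by simp
      qed simp
      finally show ?thesis .
    next
      case True
      have sub: "\<Lambda> \<inter> ball (pt v) (r / 2 * w / 2) \<subseteq> (\<Union>u\<in>V \<inter> ball v r. \<Lambda> \<inter> ball (pt u) (8 * (\<alpha> * w)))"
      proof
        fix a assume a: "a \<in> \<Lambda> \<inter> ball (pt v) (r / 2 * w / 2)"
        have d: "dist (pt v) a < r / 2 * w / 2" using a by simp
        have "r / 2 * w / 2 \<le> w" using r w0 by simp
        also have "w \<le> 2 / jap v"
          unfolding w_def power2_eq_square using j1 by (intro divide_left_mono mult_pos_pos) auto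
        \<comment> \<open>The pole is at distance \<open>2 / jap v \<ge> w\<close> from
          \<open>pt v\<close>, out of reach of the small ball, so \<open>a\<close> has a
          coordinate.\<close>
        finally have "a \<noteq> y0" using d pole[OF pv(1)] pv(2) by auto
        then have a': "a \<in> \<Lambda> - {y0}" using a by simp
        define \<Delta> where "\<Delta> = \<bar>v - x a\<bar>"
        have "\<Delta> = dist (pt v) a * jap v * jap (x a) / 2"
          using chord[OF pv(1) a'] pv(2) j1 jap_ge_1[of "x a"] by (simp add: \<Delta>_def field_simps)
        \<comment> \<open>Nothing bounds \<open>jap (x a)\<close> in advance, so \<Delta> enters on
          the right as well. Its coefficient turns out to be at most 1/2 and it is absorbed.\<close>
        also have "\<dots> \<le> dist (pt v) a * jap v * (jap v + \<Delta>) / 2"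
          using jap_le_add[of "x a" v] j1
          by (intro divide_right_mono mult_left_mono) (auto simp: \<Delta>_def abs_minus_commute)
        also have "\<dots> \<le> (r / 2 * w / 2) * jap v * (jap v + \<Delta>) / 2"
          using d j1 by (intro divide_right_mono mult_right_mono) (auto simp: \<Delta>_def)
        also have "\<dots> = r / 4 + (r / 4 / jap v) * \<Delta>"
          using j1 by (simp add: w_def power2_eq_square field_simps)
        also have "\<dots> \<le> r / 4 + 1/2 * \<Delta>"
        proof -
          have "r / 4 / jap v \<le> r / 4 / 1" using r0 j1 by (intro divide_left_mono) auto
          then have "r / 4 / jap v \<le> 1/2" using r by simp
          then show ?thesis by (intro add_left_mono mult_right_mono) (auto simp: \<Delta>_def)
        qed
        finally have \<Delta>: "\<Delta> \<le> r / 2" by simp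
        obtain u where u: "u \<in> V" "dist (x a) u < \<alpha>" using net a' by blast
        have uv: "\<bar>u - v\<bar> < r" using u(2) \<Delta> True unfolding \<Delta>_def dist_real_def by linarith
        have "dist (pt u) a \<le> 2 * \<bar>u - x a\<bar> * (2 / (jap u)\<^sup>2)"
          using chord_upper[of "pt u" a] pt[OF u(1)] a' u(2) r by (simp add: dist_real_def abs_minus_commute)
        also have "\<dots> \<le> 2 * \<bar>u - x a\<bar> * (2 / (jap v / 2)\<^sup>2)"
          using jap_close(1)[of u v] uv r j1 jap_ge_1[of u]
          by (intro mult_left_mono divide_left_mono power_mono) auto
        also have "\<dots> = 8 * (\<bar>u - x a\<bar> * w)" by (simp add: w_def power_divide)
        also have "\<dots> < 8 * (\<alpha> * w)"
          using u(2) w0 by (simp add: dist_real_def abs_minus_commute)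
        finally show "a \<in> (\<Union>u\<in>V \<inter> ball v r. \<Lambda> \<inter> ball (pt u) (8 * (\<alpha> * w)))"
          using a u(1) uv by (intro UN_I[of u]) (auto simp: dist_real_def abs_minus_commute)
      qed
      have "2 * (\<alpha> * w) \<le> r * w" using True w0 by simp
      then have \<alpha>w8: "8 * (\<alpha> * w) < 2" using rw by linarith
      have "ennreal (inverse C * (r / 2 * w / 2) powr \<delta>) \<le> ?H (ball (pt v) (r / 2 * w / 2))"
        using pv rw r0 w0 by (intro lower) auto
      also have "\<dots> \<le> hausdorff_measure \<delta> (\<Union>u\<in>V \<inter> ball v r. \<Lambda> \<inter> ball (pt u) (8 * (\<alpha> * w)))"
        by (rule hausdorff_measure_mono[OF sub])
      also have "\<dots> \<le> (\<Sum>u\<in>V \<inter> ball v r. ?H (ball (pt u) (8 * (\<alpha> * w))))"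
        by (rule hausdorff_measure_UN_le[OF fin])
      also have "\<dots> \<le> (\<Sum>u\<in>V \<inter> ball v r. ennreal (C * (8 * (\<alpha> * w)) powr \<delta>))"
        using pt \<alpha>w0 \<alpha>w8 by (intro sum_mono upper) auto
      also have "\<dots> = ennreal (card (V \<inter> ball v r) * (C * (8 * (\<alpha> * w)) powr \<delta>))"
        using C by (subst sum_ennreal) auto
      finally have "inverse C * (r / 2 * w / 2) powr \<delta> \<le> card (V \<inter> ball v r) * (C * (8 * (\<alpha> * w)) powr \<delta>)"
        using C by (subst (asm) ennreal_le_iff) auto
      then have le: "(r / 2 * w / 2) powr \<delta> \<le> C\<^sup>2 * card (V \<inter> ball v r) * (8 * (\<alpha> * w)) powr \<delta>"
        using C by (simp add: field_simps power2_eq_square)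
      \<comment> \<open>32 is the ratio of the 8 in the covering radius to the 1/4 in the covered
        one; it explains the hypothesis \<open>32 * C\<^sup>2 \<le> 2 ^ k\<close>.\<close>
      have "(r / \<alpha>) powr \<delta> = (32 * ((r / 2 * w / 2) / (8 * (\<alpha> * w)))) powr \<delta>"
        using w0 by simp
      also have "\<dots> \<le> 32 * ((r / 2 * w / 2) / (8 * (\<alpha> * w))) powr \<delta>"
        using \<delta> by (intro powr_mult_le_linear) auto
      also have "\<dots> = 32 * ((r / 2 * w / 2) powr \<delta> / (8 * (\<alpha> * w)) powr \<delta>)"
        by (simp only: powr_divide)
      also have "\<dots> \<le> 32 * (C\<^sup>2 * card (V \<inter> ball v r))"
        using le \<alpha>w0 by (intro mult_left_mono) (auto simp: divide_le_eq)
      also have "\<dots> = (32 * C\<^sup>2) * card (V \<inter> ball v r)" by simp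
      also have "\<dots> \<le> 2 ^ k * real (card (V \<inter> ball v r))"
        using C(2) by (intro mult_right_mono) auto
      finally show ?thesis .
    qed
    then show ?thesis using fin up by blast
  qed
  then show ?thesis unfolding regular_net_def using \<alpha> \<delta> by blast
qed

section \<open>Stereographic projection of the circle onto a tangent line\<close>

definition unit_tangent :: "real^2 \<Rightarrow> real^2" where
  "unit_tangent y = vector [- (y$2), y$1]"

lemma norm_sq_vec2: "(norm (y :: real^2))\<^sup>2 = (y$1)\<^sup>2 + (y$2)\<^sup>2"
  unfolding power2_norm_eq_inner by (simp add: inner_vec_def sum_2 power2_eq_square)

lemma inner_vec2: "(x :: real^2) \<bullet> y = x$1 * y$1 + x$2 * y$2"
  by (simp add: inner_vec_def sum_2)

context
  fixes y0 :: "real^2"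
  assumes y0: "norm y0 = 1"
begin

lemma y0_sq: "(y0$1)\<^sup>2 + (y0$2)\<^sup>2 = 1"
  using norm_sq_vec2[of y0] y0 by simp

lemma norm_unit_tangent: "norm (unit_tangent y0) = 1"
proof -
  have "(norm (unit_tangent y0))\<^sup>2 = 1"
    using y0_sq by (simp add: norm_sq_vec2 unit_tangent_def vector_2 add.commute)
  then have "norm (unit_tangent y0) ^ 2 = 1 ^ 2" by simp
  then show ?thesis by (rule power2_eq_imp_eq) simp_all
qed

lemma unit_tangent_in: "unit_tangent y0 \<in> tangent_line y0"
  by (simp add: tangent_line_def inner_vec2 unit_tangent_def vector_2)

lemma tangent_line_eq:
  assumes "v \<in> tangent_line y0"
  shows "v = (v \<bullet> unit_tangent y0) *\<^sub>R unit_tangent y0"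
proof -
  have o: "v$1 * y0$1 + v$2 * y0$2 = 0" using assms by (simp add: tangent_line_def inner_vec2)
  have "v$1 = v$1 * ((y0$1)\<^sup>2 + (y0$2)\<^sup>2) - y0$1 * (v$1 * y0$1 + v$2 * y0$2)"
    using y0_sq o by simp
  moreover have "v$2 = v$2 * ((y0$1)\<^sup>2 + (y0$2)\<^sup>2) - y0$2 * (v$1 * y0$1 + v$2 * y0$2)"
    using y0_sq o by simp
  ultimately show ?thesis
    by (simp add: vec_eq_iff forall_2 inner_vec2 unit_tangent_def vector_2 power2_eq_square algebra_simps)
qed

lemma subspace_tangent_line: "subspace (tangent_line y0)"
  unfolding tangent_line_def by (simp add: subspace_def inner_add_left)

lemma dim_tangent_line: "dim (tangent_line y0) = 1"
proof -
  have "tangent_line y0 = span {unit_tangent y0}"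
  proof
    show "tangent_line y0 \<subseteq> span {unit_tangent y0}"
    proof
      fix v assume "v \<in> tangent_line y0"
      from tangent_line_eq[OF this] show "v \<in> span {unit_tangent y0}"
        by (metis span_base span_scale singletonI)
    qed
    show "span {unit_tangent y0} \<subseteq> tangent_line y0"
      using unit_tangent_in subspace_tangent_line by (intro span_minimal) auto
  qed
  moreover have "unit_tangent y0 \<noteq> 0" using norm_unit_tangent by auto
  ultimately show ?thesis by (simp add: dim_singleton)
qed

lemma line_lebesgue_tangent: "line_lebesgue (tangent_line y0) = distr lborel borel (\<lambda>t. t *\<^sub>R unit_tangent y0)"
  by (rule line_lebesgue_eq[OF subspace_tangent_line dim_tangent_line unit_tangent_in norm_unit_tangent])

lemma emeasure_tangent_ball:
  assumes "0 \<le> r"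
  shows "emeasure (line_lebesgue (tangent_line y0)) (ball (u *\<^sub>R unit_tangent y0) r) = ennreal (2 * r)"
proof -
  let ?e = "unit_tangent y0"
  have "emeasure (line_lebesgue (tangent_line y0)) (ball (u *\<^sub>R ?e) r)
      = emeasure lborel ((\<lambda>t. t *\<^sub>R ?e) -` ball (u *\<^sub>R ?e) r \<inter> space lborel)"
    unfolding line_lebesgue_tangent by (intro emeasure_distr) auto
  also have "(\<lambda>t. t *\<^sub>R ?e) -` ball (u *\<^sub>R ?e) r \<inter> space lborel = {u - r<..<u + r}"
    by (auto simp: dist_norm scaleR_diff_left[symmetric] norm_unit_tangent)
  finally show ?thesis using assms by simp
qed

lemma sigma_finite_tangent: "sigma_finite_measure (line_lebesgue (tangent_line y0))"
proof
  let ?M = "line_lebesgue (tangent_line y0)"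
  have sp: "space ?M = UNIV" "sets ?M = sets borel" by (simp_all add: line_lebesgue_tangent)
  let ?A = "(\<lambda>n::nat. ball (0 *\<^sub>R unit_tangent y0) (real n)) ` UNIV"
  show "\<exists>A. countable A \<and> A \<subseteq> sets ?M \<and> \<Union> A = space ?M \<and> (\<forall>a\<in>A. emeasure ?M a \<noteq> \<infinity>)"
  proof (intro exI[of _ ?A] conjI)
    show "countable ?A" by simp
    show "?A \<subseteq> sets ?M" unfolding sp by auto
    show "\<Union> ?A = space ?M" unfolding sp by (auto simp: real_arch_simple reals_Archimedean2)
    show "\<forall>a\<in>?A. emeasure ?M a \<noteq> \<infinity>" by (auto simp only: emeasure_tangent_ball) auto
  qed
qed

abbreviation coord :: "real^2 \<Rightarrow> real" where
  "coord y \<equiv> stereo y0 y \<bullet> unit_tangent y0"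

lemma stereo_in_tangent: "stereo y0 y \<in> tangent_line y0"
  using y0 by (simp add: stereo_def tangent_line_def inner_diff_left inner_diff_right inner_commute dot_square_norm)

lemma stereo_coord: "stereo y0 y = coord y *\<^sub>R unit_tangent y0"
  by (rule tangent_line_eq[OF stereo_in_tangent])

lemma inner_less_1:
  assumes "norm y = 1" "y \<noteq> y0"
  shows "y0 \<bullet> y < 1"
proof -
  have "(norm (y0 - y))\<^sup>2 = 2 - 2 * (y0 \<bullet> y)"
    using y0 assms(1) by (simp add: power2_norm_eq_inner inner_diff inner_commute) (simp add: dot_square_norm)
  moreover have "0 < (norm (y0 - y))\<^sup>2" using assms(2) by simp
  ultimately show ?thesis by simp
qed

text \<open>The images lie on one line, so the product of their coordinates is their inner product.
  The diagonal case gives \<open>jap_coord\<close>, the general case the chord formula.\<close>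

lemma coord_mult:
  assumes "norm y = 1" "norm y' = 1" "y \<noteq> y0" "y' \<noteq> y0"
  shows "coord y * coord y' * ((1 - y0 \<bullet> y) * (1 - y0 \<bullet> y')) = y \<bullet> y' - (y0 \<bullet> y) * (y0 \<bullet> y')"
proof -
  have "stereo y0 y \<bullet> stereo y0 y' = coord y * coord y' * (unit_tangent y0 \<bullet> unit_tangent y0)"
    by (subst (1 2) stereo_coord) simp
  then have *: "stereo y0 y \<bullet> stereo y0 y' = coord y * coord y'"
    using norm_unit_tangent by (simp add: dot_square_norm)
  have "(y - (y0 \<bullet> y) *\<^sub>R y0) \<bullet> (y' - (y0 \<bullet> y') *\<^sub>R y0) = y \<bullet> y' - (y0 \<bullet> y) * (y0 \<bullet> y')"
    using y0 by (simp add: inner_diff inner_commute dot_square_norm algebra_simps)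
  moreover have "stereo y0 y \<bullet> stereo y0 y' =
     ((y - (y0 \<bullet> y) *\<^sub>R y0) \<bullet> (y' - (y0 \<bullet> y') *\<^sub>R y0)) / ((1 - y0 \<bullet> y) * (1 - y0 \<bullet> y'))"
    by (simp add: stereo_def)
  ultimately show ?thesis
    using inner_less_1[of y] inner_less_1[of y'] assms by (simp add: *)
qed

lemma jap_coord:
  assumes "norm y = 1" "y \<noteq> y0"
  shows "(jap (coord y))\<^sup>2 = 2 / (1 - y0 \<bullet> y)"
proof -
  have c: "0 < 1 - y0 \<bullet> y" using inner_less_1[OF assms] by simp
  have "(coord y)\<^sup>2 * (1 - y0 \<bullet> y)\<^sup>2 = 1 - (y0 \<bullet> y)\<^sup>2"
    using coord_mult[OF assms(1,1,2,2)] assms(1) by (simp add: power2_eq_square dot_square_norm)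
  also have "\<dots> = (1 + y0 \<bullet> y) * (1 - y0 \<bullet> y)" by (simp add: power2_eq_square algebra_simps)
  finally have "(coord y)\<^sup>2 * (1 - y0 \<bullet> y) = 1 + y0 \<bullet> y"
    using c by (simp add: power2_eq_square)
  then have "(1 + (coord y)\<^sup>2) * (1 - y0 \<bullet> y) = 2" by (simp add: algebra_simps)
  then show ?thesis using c by (simp add: jap_def field_simps)
qed

lemma dist_pole:
  assumes "norm y = 1" "y \<noteq> y0"
  shows "dist y y0 = 2 / jap (coord y)"
proof -
  have c: "0 < 1 - y0 \<bullet> y" using inner_less_1[OF assms] by simp
  have "(dist y y0)\<^sup>2 = 2 - 2 * (y0 \<bullet> y)"
    using y0 assms(1) by (simp add: dist_norm power2_norm_eq_inner inner_diff inner_commute) (simp add: dot_square_norm)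
  also have "\<dots> = (2 / jap (coord y))\<^sup>2"
    using c by (simp add: power_divide jap_coord[OF assms])
  finally show ?thesis
    by (rule power2_eq_imp_eq) (simp_all add: jap_nonneg)
qed

lemma dist_coord:
  assumes "norm y = 1" "norm y' = 1" "y \<noteq> y0" "y' \<noteq> y0"
  shows "dist y y' = 2 * \<bar>coord y - coord y'\<bar> / (jap (coord y) * jap (coord y'))"
proof -
  let ?c = "y0 \<bullet> y" and ?c' = "y0 \<bullet> y'"
  have c: "0 < 1 - ?c" "0 < 1 - ?c'" using inner_less_1[of y] inner_less_1[of y'] assms by auto
  have j: "(coord y)\<^sup>2 * (1 - ?c) = 1 + ?c" "(coord y')\<^sup>2 * (1 - ?c') = 1 + ?c'"
    using jap_coord[of y] jap_coord[of y'] assms c by (auto simp: jap_def field_simps)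
  have "(2 * \<bar>coord y - coord y'\<bar> / (jap (coord y) * jap (coord y')))\<^sup>2
     = 4 * (coord y - coord y')\<^sup>2 / ((jap (coord y))\<^sup>2 * (jap (coord y'))\<^sup>2)"
    by (simp add: power_divide power_mult_distrib)
  also have "\<dots> = (coord y - coord y')\<^sup>2 * ((1 - ?c) * (1 - ?c'))"
    using c by (simp add: jap_coord assms)
  also have "\<dots> = ((coord y)\<^sup>2 * (1 - ?c)) * (1 - ?c') + ((coord y')\<^sup>2 * (1 - ?c')) * (1 - ?c)
       - 2 * (coord y * coord y' * ((1 - ?c) * (1 - ?c')))"
    by (simp add: power2_eq_square algebra_simps)
  also have "\<dots> = 2 - 2 * (y \<bullet> y')"
    unfolding j coord_mult[OF assms] by (simp add: algebra_simps)
  also have "\<dots> = (dist y y')\<^sup>2"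
    using assms by (simp add: dist_norm power2_norm_eq_inner inner_diff inner_commute) (simp add: dot_square_norm)
  finally have "(dist y y')\<^sup>2 = (2 * \<bar>coord y - coord y'\<bar> / (jap (coord y) * jap (coord y')))\<^sup>2"
    by (rule sym)
  then show ?thesis
    by (rule power2_eq_imp_eq) (simp_all add: jap_nonneg)
qed

end

section \<open>The additive energy bound\<close>

lemma emeasure_tangent_box:
  assumes y0: "norm y0 = 1" and r: "0 \<le> r"
  defines "M \<equiv> line_lebesgue (tangent_line y0)" and "B \<equiv> \<lambda>u. ball (u *\<^sub>R unit_tangent y0) r"
  shows "B u1 \<times> B u2 \<times> B u3 \<times> B u4 \<in> sets (M \<Otimes>\<^sub>M M \<Otimes>\<^sub>M M \<Otimes>\<^sub>M M)"
    and "emeasure (M \<Otimes>\<^sub>M M \<Otimes>\<^sub>M M \<Otimes>\<^sub>M M) (B u1 \<times> B u2 \<times> B u3 \<times> B u4) = ennreal ((2 * r) ^ 4)"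
proof -
  interpret M: sigma_finite_measure M unfolding M_def by (rule sigma_finite_tangent[OF y0])
  interpret M2: sigma_finite_measure "M \<Otimes>\<^sub>M M"
    by (rule sigma_finite_pair_measure) unfold_locales
  interpret M3: sigma_finite_measure "M \<Otimes>\<^sub>M M \<Otimes>\<^sub>M M"
    by (rule sigma_finite_pair_measure) unfold_locales
  have B: "B u \<in> sets M" for u by (simp add: M_def B_def line_lebesgue_tangent[OF y0])
  then show "B u1 \<times> B u2 \<times> B u3 \<times> B u4 \<in> sets (M \<Otimes>\<^sub>M M \<Otimes>\<^sub>M M \<Otimes>\<^sub>M M)" by simp
  have mB: "emeasure M (B u) = ennreal (2 * r)" for u
    unfolding M_def B_def by (rule emeasure_tangent_ball[OF y0 r])
  show "emeasure (M \<Otimes>\<^sub>M M \<Otimes>\<^sub>M M \<Otimes>\<^sub>M M) (B u1 \<times> B u2 \<times> B u3 \<times> B u4) = ennreal ((2 * r) ^ 4)"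
    using B r by (simp add: M.emeasure_pair_measure_Times M2.emeasure_pair_measure_Times
        M3.emeasure_pair_measure_Times mB ennreal_mult[symmetric] power4_eq_xxxx mult.assoc)
qed

lemma walk_count_1_eq_card:
  assumes "finite U"
  shows "(\<Sum>x\<in>U. walks.walk_count U \<tau> 1 x) =
    card {(x, x', b, a) \<in> U \<times> U \<times> U \<times> U. \<bar>x + a - b - x'\<bar> \<le> \<tau>}"
proof -
  interpret walks U \<tau> by standard (rule assms)
  let ?P = "\<lambda>(x, x', b, a). \<bar>x + a - b - x'\<bar> \<le> \<tau>"
  have "real (card {z \<in> U \<times> U \<times> U \<times> U. ?P z}) = (\<Sum>z\<in>U \<times> U \<times> U \<times> U. if ?P z then 1 else 0)"
    using assms by (simp add: sum.If_cases Int_def)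
  also have "\<dots> = (\<Sum>x\<in>U. \<Sum>x'\<in>U. \<Sum>b\<in>U. \<Sum>a\<in>U. if \<bar>x + a - b - x'\<bar> \<le> \<tau> then 1 else 0)"
    by (simp add: sum.cartesian_product case_prod_unfold)
  finally have "real (card {z \<in> U \<times> U \<times> U \<times> U. ?P z}) = (\<Sum>x\<in>U. walk_count 1 x)"
    by (simp add: trans_count_def)
  moreover have "{(x, x', b, a) \<in> U \<times> U \<times> U \<times> U. \<bar>x + a - b - x'\<bar> \<le> \<tau>} = {z \<in> U \<times> U \<times> U \<times> U. ?P z}"
    by auto
  ultimately show ?thesis by simp
qed

lemma powi_minus_4: "(\<alpha>::real) powi (-4) = 1 / \<alpha> ^ 4"
  by (simp add: power_int_def divide_inverse power_inverse)

text \<open>Replacing four entries at a cost of \<open>2 * \<alpha>\<close> each turns the tolerance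
  \<alpha> into \<open>9 * \<alpha>\<close>. A box has measure
  \<open>(4 * \<alpha>) ^ 4 = 256 * \<alpha> ^ 4\<close>, which cancels the normalisation of the
  energy.\<close>

lemma additive_energy_le_walk_count:
  assumes y0: "norm y0 = 1" and U: "finite U" and \<alpha>: "0 < \<alpha>"
    and cover: "\<And>\<eta>. \<eta> \<in> nbhd_in (tangent_line y0) Z \<alpha> \<Longrightarrow> \<exists>u\<in>U. dist (u *\<^sub>R unit_tangent y0) \<eta> < 2 * \<alpha>"
  shows "additive_energy (tangent_line y0) Z \<alpha> \<le> ennreal (256 * (\<Sum>x\<in>U. walks.walk_count U (9 * \<alpha>) 1 x))"
proof -
  let ?e = "unit_tangent y0" and ?M = "line_lebesgue (tangent_line y0)" and ?N = "nbhd_in (tangent_line y0) Z \<alpha>"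
  let ?M4 = "?M \<Otimes>\<^sub>M ?M \<Otimes>\<^sub>M ?M \<Otimes>\<^sub>M ?M"
  define B where "B u = ball (u *\<^sub>R ?e) (2 * \<alpha>)" for u
  define I where "I = {(x, x', b, a) \<in> U \<times> U \<times> U \<times> U. \<bar>x + a - b - x'\<bar> \<le> 9 * \<alpha>}"
  \<comment> \<open>The factors are reordered: the signs of \<eta>1 - \<eta>2 + \<eta>3 - \<eta>4
    belong to x - b + a - x'.\<close>
  define Box where "Box = (\<lambda>(x, x', b, a). B x \<times> B b \<times> B a \<times> B x')"
  have finI: "finite I"
  proof (rule finite_subset)
    show "I \<subseteq> U \<times> U \<times> U \<times> U" by (auto simp: I_def)
  qed (use U in simp)
  have Box: "Box q \<in> sets ?M4" "emeasure ?M4 (Box q) = ennreal (256 * \<alpha> ^ 4)" for q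
    using emeasure_tangent_box[OF y0, of "2 * \<alpha>"] \<alpha>
    by (auto simp: Box_def B_def power_mult_distrib split: prod.split)
  have "{(\<eta>1, \<eta>2, \<eta>3, \<eta>4). \<eta>1 \<in> ?N \<and> \<eta>2 \<in> ?N \<and> \<eta>3 \<in> ?N \<and> \<eta>4 \<in> ?N \<and> norm (\<eta>1 - \<eta>2 + \<eta>3 - \<eta>4) \<le> \<alpha>}
    \<subseteq> (\<Union>q\<in>I. Box q)"
  proof clarify
    fix \<eta>1 \<eta>2 \<eta>3 \<eta>4 assume N: "\<eta>1 \<in> ?N" "\<eta>2 \<in> ?N" "\<eta>3 \<in> ?N" "\<eta>4 \<in> ?N" and le: "norm (\<eta>1 - \<eta>2 + \<eta>3 - \<eta>4) \<le> \<alpha>"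
    obtain x b a x' where u: "x \<in> U" "b \<in> U" "a \<in> U" "x' \<in> U"
      and d: "norm (x *\<^sub>R ?e - \<eta>1) < 2 * \<alpha>" "norm (b *\<^sub>R ?e - \<eta>2) < 2 * \<alpha>"
        "norm (a *\<^sub>R ?e - \<eta>3) < 2 * \<alpha>" "norm (x' *\<^sub>R ?e - \<eta>4) < 2 * \<alpha>"
      using cover[OF N(1)] cover[OF N(2)] cover[OF N(3)] cover[OF N(4)] unfolding dist_norm by blast
    have "\<bar>x + a - b - x'\<bar> = norm ((x + a - b - x') *\<^sub>R ?e)"
      by (simp add: norm_unit_tangent[OF y0])
    also have "(x + a - b - x') *\<^sub>R ?e = (x *\<^sub>R ?e - \<eta>1) - (b *\<^sub>R ?e - \<eta>2) + (a *\<^sub>R ?e - \<eta>3) - (x' *\<^sub>R ?e - \<eta>4)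
        + (\<eta>1 - \<eta>2 + \<eta>3 - \<eta>4)"
      by (simp add: algebra_simps)
    also have "norm \<dots> \<le> norm (x *\<^sub>R ?e - \<eta>1) + norm (b *\<^sub>R ?e - \<eta>2) + norm (a *\<^sub>R ?e - \<eta>3)
        + norm (x' *\<^sub>R ?e - \<eta>4) + norm (\<eta>1 - \<eta>2 + \<eta>3 - \<eta>4)"
      by (intro norm_triangle_mono norm_triangle_le_diff order_refl add_mono)
    also have "\<dots> \<le> 9 * \<alpha>" using d le by linarith
    finally have "(x, x', b, a) \<in> I" using u by (simp add: I_def)
    moreover have "(\<eta>1, \<eta>2, \<eta>3, \<eta>4) \<in> Box (x, x', b, a)"
      using d by (simp add: Box_def B_def dist_norm)
    ultimately show "(\<eta>1, \<eta>2, \<eta>3, \<eta>4) \<in> (\<Union>q\<in>I. Box q)" by blast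
  qed
  then have "emeasure ?M4 {(\<eta>1, \<eta>2, \<eta>3, \<eta>4). \<eta>1 \<in> ?N \<and> \<eta>2 \<in> ?N \<and> \<eta>3 \<in> ?N \<and> \<eta>4 \<in> ?N \<and> norm (\<eta>1 - \<eta>2 + \<eta>3 - \<eta>4) \<le> \<alpha>}
    \<le> emeasure ?M4 (\<Union>q\<in>I. Box q)"
    using finI Box(1) by (intro emeasure_mono) auto
  also have "\<dots> \<le> (\<Sum>q\<in>I. emeasure ?M4 (Box q))"
    using finI Box(1) by (intro emeasure_subadditive_finite) auto
  also have "\<dots> = ennreal (card I * (256 * \<alpha> ^ 4))"
    using \<alpha> by (simp add: Box(2) ennreal_mult ennreal_of_nat_eq_real_of_nat)
  finally have "additive_energy (tangent_line y0) Z \<alpha> \<le> ennreal (1 / \<alpha> ^ 4) * ennreal (card I * (256 * \<alpha> ^ 4))"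
    unfolding additive_energy_def powi_minus_4 by (intro mult_left_mono) auto
  also have "\<dots> = ennreal (256 * card I)"
    using \<alpha> by (simp add: ennreal_mult[symmetric])
  finally show ?thesis
    unfolding I_def walk_count_1_eq_card[OF U] by simp
qed

text \<open>The trivial bound, which serves for \<alpha> bounded away from 0, where the discrete
  estimate does not apply.\<close>

lemma additive_energy_crude:
  assumes y0: "norm y0 = 1" and \<alpha>: "0 < \<alpha>" "\<alpha> \<le> 1" and Z: "Z \<subseteq> ball 0 R" and R: "0 \<le> R"
  shows "additive_energy (tangent_line y0) Z \<alpha> \<le> ennreal ((2 * (R + 1)) ^ 4 / \<alpha> ^ 4)"
proof -
  let ?M = "line_lebesgue (tangent_line y0)" and ?N = "nbhd_in (tangent_line y0) Z \<alpha>"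
  let ?M4 = "?M \<Otimes>\<^sub>M ?M \<Otimes>\<^sub>M ?M \<Otimes>\<^sub>M ?M"
  let ?B = "ball (0 *\<^sub>R unit_tangent y0) (R + 1)"
  have R1: "0 \<le> R + 1" using R by simp
  have N: "?N \<subseteq> ?B"
  proof
    fix \<eta> assume "\<eta> \<in> ?N"
    then obtain z where "z \<in> Z" "dist z \<eta> < \<alpha>" by (auto simp: nbhd_in_def)
    moreover from this have "norm z < R" using Z by auto
    ultimately show "\<eta> \<in> ?B" using \<alpha> norm_triangle_sub[of \<eta> z] by (simp add: dist_norm norm_minus_commute)
  qed
  note box = emeasure_tangent_box[OF y0 R1, of 0 0 0 0]
  have "emeasure ?M4 {(\<eta>1, \<eta>2, \<eta>3, \<eta>4). \<eta>1 \<in> ?N \<and> \<eta>2 \<in> ?N \<and> \<eta>3 \<in> ?N \<and> \<eta>4 \<in> ?N \<and> norm (\<eta>1 - \<eta>2 + \<eta>3 - \<eta>4) \<le> \<alpha>}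
    \<le> emeasure ?M4 (?B \<times> ?B \<times> ?B \<times> ?B)"
    using N by (intro emeasure_mono box(1)) auto
  also have "\<dots> = ennreal ((2 * (R + 1)) ^ 4)" by (rule box(2))
  finally have "additive_energy (tangent_line y0) Z \<alpha> \<le> ennreal (1 / \<alpha> ^ 4) * ennreal ((2 * (R + 1)) ^ 4)"
    unfolding additive_energy_def powi_minus_4 by (intro mult_left_mono) auto
  also have "\<dots> = ennreal ((2 * (R + 1)) ^ 4 / \<alpha> ^ 4)"
    using \<alpha> R by (simp add: ennreal_mult[symmetric])
  finally show ?thesis .
qed

lemma regular_set_sphereD:
  fixes X :: "(real^2) set"
  assumes "regular_set (sphere 0 1) X \<delta> C" "y \<in> X" "0 < r" "r < 2"
  shows "ennreal (inverse C * r powr \<delta>) \<le> hausdorff_measure \<delta> (X \<inter> ball y r)"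
    and "hausdorff_measure \<delta> (X \<inter> ball y r) \<le> ennreal (C * r powr \<delta>)"
proof -
  have "dist (axis 1 1) (- axis 1 1 :: real^2) \<le> diameter (sphere 0 1 :: (real^2) set)"
    by (intro diameter_bounded_bound) auto
  also have "dist (axis 1 1) (- axis 1 1 :: real^2) = norm (2 *\<^sub>R axis 1 1 :: real^2)"
    by (simp only: dist_norm scaleR_2 diff_minus_eq_add)
  also have "\<dots> = 2" by simp
  finally have "r < diameter (sphere 0 1 :: (real^2) set)" using assms(4) by simp
  then show "ennreal (inverse C * r powr \<delta>) \<le> hausdorff_measure \<delta> (X \<inter> ball y r)"
    and "hausdorff_measure \<delta> (X \<inter> ball y r) \<le> ennreal (C * r powr \<delta>)"
    using assms(1-3) unfolding regular_set_def by blast+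
qed

lemma additive_energy_bound_of_regular:
  fixes \<Lambda> :: "(real^2) set" and k :: nat
  assumes \<Lambda>: "\<Lambda> \<subseteq> sphere 0 1" and reg: "regular_set (sphere 0 1) \<Lambda> \<delta> C"
    and \<delta>: "0 < \<delta>" "\<delta> < 1" and C: "1 \<le> C" "32 * C\<^sup>2 \<le> 2 ^ k" and k: "1 \<le> k"
    and \<beta>: "0 < \<beta>" "\<beta> \<le> \<delta> * exp (- 20000000 * (real k ^ 2 / (1 - \<delta>))\<^sup>2)"
  shows "additive_energy_bound \<Lambda> \<delta> \<beta>"
  unfolding additive_energy_bound_def
proof (intro conjI \<beta>(1) allI impI)
  fix C1 :: real assume C1: "0 < C1"
  \<comment> \<open>Room for net points within \<alpha> < 1 of a coordinate of absolute value below
    \<open>C1\<close>.\<close>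
  define M where "M = C1 + 1"
  have M: "0 \<le> M" using C1 by (simp add: M_def)
  let ?\<beta> = "\<delta> * exp (- 20000000 * (real k ^ 2 / (1 - \<delta>))\<^sup>2)"
  obtain Cd \<alpha>0 where Cd: "0 < Cd" "0 < \<alpha>0" "\<alpha>0 \<le> 1/152"
    and main: "\<And>\<alpha> V. \<alpha> < \<alpha>0 \<Longrightarrow> regular_net V \<alpha> \<delta> k \<Longrightarrow>
       (\<Sum>x\<in>V \<inter> {-M..M}. walks.walk_count (V \<inter> {-M..M}) (9 * \<alpha>) 1 x) \<le> Cd * \<alpha> powr (- 3 * \<delta> + ?\<beta>)"
    using discrete_energy_bound[OF \<delta> k M] by blast
  define Cr where "Cr = (2 * (C1 + 1)) ^ 4 / \<alpha>0 ^ 4"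
  have Cr: "0 \<le> Cr" using C1 Cd by (simp add: Cr_def)
  define C' where "C' = 256 * Cd + Cr"
  show "\<exists>C'>0. \<forall>\<alpha>\<in>{0<..<1}.
      (SUP y0\<in>\<Lambda>. additive_energy (tangent_line y0) (stereo y0 ` (\<Lambda> - {y0}) \<inter> ball 0 C1) \<alpha>)
        \<le> ennreal (C' * \<alpha> powr (- 3 * \<delta> + \<beta>))"
  proof (intro exI[of _ C'] conjI ballI SUP_least)
    show "0 < C'" using Cd Cr by (simp add: C'_def add_pos_nonneg)
    fix \<alpha> :: real and y0 assume \<alpha>: "\<alpha> \<in> {0<..<1}" and y0\<Lambda>: "y0 \<in> \<Lambda>"
    have y0: "norm y0 = 1" using \<Lambda> y0\<Lambda> by auto
    let ?e = "unit_tangent y0"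
    let ?x = "\<lambda>y. stereo y0 y \<bullet> ?e"
    define Z where "Z = stereo y0 ` (\<Lambda> - {y0}) \<inter> ball 0 C1"
    \<comment> \<open>Makes the exponent \<open>- 3 * \<delta> + \<beta>\<close> nonpositive, so the
      power of \<alpha> is at least 1 and a constant suffices for \<alpha> \<ge> \<alpha>0.\<close>
    have \<beta>\<delta>: "\<beta> \<le> \<delta>"
    proof -
      have "?\<beta> \<le> \<delta> * 1" using \<delta> by (intro mult_left_mono) auto
      then show ?thesis using \<beta>(2) by simp
    qed
    have "additive_energy (tangent_line y0) Z \<alpha> \<le> ennreal (C' * \<alpha> powr (- 3 * \<delta> + \<beta>))"
    proof (cases "\<alpha> < \<alpha>0")
      case True
      have \<alpha>pos: "0 < \<alpha>" using \<alpha> by simp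
      obtain V where V: "V \<subseteq> ?x ` (\<Lambda> - {y0})" "separated \<alpha> V"
        and net: "\<And>t. t \<in> ?x ` (\<Lambda> - {y0}) \<Longrightarrow> \<exists>u\<in>V. dist t u < \<alpha>"
      proof (rule ex_separated_net[OF \<alpha>pos, of "?x ` (\<Lambda> - {y0})"])
        fix Z assume "Z \<subseteq> ?x ` (\<Lambda> - {y0})" "separated \<alpha> Z"
          "\<And>t. t \<in> ?x ` (\<Lambda> - {y0}) \<Longrightarrow> \<exists>u\<in>Z. dist t u < \<alpha>"
        then show thesis by (rule that)
      qed
      have rn: "regular_net V \<alpha> \<delta> k"
      proof (rule regular_net_of_chart[OF regular_set_sphereD[OF reg] _ _ V net _ \<delta> C])
        show "dist y y' = 2 * \<bar>?x y - ?x y'\<bar> / (jap (?x y) * jap (?x y'))"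
          if "y \<in> \<Lambda> - {y0}" "y' \<in> \<Lambda> - {y0}" for y y'
          using that \<Lambda> by (intro dist_coord[OF y0]) auto
        show "dist y y0 = 2 / jap (?x y)" if "y \<in> \<Lambda> - {y0}" for y
          using that \<Lambda> by (intro dist_pole[OF y0]) auto
      qed (use \<alpha> in auto)
      let ?U = "V \<inter> {-M..M}"
      have finU: "finite ?U"
        by (rule regular_net_Icc(1)[OF rn _ M]) (use True Cd in linarith)
      have "additive_energy (tangent_line y0) Z \<alpha> \<le> ennreal (256 * (\<Sum>x\<in>?U. walks.walk_count ?U (9 * \<alpha>) 1 x))"
      proof (rule additive_energy_le_walk_count[OF y0 finU])
        show "0 < \<alpha>" using \<alpha> by simp
        fix \<eta> assume "\<eta> \<in> nbhd_in (tangent_line y0) Z \<alpha>"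
        then obtain z where z: "z \<in> Z" "dist z \<eta> < \<alpha>" by (auto simp: nbhd_in_def)
        then obtain y where "y \<in> \<Lambda> - {y0}" "z = stereo y0 y" "z \<in> ball 0 C1"
          unfolding Z_def by blast
        then have y: "y \<in> \<Lambda> - {y0}" "stereo y0 y \<in> ball 0 C1" "dist (stereo y0 y) \<eta> < \<alpha>"
          using z by simp_all
        have st: "stereo y0 y = ?x y *\<^sub>R ?e" by (rule stereo_coord[OF y0])
        have "\<bar>?x y\<bar> < C1"
        proof -
          have "norm (stereo y0 y) = \<bar>?x y\<bar>" by (subst st) (simp add: norm_unit_tangent[OF y0])
          then show ?thesis using y(2) by simp
        qed
        moreover obtain u where u: "u \<in> V" "\<bar>?x y - u\<bar> < \<alpha>" using net y(1) by (auto simp: dist_real_def)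
        ultimately have "u \<in> ?U" using \<alpha> by (auto simp: M_def)
        moreover have "dist (u *\<^sub>R ?e) (stereo y0 y) < \<alpha>"
        proof -
          have "dist (u *\<^sub>R ?e) (stereo y0 y) = \<bar>u - ?x y\<bar>"
            by (subst st) (simp add: dist_norm scaleR_diff_left[symmetric] norm_unit_tangent[OF y0])
          then show ?thesis using u(2) by (simp add: abs_minus_commute)
        qed
        then have "dist (u *\<^sub>R ?e) \<eta> < 2 * \<alpha>"
          using dist_triangle[of "u *\<^sub>R ?e" \<eta> "stereo y0 y"] y(3) by linarith
        ultimately show "\<exists>u\<in>?U. dist (u *\<^sub>R ?e) \<eta> < 2 * \<alpha>" by blast
      qed
      also have "\<dots> \<le> ennreal (256 * (Cd * \<alpha> powr (- 3 * \<delta> + ?\<beta>)))"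
        using main[OF True rn] by (intro ennreal_leI mult_left_mono) auto
      also have "\<dots> \<le> ennreal (C' * \<alpha> powr (- 3 * \<delta> + \<beta>))"
      proof (rule ennreal_leI)
        have "256 * (Cd * \<alpha> powr (- 3 * \<delta> + ?\<beta>)) = (256 * Cd) * \<alpha> powr (- 3 * \<delta> + ?\<beta>)" by simp
        also have "\<dots> \<le> C' * \<alpha> powr (- 3 * \<delta> + \<beta>)"
          using \<alpha> \<beta>(2) Cr Cd by (intro mult_mono powr_mono') (auto simp: C'_def)
        finally show "256 * (Cd * \<alpha> powr (- 3 * \<delta> + ?\<beta>)) \<le> C' * \<alpha> powr (- 3 * \<delta> + \<beta>)" .
      qed
      finally show ?thesis .
    next
      case False
      have "additive_energy (tangent_line y0) Z \<alpha> \<le> ennreal ((2 * (C1 + 1)) ^ 4 / \<alpha> ^ 4)"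
        using \<alpha> C1 by (intro additive_energy_crude[OF y0]) (auto simp: Z_def)
      also have "\<dots> \<le> ennreal Cr"
        unfolding Cr_def using False Cd \<alpha> C1 by (intro ennreal_leI divide_left_mono power_mono) auto
      also have "\<dots> \<le> ennreal (C' * \<alpha> powr (- 3 * \<delta> + \<beta>))"
      proof (rule ennreal_leI)
        have "\<alpha> powr 0 \<le> \<alpha> powr (- 3 * \<delta> + \<beta>)"
          using \<alpha> \<beta>\<delta> \<delta> by (intro powr_mono') auto
        then have "Cr * 1 \<le> C' * \<alpha> powr (- 3 * \<delta> + \<beta>)"
          using \<alpha> Cr Cd by (intro mult_mono) (auto simp: C'_def)
        then show "Cr \<le> C' * \<alpha> powr (- 3 * \<delta> + \<beta>)" by simp
      qed
      finally show ?thesis .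
    qed
    then show "additive_energy (tangent_line y0) (stereo y0 ` (\<Lambda> - {y0}) \<inter> ball 0 C1) \<alpha>
        \<le> ennreal (C' * \<alpha> powr (- 3 * \<delta> + \<beta>))" by (simp add: Z_def)
  qed
qed

text \<open>32 is \<open>2 ^ 5\<close>, and doubling the logarithm of \<open>C\<close> to base 2
  gives at most \<open>3 * ln C\<close> because ln 2 \<ge> 2/3; rounding up turns the 5 into
  6.\<close>

lemma ex_power2_regularity:
  fixes C :: real
  assumes "1 \<le> C"
  obtains k :: nat where "1 \<le> k" "32 * C\<^sup>2 \<le> 2 ^ k" "k \<le> 6 + 3 * ln C"
proof -
  define k where "k = nat \<lceil>5 + 3 * ln C\<rceil>"
  have l: "0 \<le> ln C" using assms by simp
  then have k: "5 + 3 * ln C \<le> k" "k \<le> 6 + 3 * ln C" unfolding k_def by linarith+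
  have "ln (32 * C\<^sup>2) = ln (2 ^ 5 * C\<^sup>2)" by simp
  also have "\<dots> = 5 * ln 2 + 2 * ln C"
    using assms by (subst ln_mult_pos) (auto simp only: ln_realpow, auto)
  also have "\<dots> \<le> (5 + 3 * ln C) * ln 2"
  proof -
    have "2 * ln C \<le> (3 * ln 2) * ln C" using ln2_ge_two_thirds l by (intro mult_right_mono) auto
    then show ?thesis by (simp add: algebra_simps)
  qed
  also have "\<dots> \<le> k * ln 2" using k(1) by (intro mult_right_mono) auto
  also have "\<dots> = ln (2 ^ k)" by (simp add: ln_realpow)
  finally have "32 * C\<^sup>2 \<le> 2 ^ k" using assms by (subst (asm) ln_le_cancel_iff) auto
  moreover have "1 \<le> k" using k(1) l by linarith
  ultimately show ?thesis using that k(2) by blast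
qed

text \<open>The argument produces the square of 1 / (1 - \<delta>) and the fourth power of 1 + log
  C; both are dominated by the powers 28 and 14. The constant is 20000000 times 20736, where 20736
  is \<open>6 ^ 4 * 2 ^ 4\<close>.\<close>

lemma exponent_comparison:
  fixes \<delta> x :: real and k :: nat
  assumes \<delta>: "0 < \<delta>" "\<delta> < 1" and x: "0 \<le> x" and k: "k \<le> 6 + 3 * x"
  shows "20000000 * (real k ^ 2 / (1 - \<delta>))\<^sup>2 \<le> 414720000000 * (1 - \<delta>) powi (-28) * (1 + x ^ 14)"
proof -
  have "real k ^ 4 \<le> (6 * (1 + x)) ^ 4" using k x by (intro power_mono) auto
  also have "\<dots> = 1296 * (1 + x) ^ 4" by (simp only: power_mult_distrib) simp
  also have "\<dots> \<le> 1296 * (16 * (1 + x ^ 14))"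
  proof (rule mult_left_mono)
    show "(1 + x) ^ 4 \<le> 16 * (1 + x ^ 14)"
    proof (cases "x \<le> 1")
      case True
      then have "(1 + x) ^ 4 \<le> 2 ^ 4" using x by (intro power_mono) auto
      also have "\<dots> \<le> 16 * (1 + x ^ 14)" using x by simp
      finally show ?thesis .
    next
      case False
      then have "(1 + x) ^ 4 \<le> (2 * x) ^ 4" using x by (intro power_mono) auto
      also have "\<dots> = 16 * x ^ 4" by (simp only: power_mult_distrib) simp
      also have "x ^ 4 \<le> x ^ 14" using False by (intro power_increasing) auto
      finally show ?thesis by simp
    qed
  qed simp
  finally have k4: "real k ^ 4 \<le> 20736 * (1 + x ^ 14)" by simp
  have "(1 / (1 - \<delta>)) ^ 2 \<le> (1 / (1 - \<delta>)) ^ 28" using \<delta> by (intro power_increasing) auto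
  also have "\<dots> = (1 - \<delta>) powi (-28)" by (simp add: power_int_def power_divide divide_inverse power_inverse)
  finally have d: "(1 / (1 - \<delta>)) ^ 2 \<le> (1 - \<delta>) powi (-28)" .
  have "(real k ^ 2 / (1 - \<delta>))\<^sup>2 = (1 / (1 - \<delta>)) ^ 2 * real k ^ 4"
    by (simp add: power_divide power_mult[symmetric])
  also have "\<dots> \<le> (1 - \<delta>) powi (-28) * (20736 * (1 + x ^ 14))"
    using d k4 \<delta> by (intro mult_mono) auto
  finally have "(real k ^ 2 / (1 - \<delta>))\<^sup>2 \<le> (1 - \<delta>) powi (-28) * (20736 * (1 + x ^ 14))" .
  moreover have "20000000 * t \<le> 414720000000 * d * u" if "t \<le> d * (20736 * u)" for t d u :: real
    using that by simp
  ultimately show ?thesis by blast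
qed

theorem theorem5:
  shows "\<exists>K::real. K > 0 \<and>
    (\<forall>(\<Gamma> :: (real^3^3) set) (\<delta>::real) (C::real).
       convex_cocompact \<Gamma> \<and> limit_set_dimension \<Gamma> \<delta> \<and> 0 < \<delta> \<and> \<delta> < 1 \<and>
       C \<ge> 1 \<and> regular_set (sphere 0 1) (limit_set \<Gamma>) \<delta> C \<longrightarrow>
       additive_energy_bound (limit_set \<Gamma>) \<delta>
         (\<delta> * exp (- K * (1 - \<delta>) powi (-28) * (1 + (ln C) ^ 14))))"
proof (intro exI[of _ 414720000000] conjI allI impI; (elim conjE)?)
  fix \<Gamma> :: "(real^3^3) set" and \<delta> C :: real
  assume \<delta>: "0 < \<delta>" "\<delta> < 1" and C: "C \<ge> 1" and reg: "regular_set (sphere 0 1) (limit_set \<Gamma>) \<delta> C"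
  obtain k :: nat where k: "1 \<le> k" "32 * C\<^sup>2 \<le> 2 ^ k" "k \<le> 6 + 3 * ln C"
    using ex_power2_regularity[OF C] by blast
  have "limit_set \<Gamma> \<subseteq> sphere 0 1" by (auto simp: limit_set_def limit_set_from_def)
  then show "additive_energy_bound (limit_set \<Gamma>) \<delta>
      (\<delta> * exp (- 414720000000 * (1 - \<delta>) powi (-28) * (1 + (ln C) ^ 14)))"
  proof (rule additive_energy_bound_of_regular[OF _ reg \<delta> C k(2,1)])
    have "20000000 * (real k ^ 2 / (1 - \<delta>))\<^sup>2 \<le> 414720000000 * (1 - \<delta>) powi (-28) * (1 + (ln C) ^ 14)"
      using C k(3) by (intro exponent_comparison[OF \<delta>]) auto
    then show "\<delta> * exp (- 414720000000 * (1 - \<delta>) powi (-28) * (1 + (ln C) ^ 14))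
        \<le> \<delta> * exp (- 20000000 * (real k ^ 2 / (1 - \<delta>))\<^sup>2)"
      using \<delta> by (intro mult_left_mono) auto
  qed (use \<delta> in simp)
qed simp

end
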